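(* Consider the standard batched kernelized bandit setting on $\mathcal{X}=[0,1]^d$ with time horizon $T$ and $B$ batches ($T\ge B\ge2$), where $B$ may be constant or grow with $T$. For any batched algorithm using $B$ adaptive batches and any $\delta\in(0,\frac{1}{11B})$, there exists $f$ with $\|f\|_k\le\Psi$ such that with probability at least $\delta$: - if $k$ is the SE kernel, then with $\eta=\frac12$, $$R_T=\Omega\Bigl(B^{-2}\,T^{\frac{1-\eta}{1-\eta^B}}(\log T)^{\frac{d\eta(\eta-\eta^B)}{1-\eta^B}}\Bigr);$$ - if $k$ is the Mat\'ern kernel with smoothness $\nu$, then with $\eta=\frac{\nu}{2\nu+d}$, $$R_T=\Omega\Bigl(B^{-(2\eta+1)}\,T^{\frac{1-\eta}{1-\eta^B}}\Bigr).$$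
   Context: Standard setting. An unknown function $f:\mathcal{X}\to\mathbb{R}$ lies in the RKHS of kernel $k$ with $\|f\|_k\le\Psi$, $\Psi>0$. Kernels: $k_{\rm SE}(x,x')=\exp\bigl(-\frac{\|x-x'\|^2}{2l^2}\bigr)$, or $k_{\text{Mat\'ern}}(x,x')=\frac{2^{1-\nu}}{\Gamma(\nu)}\bigl(\frac{\sqrt{2\nu}\|x-x'\|}{l}\bigr)^{\nu}J_\nu\bigl(\frac{\sqrt{2\nu}\|x-x'\|}{l}\bigr)$ with $J_\nu$ the modified Bessel function (of the second kind), $l,\nu>0$. At each time $t\in\{1,\dots,T\}$ the algorithm selects $x_t\in\mathcal{X}$, generating $y_t=f(x_t)+z_t$ with $z_t\sim N(0,\sigma^2)$ independent over $t$. There are times $0=t_0<t_1<\dots<t_B=T$; the $i$-th batch is $\{t:t_{i-1}<t\le t_i\}$, and every $y_t$ with $t\in(t_{i-1},t_i]$ is revealed only at the end of time $t_i$. Adaptive batches: $t_1$ is predetermined, and for $i\ge2$, $t_i$ is chosen at the end of time $t_{i-1}$, i.e. after receiving the observations of batch $i-1$ (and may depend on all observations received so far). Each $x_t$ may depend only on the observations revealed before time $t$ (and internal randomness). Regret: $R_T=\sum_{t=1}^T(f(x^* )-f(x_t))$ with $x^*\in\arg\max_{x\in\mathcal{X}}f(x)$. Asymptotics: $T\to\infty$ with $d,\nu,l,\Psi,\sigma$ fixed constants; the implied constants do not depend on $T$, $B$ or the algorithm, and $f$ may depend on $T$, $B$, $\delta$ and the algorithm. *)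

theory Defs
  imports "HOL-Probability.Probability"
begin

definition unit_cube :: "(real ^ 'd) set" where
  "unit_cube = {x. \<forall>i. 0 \<le> x $ i \<and> x $ i \<le> 1}"

definition se_kernel :: "real \<Rightarrow> 'a::real_normed_vector \<Rightarrow> 'a \<Rightarrow> real" where
  "se_kernel l x x' = exp (- ((norm (x - x'))\<^sup>2 / (2 * l\<^sup>2)))"

(* Modified Bessel function of the second kind of real order, for positive argument z
   (Schlaefli's integral). *)
definition bessel_K :: "real \<Rightarrow> real \<Rightarrow> real" where
  "bessel_K \<nu> z = (LBINT t:{0..}. exp (- z * cosh t) * cosh (\<nu> * t))"

(* The closed formula is singular on the diagonal, where the kernel takes its limit value 1. *)
definition matern_kernel :: "real \<Rightarrow> real \<Rightarrow> 'a::real_normed_vector \<Rightarrow> 'a \<Rightarrow> real" where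
  "matern_kernel \<nu> l x x' =
     (if x = x' then 1
      else 2 powr (1 - \<nu>) / Gamma \<nu> * (sqrt (2 * \<nu>) * norm (x - x') / l) powr \<nu>
             * bessel_K \<nu> (sqrt (2 * \<nu>) * norm (x - x') / l))"

(* H with inner product ip is a Hilbert space of real functions on X with reproducing kernel k.
   A function on X is represented by its extension by 0 to the whole type. *)
locale rkhs =
  fixes X :: "'a set"
    and k :: "'a \<Rightarrow> 'a \<Rightarrow> real"
    and H :: "('a \<Rightarrow> real) set"
    and ip :: "('a \<Rightarrow> real) \<Rightarrow> ('a \<Rightarrow> real) \<Rightarrow> real"
  assumes zero_outside: "f \<in> H \<Longrightarrow> x \<notin> X \<Longrightarrow> f x = 0"
    and zero_mem: "(\<lambda>x. 0) \<in> H"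
    and add_mem: "f \<in> H \<Longrightarrow> g \<in> H \<Longrightarrow> (\<lambda>x. f x + g x) \<in> H"
    and scale_mem: "f \<in> H \<Longrightarrow> (\<lambda>x. a * f x) \<in> H"
    and ip_commute: "f \<in> H \<Longrightarrow> g \<in> H \<Longrightarrow> ip f g = ip g f"
    and ip_add: "f \<in> H \<Longrightarrow> g \<in> H \<Longrightarrow> h \<in> H \<Longrightarrow> ip (\<lambda>x. f x + g x) h = ip f h + ip g h"
    and ip_scale: "f \<in> H \<Longrightarrow> g \<in> H \<Longrightarrow> ip (\<lambda>x. a * f x) g = a * ip f g"
    and ip_nonneg: "f \<in> H \<Longrightarrow> 0 \<le> ip f f"
    and ip_eq_zero: "f \<in> H \<Longrightarrow> ip f f = 0 \<Longrightarrow> f = (\<lambda>x. 0)"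
    and complete: "Metric_space.mcomplete H
          (\<lambda>f g. sqrt (ip (\<lambda>x. f x - g x) (\<lambda>x. f x - g x)))"
    and kernel_mem: "x \<in> X \<Longrightarrow> (\<lambda>y. if y \<in> X then k x y else 0) \<in> H"
    and reproducing: "f \<in> H \<Longrightarrow> x \<in> X \<Longrightarrow> ip f (\<lambda>y. if y \<in> X then k x y else 0) = f x"

(* The pair (H, ip on H) is determined by X and k, so this says that f lies in the RKHS of k
   with norm at most r. *)
definition in_rkhs_ball :: "'a set \<Rightarrow> ('a \<Rightarrow> 'a \<Rightarrow> real) \<Rightarrow> real \<Rightarrow> ('a \<Rightarrow> real) \<Rightarrow> bool" where
  "in_rkhs_ball X k r f \<longleftrightarrow> (\<exists>H ip. rkhs X k H ip \<and> f \<in> H \<and> sqrt (ip f f) \<le> r)"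

(* The internal randomness is one draw u from the law seed_law, an arbitrary probability measure
   on real sequences.  Its type is fixed rather than a type parameter so that constants
   quantified before the algorithm cannot depend on it.
   next_end i n (u, h) is the end of batch i (i >= 2) and select t n (u, h) the point played at
   time t, when n is the end of the previous batch and h, in the product space over {1..n},
   holds the observations revealed so far.  The end of the first batch is a constant. *)
record 'a batched_alg =
  seed_law :: "(nat \<Rightarrow> real) measure"
  first_end :: nat
  next_end :: "nat \<Rightarrow> nat \<Rightarrow> (nat \<Rightarrow> real) \<times> (nat \<Rightarrow> real) \<Rightarrow> nat"
  select :: "nat \<Rightarrow> nat \<Rightarrow> (nat \<Rightarrow> real) \<times> (nat \<Rightarrow> real) \<Rightarrow> 'a"

fun batch_end :: "'a batched_alg \<Rightarrow> (nat \<Rightarrow> real) \<Rightarrow> (nat \<Rightarrow> real) \<Rightarrow> nat \<Rightarrow> nat" where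
  "batch_end A u y 0 = 0"
| "batch_end A u y (Suc 0) = first_end A"
| "batch_end A u y (Suc (Suc i)) =
     (let n = batch_end A u y (Suc i) in next_end A (Suc (Suc i)) n (u, restrict y {1..n}))"

definition batched_algorithm ::
    "'a::topological_space set \<Rightarrow> nat \<Rightarrow> nat \<Rightarrow> 'a batched_alg \<Rightarrow> bool" where
  "batched_algorithm X T B A \<longleftrightarrow>
     prob_space (seed_law A) \<and>
     (\<forall>i\<in>{2..B}. \<forall>n<T. next_end A i n
        \<in> seed_law A \<Otimes>\<^sub>M (\<Pi>\<^sub>M j\<in>{1..n}. borel) \<rightarrow>\<^sub>M count_space UNIV) \<and>
     (\<forall>t\<in>{1..T}. \<forall>n<t. select A t n
        \<in> seed_law A \<Otimes>\<^sub>M (\<Pi>\<^sub>M j\<in>{1..n}. borel) \<rightarrow>\<^sub>M borel) \<and>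
     (\<forall>t\<in>{1..T}. \<forall>n<t. \<forall>p\<in>space (seed_law A \<Otimes>\<^sub>M (\<Pi>\<^sub>M j\<in>{1..n}. (borel :: real measure))).
        select A t n p \<in> X) \<and>
     (\<forall>u\<in>space (seed_law A). \<forall>y.
        (\<forall>i<B. batch_end A u y i < batch_end A u y (Suc i)) \<and> batch_end A u y B = T)"

(* Number of observations available when the point for time t >= 1 is chosen: the last batch end
   strictly before t.  For a batched_algorithm it depends only on the values y s with s < t. *)
definition revealed :: "'a batched_alg \<Rightarrow> nat \<Rightarrow> (nat \<Rightarrow> real) \<Rightarrow> (nat \<Rightarrow> real) \<Rightarrow> nat \<Rightarrow> nat" where
  "revealed A B u y t = Max {batch_end A u y i | i. i \<le> B \<and> batch_end A u y i < t}"

definition query :: "'a batched_alg \<Rightarrow> nat \<Rightarrow> (nat \<Rightarrow> real) \<Rightarrow> (nat \<Rightarrow> real) \<Rightarrow> nat \<Rightarrow> 'a" where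
  "query A B u y t = (let n = revealed A B u y t in select A t n (u, restrict y {1..n}))"

(* Observations up to a given time, for objective f, internal randomness u and noise z;
   entries at later times are placeholders. *)
primrec observations ::
    "'a batched_alg \<Rightarrow> nat \<Rightarrow> ('a \<Rightarrow> real) \<Rightarrow> (nat \<Rightarrow> real) \<Rightarrow> (nat \<Rightarrow> real) \<Rightarrow> nat \<Rightarrow> nat \<Rightarrow> real" where
  "observations A B f u z 0 = (\<lambda>_. 0)"
| "observations A B f u z (Suc t) =
     (let y = observations A B f u z t
      in y(Suc t := f (query A B u y (Suc t)) + z (Suc t)))"

definition played ::
    "'a batched_alg \<Rightarrow> nat \<Rightarrow> ('a \<Rightarrow> real) \<Rightarrow> (nat \<Rightarrow> real) \<Rightarrow> (nat \<Rightarrow> real) \<Rightarrow> nat \<Rightarrow> 'a" where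
  "played A B f u z t = query A B u (observations A B f u z (t - 1)) t"

definition regret ::
    "'a batched_alg \<Rightarrow> nat \<Rightarrow> nat \<Rightarrow> ('a \<Rightarrow> real) \<Rightarrow> 'a \<Rightarrow> (nat \<Rightarrow> real) \<Rightarrow> (nat \<Rightarrow> real) \<Rightarrow> real" where
  "regret A B T f xstar u z = (\<Sum>t=1..T. f xstar - f (played A B f u z t))"

definition interaction_law ::
    "'a batched_alg \<Rightarrow> real \<Rightarrow> nat \<Rightarrow> ((nat \<Rightarrow> real) \<times> (nat \<Rightarrow> real)) measure" where
  "interaction_law A \<sigma> T =
     seed_law A \<Otimes>\<^sub>M (\<Pi>\<^sub>M t\<in>{1..T}. density lborel (\<lambda>x. ennreal (normal_density 0 \<sigma> x)))"

end

theory Submission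
  imports Defs "HOL-Real_Asymp.Real_Asymp"
begin

text \<open>Fix thresholds \<open>\<tau>\<^sub>0 \<le> \<tau>\<^sub>1 \<le> \<dots> \<le> \<tau>\<^sub>B = T\<close>. Every run has a batch \<open>j + 1\<close> that starts before
  \<open>\<tau>\<^sub>j\<close> and ends after \<open>\<tau>\<^bsub>j+1\<^esub>\<close>, so for the zero function some fixed \<open>j\<close> is hit with probability
  at least \<open>1/B\<close>. Replace the zero function by one of \<open>M\<close> bumps of height \<open>\<epsilon>\<close> with
  \<open>\<Sum>\<^sub>m f\<^sub>m\<^sup>2 \<le> C \<epsilon>\<^sup>2\<close>. If \<open>\<tau>\<^sub>j \<epsilon>\<^sup>2 / M\<close> is at most a small multiple of \<open>1/B\<close>, then for most \<open>m\<close> the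
  observations of the first \<open>\<tau>\<^sub>j\<close> rounds hardly change in law and the queries of batch \<open>j + 1\<close>
  mostly miss the \<open>m\<close>-th bump, which costs regret of order \<open>\<epsilon> \<tau>\<^bsub>j+1\<^esub>\<close>.

  The bumps have to be small in the RKHS. For the SE kernel they are products of sinc functions of
  width \<open>1/N\<close>, with norm \<open>\<epsilon> e\<^bsup>O(N\<^sup>2)\<^esup>\<close>. The Matern kernel is a mixture of Gaussian kernels
  under a Gamma law of the squared length scale; the part of the mixture with scales near \<open>1/N\<close> is
  itself a bump, with norm \<open>O(\<epsilon> N\<^bsup>\<nu>\<^esup>)\<close>.\<close>

section \<open>The RKHS of a positive semidefinite kernel\<close>

text \<open>Bumps with small RKHS norm have tails, so the cube is not cut into cells owned by one
  bump each. The bound on the sum of squares takes over both duties of disjoint supports: it limits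
  the information leaked about an average bump and, by Cauchy-Schwarz over time, the number of bumps
  that are hit often. Adaptive batch ends are harmless because of a locality property: if batch j
  has ended by \<tau> j, then the end of batch j + 1 and all queries up to that end are functions of
  the observations up to \<tau> j, so only those observations enter the comparison of laws. The
  comparison is a linear inequality between probabilities; it can therefore be integrated over an
  arbitrary seed law and summed over the bumps. The height at stage j is limited by the information
  gathered up to \<tau> j, to order \<tau> j powr (-\<eta>) up to logarithms and B. Making the
  product with \<tau> (j + 1) the same for all j gives \<tau> (j + 1) proportional to \<tau> j powr
  \<eta>; with \<tau> B = T this recursion produces the exponent (1 - \<eta>) / (1 - \<eta>^B). The
  success probability is (3/4 * 3/4 - 3/2 * 1/8) / B = 3/(8 B), which exceeds 1/(11 B).\<close>

lemma additive_bounded_zero: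
  fixes \<psi> :: "real \<Rightarrow> real"
  assumes add: "\<And>s t. \<psi> (s + t) = \<psi> s + \<psi> t" and one: "\<psi> 1 = 0"
    and bnd: "\<And>t. \<bar>t\<bar> \<le> 1 \<Longrightarrow> \<bar>\<psi> t\<bar> \<le> C"
  shows "\<psi> t = 0"
proof -
  have zero: "\<psi> 0 = 0" using add[of 0 0] by simp
  have nat_mult: "\<psi> (real n * s) = real n * \<psi> s" for n s
    by (induction n) (auto simp: zero add algebra_simps)
  have neg: "\<psi> (- s) = - \<psi> s" for s using add[of s "-s"] zero by simp
  have int: "\<psi> (of_int m) = 0" for m
  proof (cases "m \<ge> 0")
    case True
    then show ?thesis using nat_mult[of "nat m" 1] one by simp
  next
    case False
    then show ?thesis using nat_mult[of "nat (- m)" 1] one neg[of "of_int m"] by simp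
  qed
  \<comment> \<open>Vanishing on the integers makes \<psi> periodic with period 1, so the bound near
    0 is global; additivity then turns it into n |\<psi> t| <= C for every n.\<close>
  have all: "\<bar>\<psi> s\<bar> \<le> C" for s
  proof -
    have "\<psi> s = \<psi> (frac s)" using add[of "frac s" "of_int \<lfloor>s\<rfloor>"] int by (simp add: frac_def)
    then show ?thesis using bnd[of "frac s"] frac_lt_1[of s] frac_ge_0[of s] by simp
  qed
  have "real n * \<bar>\<psi> t\<bar> \<le> C" for n
    using all[of "real n * t"] nat_mult[of n t] by (simp add: abs_mult)
  then show ?thesis
    using reals_Archimedean3[of "\<bar>\<psi> t\<bar>"] by (metis abs_ge_zero abs_zero not_le zero_less_abs_iff)
qed

text \<open>The left side is maximal at t = b/a, with value b^2/a; for a = 0 it is linear in t and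
  bounded, which forces b = 0. This is how Cauchy-Schwarz inequalities come out of a norm defined as
  a supremum.\<close>

lemma square_le_of_quadratic:
  fixes a b c :: real
  assumes "\<And>t. 2 * t * b - t\<^sup>2 * a \<le> c" and "0 \<le> a"
  shows "b\<^sup>2 \<le> a * c"
proof (cases "a = 0")
  case True
  have "b = 0"
  proof (rule ccontr)
    assume "b \<noteq> 0"
    then have "2 * ((c + 1) / (2 * b)) * b = c + 1" by simp
    then show False using assms(1)[of "(c + 1) / (2 * b)"] True by simp
  qed
  then show ?thesis using True by simp
next
  case False
  then have "2 * (b / a) * b - (b / a)\<^sup>2 * a = b\<^sup>2 / a"
    by (simp add: field_simps power2_eq_square)
  then have "b\<^sup>2 / a \<le> c" using assms(1)[of "b / a"] by linarith
  then show ?thesis using False assms(2)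
    by (simp add: pos_divide_le_eq mult.commute)
qed

abbreviation kernel_form :: "('a \<Rightarrow> 'a \<Rightarrow> real) \<Rightarrow> 'a set \<Rightarrow> ('a \<Rightarrow> real) \<Rightarrow> real" where
  "kernel_form k S a \<equiv> (\<Sum>x\<in>S. \<Sum>y\<in>S. a x * a y * k x y)"

text \<open>The expression under the supremum that defines the squared norm, for coefficients living
  on S. Every norm estimate for a bump below is a bound on it that is uniform in S and a.\<close>

abbreviation kernel_gap ::
    "('a \<Rightarrow> 'a \<Rightarrow> real) \<Rightarrow> 'a set \<Rightarrow> ('a \<Rightarrow> real) \<Rightarrow> ('a \<Rightarrow> real) \<Rightarrow> real" where
  "kernel_gap k S a f \<equiv> 2 * (\<Sum>x\<in>S. a x * f x) - kernel_form k S a"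

text \<open>The RKHS norm is dual to the kernel form,
  \<open>\<parallel>f\<parallel>\<^sup>2 = sup\<^sub>a 2 \<Sum> a\<^sub>x f(x) - \<Sum> a\<^sub>x a\<^sub>y k(x,y)\<close> over finitely supported \<open>a\<close>. Taken as the definition,
  this realises the RKHS inside the functions on \<open>X\<close> without completing or factoring a space.\<close>

locale psd_kernel =
  fixes X :: "'a set" and k :: "'a \<Rightarrow> 'a \<Rightarrow> real"
  assumes sym: "x \<in> X \<Longrightarrow> y \<in> X \<Longrightarrow> k x y = k y x"
    and psd: "finite S \<Longrightarrow> S \<subseteq> X \<Longrightarrow> 0 \<le> (\<Sum>x\<in>S. \<Sum>y\<in>S. a x * a y * k x y)"
begin

definition coeffs :: "('a \<Rightarrow> real) set" where
  "coeffs = {a. finite {x. a x \<noteq> 0} \<and> {x. a x \<noteq> 0} \<subseteq> X}"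

definition pairing :: "('a \<Rightarrow> real) \<Rightarrow> ('a \<Rightarrow> real) \<Rightarrow> real" where
  "pairing a f = (\<Sum>x | a x \<noteq> 0. a x * f x)"

definition qform :: "('a \<Rightarrow> real) \<Rightarrow> real" where
  "qform a = (\<Sum>x | a x \<noteq> 0. \<Sum>y | a y \<noteq> 0. a x * a y * k x y)"

definition lag :: "('a \<Rightarrow> real) \<Rightarrow> ('a \<Rightarrow> real) \<Rightarrow> real" where
  "lag f a = 2 * pairing a f - qform a"

definition dual :: "('a \<Rightarrow> real) set" where
  "dual = {f. (\<forall>x. x \<notin> X \<longrightarrow> f x = 0) \<and> bdd_above (lag f ` coeffs)}"

definition nsq :: "('a \<Rightarrow> real) \<Rightarrow> real" where
  "nsq f = Sup (lag f ` coeffs)"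

definition ip :: "('a \<Rightarrow> real) \<Rightarrow> ('a \<Rightarrow> real) \<Rightarrow> real" where
  "ip f g = (nsq (\<lambda>x. f x + g x) - nsq (\<lambda>x. f x - g x)) / 4"

lemma pairing_superset:
  assumes "finite S" "{x. a x \<noteq> 0} \<subseteq> S"
  shows "pairing a f = (\<Sum>x\<in>S. a x * f x)"
  unfolding pairing_def using assms by (intro sum.mono_neutral_left) auto

lemma qform_superset:
  assumes "finite S" "{x. a x \<noteq> 0} \<subseteq> S"
  shows "qform a = (\<Sum>x\<in>S. \<Sum>y\<in>S. a x * a y * k x y)"
proof -
  have "qform a = (\<Sum>x | a x \<noteq> 0. \<Sum>y\<in>S. a x * a y * k x y)"
    unfolding qform_def
  proof (rule sum.cong[OF refl])
    show "(\<Sum>y | a y \<noteq> 0. a x * a y * k x y) = (\<Sum>y\<in>S. a x * a y * k x y)" for x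
      using assms by (intro sum.mono_neutral_left) auto
  qed
  also have "\<dots> = (\<Sum>x\<in>S. \<Sum>y\<in>S. a x * a y * k x y)"
    using assms by (intro sum.mono_neutral_left) auto
  finally show ?thesis .
qed

lemma coeffs_zero: "(\<lambda>x. 0) \<in> coeffs"
  by (simp add: coeffs_def)

lemma coeffs_common_support:
  assumes "a \<in> coeffs" "b \<in> coeffs"
  obtains S where "finite S" "S \<subseteq> X" "{x. a x \<noteq> 0} \<subseteq> S" "{x. b x \<noteq> 0} \<subseteq> S"
  using assms by (intro that[of "{x. a x \<noteq> 0} \<union> {x. b x \<noteq> 0}"]) (auto simp: coeffs_def)

lemma comb_support:
  fixes a b :: "'a \<Rightarrow> real"
  assumes "{x. a x \<noteq> 0} \<subseteq> S" "{x. b x \<noteq> 0} \<subseteq> S"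
  shows "{x. s * a x + t * b x \<noteq> 0} \<subseteq> S"
proof
  fix x assume x: "x \<in> {x. s * a x + t * b x \<noteq> 0}"
  show "x \<in> S"
  proof (rule ccontr)
    assume "x \<notin> S"
    then have "a x = 0" "b x = 0" using assms by auto
    then show False using x by simp
  qed
qed

lemma coeffs_comb:
  assumes "a \<in> coeffs" "b \<in> coeffs"
  shows "(\<lambda>x. s * a x + t * b x) \<in> coeffs"
proof -
  obtain S where S: "finite S" "S \<subseteq> X" "{x. a x \<noteq> 0} \<subseteq> S" "{x. b x \<noteq> 0} \<subseteq> S"
    by (rule coeffs_common_support[OF assms])
  have "{x. s * a x + t * b x \<noteq> 0} \<subseteq> S" by (rule comb_support[OF S(3,4)])
  then show ?thesis using S finite_subset by (auto simp: coeffs_def)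
qed

lemma pairing_comb:
  assumes "a \<in> coeffs" "b \<in> coeffs"
  shows "pairing (\<lambda>x. s * a x + t * b x) f = s * pairing a f + t * pairing b f"
proof -
  obtain S where S: "finite S" "{x. a x \<noteq> 0} \<subseteq> S" "{x. b x \<noteq> 0} \<subseteq> S"
    using coeffs_common_support[OF assms] by metis
  have "{x. s * a x + t * b x \<noteq> 0} \<subseteq> S" by (rule comb_support[OF S(2,3)])
  from pairing_superset[OF S(1) this]
  show ?thesis
    unfolding pairing_superset[OF S(1,2)] pairing_superset[OF S(1,3)]
      sum_distrib_left sum.distrib[symmetric] by (simp add: algebra_simps)
qed

lemma pairing_fun_comb: "pairing a (\<lambda>x. s * f x + t * g x) = s * pairing a f + t * pairing a g"
  by (simp add: pairing_def sum.distrib sum_distrib_left algebra_simps)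

lemma qform_parallelogram:
  assumes "a \<in> coeffs" "b \<in> coeffs"
  shows "qform a + qform b
    = 2 * qform (\<lambda>x. 1/2 * a x + 1/2 * b x) + 2 * qform (\<lambda>x. 1/2 * a x + (-1/2) * b x)"
proof -
  obtain S where S: "finite S" "{x. a x \<noteq> 0} \<subseteq> S" "{x. b x \<noteq> 0} \<subseteq> S"
    using coeffs_common_support[OF assms] by metis
  have T: "{x. 1/2 * a x + 1/2 * b x \<noteq> 0} \<subseteq> S" "{x. 1/2 * a x + (-1/2) * b x \<noteq> 0} \<subseteq> S"
    by (rule comb_support[OF S(2,3)])+
  show ?thesis
    unfolding qform_superset[OF S(1,2)] qform_superset[OF S(1,3)] qform_superset[OF S(1) T(1)]
      qform_superset[OF S(1) T(2)] sum_distrib_left sum.distrib[symmetric]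
    by (intro sum.cong refl) (simp add: field_simps)
qed

lemma qform_scale: "qform (\<lambda>x. t * a x) = t\<^sup>2 * qform a"
proof (cases "t = 0")
  case False
  then have "{x. t * a x \<noteq> 0} = {x. a x \<noteq> 0}" by auto
  then show ?thesis
    unfolding qform_def by (simp add: sum_distrib_left power2_eq_square mult_ac)
qed (simp add: qform_def)

lemma pairing_scale: "pairing (\<lambda>x. t * a x) f = t * pairing a f"
proof (cases "t = 0")
  case False
  then have "{x. t * a x \<noteq> 0} = {x. a x \<noteq> 0}" by auto
  then show ?thesis
    unfolding pairing_def by (simp add: sum_distrib_left mult_ac)
qed (simp add: pairing_def)

lemma coeffs_scale: "a \<in> coeffs \<Longrightarrow> (\<lambda>x. t * a x) \<in> coeffs"
  using coeffs_comb[of a a t 0] by simp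

lemma qform_nonneg: "a \<in> coeffs \<Longrightarrow> 0 \<le> qform a"
  unfolding qform_def coeffs_def using psd by blast

lemma lag_zero: "lag f (\<lambda>x. 0) = 0"
  by (simp add: lag_def pairing_def qform_def)

section \<open>The dual norm and the parallelogram law\<close>

lemma dualD: "f \<in> dual \<Longrightarrow> a \<in> coeffs \<Longrightarrow> lag f a \<le> nsq f"
  unfolding dual_def nsq_def by (auto intro: cSUP_upper)

lemma nsq_leI: "(\<And>a. a \<in> coeffs \<Longrightarrow> lag f a \<le> C) \<Longrightarrow> nsq f \<le> C"
  unfolding nsq_def using coeffs_zero by (intro cSUP_least) auto

lemma dualI:
  "(\<And>x. x \<notin> X \<Longrightarrow> f x = 0) \<Longrightarrow> (\<And>a. a \<in> coeffs \<Longrightarrow> lag f a \<le> C) \<Longrightarrow> f \<in> dual"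
  unfolding dual_def by (auto intro!: bdd_aboveI2[of _ _ C])

lemma nsq_nonneg: "f \<in> dual \<Longrightarrow> 0 \<le> nsq f"
  using dualD[OF _ coeffs_zero] by (simp add: lag_zero)

text \<open>Replacing a, b by their half sum c and half difference e turns the left side into
  exactly 2 lag f c + 2 lag g e, by bilinearity of the pairing and the parallelogram law of the
  quadratic form.\<close>

lemma lag_sum_diff:
  assumes "a \<in> coeffs" "b \<in> coeffs" "f \<in> dual" "g \<in> dual"
  shows "lag (\<lambda>x. f x + g x) a + lag (\<lambda>x. f x - g x) b \<le> 2 * nsq f + 2 * nsq g"
proof -
  define c where "c = (\<lambda>x. 1/2 * a x + 1/2 * b x)"
  define e where "e = (\<lambda>x. 1/2 * a x + (-1/2) * b x)"
  have ce: "c \<in> coeffs" "e \<in> coeffs"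
    unfolding c_def e_def by (intro coeffs_comb assms)+
  have q: "qform a + qform b = 2 * qform c + 2 * qform e"
    unfolding c_def e_def by (rule qform_parallelogram[OF assms(1,2)])
  have "pairing a (\<lambda>x. f x + g x) = pairing a f + pairing a g"
    "pairing b (\<lambda>x. f x - g x) = pairing b f - pairing b g"
    using pairing_fun_comb[of a 1 f 1 g] pairing_fun_comb[of b 1 f "-1" g] by simp_all
  moreover have "pairing c f = 1/2 * pairing a f + 1/2 * pairing b f"
    "pairing e g = 1/2 * pairing a g + (-1/2) * pairing b g"
    unfolding c_def e_def by (intro pairing_comb assms)+
  ultimately have "lag (\<lambda>x. f x + g x) a + lag (\<lambda>x. f x - g x) b = 2 * lag f c + 2 * lag g e"
    using q by (simp add: lag_def algebra_simps)
  then show ?thesis using dualD[OF assms(3) ce(1)] dualD[OF assms(4) ce(2)] by linarith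
qed

lemma dual_zero: "(\<lambda>x. 0) \<in> dual"
  by (rule dualI[of _ 0]) (auto simp: lag_def pairing_def qform_nonneg)

lemma nsq_zero: "nsq (\<lambda>x. 0) = 0"
proof (rule antisym)
  show "nsq (\<lambda>x. 0) \<le> 0"
    by (rule nsq_leI) (auto simp: lag_def pairing_def qform_nonneg)
qed (rule nsq_nonneg[OF dual_zero])

lemma dual_scale_nsq_le:
  assumes "f \<in> dual"
  shows "(\<lambda>x. t * f x) \<in> dual" and "nsq (\<lambda>x. t * f x) \<le> t\<^sup>2 * nsq f"
proof -
  have *: "lag (\<lambda>x. t * f x) a \<le> t\<^sup>2 * nsq f" if a: "a \<in> coeffs" for a
  proof (cases "t = 0")
    case True
    then show ?thesis using a by (simp add: lag_def pairing_def qform_nonneg)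
  next
    case False
    have "lag (\<lambda>x. t * f x) a = t\<^sup>2 * lag f (\<lambda>x. (1/t) * a x)"
      unfolding lag_def pairing_scale qform_scale
      using pairing_fun_comb[of a t f 0 f] False by (simp add: field_simps power2_eq_square)
    also have "\<dots> \<le> t\<^sup>2 * nsq f"
      by (intro mult_left_mono dualD assms coeffs_scale a) auto
    finally show ?thesis .
  qed
  show "(\<lambda>x. t * f x) \<in> dual"
    using assms * by (intro dualI[of _ "t\<^sup>2 * nsq f"]) (auto simp: dual_def)
  show "nsq (\<lambda>x. t * f x) \<le> t\<^sup>2 * nsq f"
    by (intro nsq_leI *)
qed

lemma nsq_scale:
  assumes "f \<in> dual"
  shows "nsq (\<lambda>x. t * f x) = t\<^sup>2 * nsq f"
proof (cases "t = 0")
  case False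
  have "nsq (\<lambda>x. (1/t) * (t * f x)) \<le> (1/t)\<^sup>2 * nsq (\<lambda>x. t * f x)"
    by (intro dual_scale_nsq_le assms)
  then have "t\<^sup>2 * nsq f \<le> nsq (\<lambda>x. t * f x)"
    using False by (simp add: field_simps)
  then show ?thesis using dual_scale_nsq_le(2)[OF assms, of t] by linarith
qed (simp add: nsq_zero)

lemma dual_add:
  assumes "f \<in> dual" "g \<in> dual"
  shows "(\<lambda>x. f x + g x) \<in> dual"
proof (rule dualI[of _ "2 * nsq f + 2 * nsq g"])
  show "f x + g x = 0" if "x \<notin> X" for x using assms that by (auto simp: dual_def)
  show "lag (\<lambda>x. f x + g x) a \<le> 2 * nsq f + 2 * nsq g" if "a \<in> coeffs" for a
    using lag_sum_diff[OF that coeffs_zero assms] by (simp add: lag_zero)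
qed

lemma dual_diff: "f \<in> dual \<Longrightarrow> g \<in> dual \<Longrightarrow> (\<lambda>x. f x - g x) \<in> dual"
  using dual_add[OF _ dual_scale_nsq_le(1)[of g "-1"], of f] by simp

lemma parallelogram_le:
  assumes "f \<in> dual" "g \<in> dual"
  shows "nsq (\<lambda>x. f x + g x) + nsq (\<lambda>x. f x - g x) \<le> 2 * nsq f + 2 * nsq g"
proof -
  \<comment> \<open>The two suprema are taken one after the other: over a with b fixed, then over
    b.\<close>
  have "nsq (\<lambda>x. f x - g x) \<le> 2 * nsq f + 2 * nsq g - nsq (\<lambda>x. f x + g x)"
  proof (rule nsq_leI)
    fix b assume b: "b \<in> coeffs"
    have "nsq (\<lambda>x. f x + g x) \<le> 2 * nsq f + 2 * nsq g - lag (\<lambda>x. f x - g x) b"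
      using lag_sum_diff[OF _ b assms] by (intro nsq_leI) (simp add: algebra_simps)
    then show "lag (\<lambda>x. f x - g x) b \<le> 2 * nsq f + 2 * nsq g - nsq (\<lambda>x. f x + g x)" by simp
  qed
  then show ?thesis by simp
qed

text \<open>The reverse inequality is \<open>parallelogram_le\<close> applied to f + g and f - g,
  whose sum and difference are 2f and 2g.\<close>

lemma parallelogram:
  assumes "f \<in> dual" "g \<in> dual"
  shows "nsq (\<lambda>x. f x + g x) + nsq (\<lambda>x. f x - g x) = 2 * nsq f + 2 * nsq g"
proof -
  have "nsq (\<lambda>x. 2 * f x) + nsq (\<lambda>x. 2 * g x)
      \<le> 2 * nsq (\<lambda>x. f x + g x) + 2 * nsq (\<lambda>x. f x - g x)"
    using parallelogram_le[OF dual_add[OF assms] dual_diff[OF assms]] by (simp add: algebra_simps)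
  then show ?thesis
    using parallelogram_le[OF assms] by (simp add: nsq_scale assms)
qed

lemma nsq_minus_commute:
  assumes "f \<in> dual" "g \<in> dual"
  shows "nsq (\<lambda>x. f x - g x) = nsq (\<lambda>x. g x - f x)"
  using nsq_scale[OF dual_diff[OF assms], of "-1"] by simp

lemma ip_self: "f \<in> dual \<Longrightarrow> ip f f = nsq f"
  unfolding ip_def using nsq_scale[of f 2] by (simp add: nsq_zero mult_2[symmetric])

lemma ip_commute: "f \<in> dual \<Longrightarrow> g \<in> dual \<Longrightarrow> ip f g = ip g f"
  unfolding ip_def using nsq_minus_commute[of f g] by (simp add: add.commute)

text \<open>Jordan and von Neumann: the parallelogram law, applied to \<open>f + h, g\<close> and to \<open>g + h, f\<close>,
  makes the polarization of \<open>nsq\<close> additive.\<close>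

lemma nsq_add3:
  assumes "f \<in> dual" "g \<in> dual" "h \<in> dual"
  shows "nsq (\<lambda>x. f x + g x + h x) = nsq (\<lambda>x. f x + h x) + nsq g + nsq (\<lambda>x. g x + h x) + nsq f
    - nsq (\<lambda>x. f x - g x + h x) / 2 - nsq (\<lambda>x. g x - f x + h x) / 2"
proof -
  have 1: "nsq (\<lambda>x. f x + g x + h x) + nsq (\<lambda>x. f x - g x + h x)
      = 2 * nsq (\<lambda>x. f x + h x) + 2 * nsq g"
    using parallelogram[OF dual_add[OF assms(1,3)] assms(2)] by (simp add: algebra_simps)
  have 2: "nsq (\<lambda>x. f x + g x + h x) + nsq (\<lambda>x. g x - f x + h x)
      = 2 * nsq (\<lambda>x. g x + h x) + 2 * nsq f"
    using parallelogram[OF dual_add[OF assms(2,3)] assms(1)] by (simp add: algebra_simps)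
  show ?thesis using 1 2 by linarith
qed

lemma ip_add:
  assumes "f \<in> dual" "g \<in> dual" "h \<in> dual"
  shows "ip (\<lambda>x. f x + g x) h = ip f h + ip g h"
proof -
  have h': "(\<lambda>x. (-1) * h x) \<in> dual" by (rule dual_scale_nsq_le(1)[OF assms(3)])
  have 1: "nsq (\<lambda>x. f x - g x - h x) = nsq (\<lambda>x. g x - f x + h x)"
    using nsq_minus_commute[OF dual_diff[OF assms(1,2)] assms(3)] by (simp add: algebra_simps)
  have 2: "nsq (\<lambda>x. g x - f x - h x) = nsq (\<lambda>x. f x - g x + h x)"
    using nsq_minus_commute[OF dual_diff[OF assms(2,1)] assms(3)] by (simp add: algebra_simps)
  show ?thesis
    using nsq_add3[OF assms] nsq_add3[OF assms(1,2) h'] 1 2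
    unfolding ip_def by (simp add: field_simps)
qed

text \<open>Additivity alone yields homogeneity for rational factors only. The defect \<psi> is
  additive, vanishes at 1 and is bounded on [-1,1] by the parallelogram law, hence it is
  zero.\<close>

lemma ip_scale:
  assumes f: "f \<in> dual" and g: "g \<in> dual"
  shows "ip (\<lambda>x. t * f x) g = t * ip f g"
proof -
  define \<psi> where "\<psi> s = ip (\<lambda>x. s * f x) g - s * ip f g" for s
  have sf: "(\<lambda>x. s * f x) \<in> dual" for s by (rule dual_scale_nsq_le(1)[OF f])
  have "\<psi> t = 0"
  proof (rule additive_bounded_zero[of \<psi> "2 * nsq f + 2 * nsq g + \<bar>ip f g\<bar>"])
    show "\<psi> (r + s) = \<psi> r + \<psi> s" for r s
      unfolding \<psi>_def using ip_add[OF sf[of r] sf[of s] g] by (simp add: algebra_simps)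
    show "\<psi> 1 = 0" by (simp add: \<psi>_def)
    show "\<bar>\<psi> s\<bar> \<le> (2 * nsq f + 2 * nsq g) + \<bar>ip f g\<bar>" if s: "\<bar>s\<bar> \<le> 1" for s
    proof -
      have par: "nsq (\<lambda>x. s * f x + g x) + nsq (\<lambda>x. s * f x - g x) = 2 * (s\<^sup>2 * nsq f) + 2 * nsq g"
        using parallelogram[OF sf[of s] g] by (simp add: nsq_scale f)
      have "s\<^sup>2 * nsq f \<le> 1 * nsq f"
        using s nsq_nonneg[OF f] by (intro mult_right_mono) (auto simp: abs_square_le_1)
      then have "\<bar>ip (\<lambda>x. s * f x) g\<bar> \<le> 2 * nsq f + 2 * nsq g"
        unfolding ip_def
        using par nsq_nonneg[OF dual_add[OF sf[of s] g]] nsq_nonneg[OF dual_diff[OF sf[of s] g]]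
          nsq_nonneg[OF f] nsq_nonneg[OF g] by (simp add: abs_le_iff)
      moreover have "\<bar>s * ip f g\<bar> \<le> \<bar>ip f g\<bar>"
        using s by (simp add: abs_mult mult_left_le_one_le)
      ultimately show ?thesis unfolding \<psi>_def by linarith
    qed
  qed
  then show ?thesis by (simp add: \<psi>_def)
qed

section \<open>Point evaluations and the reproducing property\<close>

definition point :: "'a \<Rightarrow> 'a \<Rightarrow> real" where
  "point x = (\<lambda>y. if y = x then 1 else 0)"

lemma point_coeffs: "x \<in> X \<Longrightarrow> point x \<in> coeffs"
  by (auto simp: point_def coeffs_def)

lemma pairing_point: "pairing (point x) f = f x"
  by (simp add: pairing_superset[of "{x}"] point_def)

lemma qform_point: "qform (point x) = k x x"
  by (simp add: qform_superset[of "{x}"] point_def)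

text \<open>Test the supremum on the multiples t of the point mass at x and optimise over t.\<close>

lemma eval_square_le:
  assumes "f \<in> dual" "x \<in> X"
  shows "(f x)\<^sup>2 \<le> k x x * nsq f"
proof (rule square_le_of_quadratic)
  show "2 * t * f x - t\<^sup>2 * k x x \<le> nsq f" for t
    using dualD[OF assms(1) coeffs_scale[OF point_coeffs[OF assms(2)]], of t]
    by (simp add: lag_def pairing_scale qform_scale pairing_point qform_point)
  show "0 \<le> k x x" using qform_nonneg[OF point_coeffs[OF assms(2)]] by (simp add: qform_point)
qed

lemma nsq_eq_zero:
  assumes "f \<in> dual" "nsq f = 0"
  shows "f = (\<lambda>x. 0)"
proof
  fix x show "f x = 0"
    using assms eval_square_le[OF assms(1), of x] by (cases "x \<in> X") (auto simp: dual_def)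
qed

abbreviation section_at :: "'a \<Rightarrow> 'a \<Rightarrow> real" where
  "section_at x \<equiv> (\<lambda>y. if y \<in> X then k x y else 0)"

lemma qform_shift_point:
  assumes "a \<in> coeffs" "x \<in> X"
  shows "qform (\<lambda>y. 1 * a y + t * point x y)
    = qform a + 2 * t * pairing a (section_at x) + t\<^sup>2 * k x x"
proof -
  obtain S where S: "finite S" "S \<subseteq> X" "{x. a x \<noteq> 0} \<subseteq> S" "{y. point x y \<noteq> 0} \<subseteq> S"
    by (rule coeffs_common_support[OF assms(1) point_coeffs[OF assms(2)]])
  then have xS: "x \<in> S" by (auto simp: point_def)
  have sup: "{y. 1 * a y + t * point x y \<noteq> 0} \<subseteq> S" by (rule comb_support[OF S(3,4)])
  have "qform (\<lambda>y. 1 * a y + t * point x y)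
    = (\<Sum>y\<in>S. \<Sum>z\<in>S. a y * a z * k y z) + (\<Sum>y\<in>S. \<Sum>z\<in>S. t * (a y * point x z * k y z))
     + (\<Sum>y\<in>S. \<Sum>z\<in>S. t * (point x y * a z * k y z))
     + (\<Sum>y\<in>S. \<Sum>z\<in>S. t\<^sup>2 * (point x y * point x z * k y z))"
    unfolding qform_superset[OF S(1) sup] sum.distrib[symmetric]
    by (intro sum.cong refl) (simp add: algebra_simps power2_eq_square)
  also have "(\<Sum>y\<in>S. \<Sum>z\<in>S. t * (a y * point x z * k y z)) = t * (\<Sum>y\<in>S. a y * k y x)"
    using S(1) xS by (simp add: point_def sum_distrib_left if_distrib[of "\<lambda>u. _ * u"] sum.delta
        if_distrib[of "\<lambda>u. u * _"] cong: if_cong)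
  also have "(\<Sum>y\<in>S. a y * k y x) = (\<Sum>y\<in>S. a y * section_at x y)"
    using S(2) assms(2) sym by (intro sum.cong) auto
  also have "(\<Sum>y\<in>S. a y * section_at x y) = pairing a (section_at x)"
    by (rule pairing_superset[OF S(1,3), symmetric])
  also have "(\<Sum>y\<in>S. \<Sum>z\<in>S. t * (point x y * a z * k y z)) = (\<Sum>y\<in>S. point x y * (t * (\<Sum>z\<in>S. a z * k y z)))"
    by (simp add: sum_distrib_left mult_ac)
  also have "\<dots> = t * (\<Sum>z\<in>S. a z * k x z)"
    using S(1) xS by (simp add: point_def if_distrib[of "\<lambda>u. u * _"] sum.delta cong: if_cong)
  also have "(\<Sum>z\<in>S. a z * k x z) = (\<Sum>y\<in>S. a y * section_at x y)"
    using S(2) by (intro sum.cong) auto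
  also have "(\<Sum>y\<in>S. a y * section_at x y) = pairing a (section_at x)"
    by (rule pairing_superset[OF S(1,3), symmetric])
  also have "(\<Sum>y\<in>S. \<Sum>z\<in>S. t\<^sup>2 * (point x y * point x z * k y z))
      = (\<Sum>y\<in>S. point x y * (t\<^sup>2 * (\<Sum>z\<in>S. point x z * k y z)))"
    by (simp add: sum_distrib_left mult_ac)
  also have "\<dots> = t\<^sup>2 * k x x"
    using S(1) xS by (simp add: point_def if_distrib[of "\<lambda>u. u * _"] sum.delta cong: if_cong)
  also have "(\<Sum>y\<in>S. \<Sum>z\<in>S. a y * a z * k y z) = qform a"
    by (rule qform_superset[OF S(1,3), symmetric])
  finally show ?thesis by simp
qed

text \<open>Completing the square in the coefficient vector: the substitution \<open>a \<mapsto> a - t \<delta>\<^sub>x\<close> moves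
  the section out of the supremum.\<close>

lemma lag_shift_section:
  assumes a: "a \<in> coeffs" and x: "x \<in> X"
  shows "lag (\<lambda>y. f y + t * section_at x y) a
    = lag f (\<lambda>y. 1 * a y + (- t) * point x y) + 2 * t * f x + t\<^sup>2 * k x x"
proof -
  have p: "pairing a (\<lambda>y. f y + t * section_at x y) = pairing a f + t * pairing a (section_at x)"
    using pairing_fun_comb[of a 1 f t "section_at x"] by simp
  have q: "pairing (\<lambda>y. 1 * a y + (- t) * point x y) f = pairing a f - t * f x"
    using pairing_comb[OF a point_coeffs[OF x], of 1 "- t" f] by (simp add: pairing_point)
  show ?thesis
    using p q qform_shift_point[OF a x, of "- t"] unfolding lag_def by (simp add: algebra_simps)
qed

lemma nsq_shift_section_le:
  assumes "f \<in> dual" "x \<in> X"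
  shows "(\<lambda>y. f y + t * section_at x y) \<in> dual"
    and "nsq (\<lambda>y. f y + t * section_at x y) \<le> nsq f + 2 * t * f x + t\<^sup>2 * k x x"
proof -
  have *: "lag (\<lambda>y. f y + t * section_at x y) a \<le> nsq f + 2 * t * f x + t\<^sup>2 * k x x"
    if a: "a \<in> coeffs" for a
    unfolding lag_shift_section[OF a assms(2)]
    using dualD[OF assms(1) coeffs_comb[OF a point_coeffs[OF assms(2)], of 1 "- t"]] by simp
  show "nsq (\<lambda>y. f y + t * section_at x y) \<le> nsq f + 2 * t * f x + t\<^sup>2 * k x x"
    by (rule nsq_leI[OF *])
  show "(\<lambda>y. f y + t * section_at x y) \<in> dual"
    using assms by (intro dualI[OF _ *]) (auto simp: dual_def)
qed

lemma section_dual: "x \<in> X \<Longrightarrow> section_at x \<in> dual"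
  using nsq_shift_section_le(1)[OF dual_zero, of x 1] by simp

text \<open>A shift by -t undoes the shift by t, so the one-sided estimate applied twice is an
  equality.\<close>

lemma nsq_shift_section:
  assumes "f \<in> dual" "x \<in> X"
  shows "nsq (\<lambda>y. f y + t * section_at x y) = nsq f + 2 * t * f x + t\<^sup>2 * k x x"
proof -
  let ?g = "\<lambda>y. f y + t * section_at x y"
  have "nsq f \<le> nsq ?g + 2 * (- t) * ?g x + (- t)\<^sup>2 * k x x"
    using nsq_shift_section_le(2)[OF nsq_shift_section_le(1)[OF assms, of t] assms(2), of "- t"]
    by (simp add: algebra_simps)
  then show ?thesis
    using nsq_shift_section_le(2)[OF assms, of t] assms(2)
    by (simp add: algebra_simps power2_eq_square)
qed

text \<open>Take t = 1 and t = -1 in the shift formula: in the polarization all terms cancel except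
  4 f x / 4.\<close>

lemma ip_section:
  assumes "f \<in> dual" "x \<in> X"
  shows "ip f (section_at x) = f x"
  using nsq_shift_section[OF assms, of 1] nsq_shift_section[OF assms, of "-1"]
  unfolding ip_def by (simp cong: if_cong)

section \<open>Triangle inequality and completeness\<close>

lemma sqrt_nsq_triangle:
  assumes f: "f \<in> dual" and g: "g \<in> dual"
  shows "sqrt (nsq (\<lambda>x. f x + g x)) \<le> sqrt (nsq f) + sqrt (nsq g)"
proof -
  have exp: "nsq (\<lambda>x. f x + g x) = nsq f + nsq g + 2 * ip f g"
    using parallelogram[OF f g] unfolding ip_def by (simp add: field_simps)
  have "(ip f g)\<^sup>2 \<le> nsq g * nsq f"
  proof (rule square_le_of_quadratic)
    fix t
    have tg: "(\<lambda>x. (- t) * g x) \<in> dual" by (rule dual_scale_nsq_le(1)[OF g])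
    have "0 \<le> nsq (\<lambda>x. f x + (- t) * g x)" by (rule nsq_nonneg[OF dual_add[OF f tg]])
    also have "\<dots> = nsq f + t\<^sup>2 * nsq g + 2 * ip f (\<lambda>x. (- t) * g x)"
      using parallelogram[OF f tg] nsq_scale[OF g, of "- t"] unfolding ip_def by (simp add: field_simps)
    also have "ip f (\<lambda>x. (- t) * g x) = - t * ip f g"
      using ip_commute[OF f tg] ip_commute[OF f g] ip_scale[OF g f, of "- t"] by simp
    finally show "2 * t * ip f g - t\<^sup>2 * nsq g \<le> nsq f" by simp
  qed (rule nsq_nonneg[OF g])
  then have "ip f g \<le> sqrt (nsq g * nsq f)"
    using real_le_rsqrt by blast
  then have "nsq (\<lambda>x. f x + g x) \<le> (sqrt (nsq f) + sqrt (nsq g))\<^sup>2"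
    using exp nsq_nonneg[OF f] nsq_nonneg[OF g] by (simp add: power2_sum real_sqrt_mult mult_ac)
  then show ?thesis
    by (rule real_le_lsqrt[rotated]) (auto simp: nsq_nonneg f g)
qed

text \<open>Outside \<open>dual\<close> the supremum \<open>nsq\<close> is junk, but \<open>Metric_space\<close> asks for nonnegativity and
  symmetry of the distance everywhere.\<close>

definition ip\<^sub>0 :: "('a \<Rightarrow> real) \<Rightarrow> ('a \<Rightarrow> real) \<Rightarrow> real" where
  "ip\<^sub>0 f g = (if f \<in> dual \<and> g \<in> dual then ip f g else 0)"

abbreviation ndist :: "('a \<Rightarrow> real) \<Rightarrow> ('a \<Rightarrow> real) \<Rightarrow> real" where
  "ndist \<equiv> \<lambda>f g. sqrt (ip\<^sub>0 (\<lambda>x. f x - g x) (\<lambda>x. f x - g x))"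

lemma ndist_eq: "f \<in> dual \<Longrightarrow> g \<in> dual \<Longrightarrow> ndist f g = sqrt (nsq (\<lambda>x. f x - g x))"
  by (simp add: ip\<^sub>0_def ip_self dual_diff)

lemma ip\<^sub>0_self: "ip\<^sub>0 f f = (if f \<in> dual then nsq f else 0)"
  by (simp add: ip\<^sub>0_def ip_self)

lemma Metric_space_dual: "Metric_space dual ndist"
proof
  fix f g h :: "'a \<Rightarrow> real"
  show "0 \<le> ndist f g" by (simp add: ip\<^sub>0_self nsq_nonneg)
  have swap: "nsq (\<lambda>x. f x - g x) = nsq (\<lambda>x. g x - f x) \<and> (\<lambda>x. g x - f x) \<in> dual"
    if "(\<lambda>x. f x - g x) \<in> dual" for f g
    using nsq_scale[OF that, of "-1"] dual_scale_nsq_le(1)[OF that, of "-1"] by simp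
  show "ndist f g = ndist g f"
  proof (cases "(\<lambda>x. f x - g x) \<in> dual")
    case True
    then show ?thesis using swap[OF True] unfolding ip\<^sub>0_self by simp
  next
    case False
    then have "(\<lambda>x. g x - f x) \<notin> dual" using swap[of g f] by blast
    then show ?thesis using False unfolding ip\<^sub>0_self by simp
  qed
  show "ndist f g = 0 \<longleftrightarrow> f = g" if "f \<in> dual" "g \<in> dual"
    using nsq_eq_zero[OF dual_diff[OF that]] that
    by (auto simp: ndist_eq nsq_zero fun_eq_iff)
  show "ndist f h \<le> ndist f g + ndist g h" if "f \<in> dual" "g \<in> dual" "h \<in> dual"
    using sqrt_nsq_triangle[OF dual_diff[OF that(1,2)] dual_diff[OF that(2,3)]] that
    by (simp add: ndist_eq)
qed

text \<open>Evaluations are bounded, so a Cauchy sequence has a pointwise limit g. For a fixed a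
  only finitely many points enter \<open>lag\<close>, hence the bound on nsq (\<sigma> n - \<sigma>
  m) survives the limit in m; taking the supremum over a only afterwards gives convergence in
  norm.\<close>

lemma mcomplete_dual: "Metric_space.mcomplete dual ndist"
proof -
  interpret Metric_space dual ndist by (rule Metric_space_dual)
  show ?thesis unfolding mcomplete_def
  proof (intro allI impI)
    fix \<sigma> assume "MCauchy \<sigma>"
    then have \<sigma>: "\<sigma> n \<in> dual" and
      Cauchy: "\<And>\<epsilon>. \<epsilon> > 0 \<Longrightarrow> \<exists>N. \<forall>n n'. N \<le> n \<longrightarrow> N \<le> n' \<longrightarrow> ndist (\<sigma> n) (\<sigma> n') < \<epsilon>" for n
      unfolding MCauchy_def by (auto simp: image_subset_iff)
    have nsq_small: "\<exists>N. \<forall>n\<ge>N. \<forall>m\<ge>N. nsq (\<lambda>x. \<sigma> n x - \<sigma> m x) \<le> \<epsilon>\<^sup>2" if \<epsilon>: "\<epsilon> > 0" for \<epsilon>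
    proof -
      obtain N where N: "\<And>n n'. N \<le> n \<Longrightarrow> N \<le> n' \<Longrightarrow> ndist (\<sigma> n) (\<sigma> n') < \<epsilon>"
        using Cauchy[OF \<epsilon>] by blast
      have "nsq (\<lambda>x. \<sigma> n x - \<sigma> m x) \<le> \<epsilon>\<^sup>2" if "n \<ge> N" "m \<ge> N" for n m
        using N[OF that] \<epsilon> by (simp add: ndist_eq \<sigma> real_less_rsqrt sqrt_le_D)
      then show ?thesis by blast
    qed
    have "Cauchy (\<lambda>n. \<sigma> n x)" for x
    proof (cases "x \<in> X")
      case True
      show ?thesis
      proof (rule metric_CauchyI)
        fix e :: real assume e: "e > 0"
        define \<epsilon> where "\<epsilon> = e / (2 * (1 + sqrt (k x x)))"
        have k0: "0 \<le> k x x"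
          using qform_nonneg[OF point_coeffs[OF True]] by (simp add: qform_point)
        have \<epsilon>: "\<epsilon> > 0" unfolding \<epsilon>_def using e k0 by (simp add: add_pos_nonneg)
        obtain N where N: "\<And>n m. n \<ge> N \<Longrightarrow> m \<ge> N \<Longrightarrow> nsq (\<lambda>x. \<sigma> n x - \<sigma> m x) \<le> \<epsilon>\<^sup>2"
          using nsq_small[OF \<epsilon>] by blast
        have "dist (\<sigma> n x) (\<sigma> m x) < e" if nm: "n \<ge> N" "m \<ge> N" for n m
        proof -
          have "(\<sigma> n x - \<sigma> m x)\<^sup>2 \<le> k x x * nsq (\<lambda>x. \<sigma> n x - \<sigma> m x)"
            using eval_square_le[OF dual_diff[OF \<sigma> \<sigma>] True] by simp
          also have "\<dots> \<le> k x x * \<epsilon>\<^sup>2" by (intro mult_left_mono N nm k0)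
          finally have "sqrt ((\<sigma> n x - \<sigma> m x)\<^sup>2) \<le> sqrt (k x x * \<epsilon>\<^sup>2)"
            by (rule real_sqrt_le_mono)
          then have "\<bar>\<sigma> n x - \<sigma> m x\<bar> \<le> sqrt (k x x) * \<epsilon>"
            using \<epsilon> by (simp add: real_sqrt_mult)
          also have "\<dots> \<le> (1 + sqrt (k x x)) * \<epsilon>" using \<epsilon> by (simp add: algebra_simps)
          also have "\<dots> = e / 2"
          proof -
            have "1 + sqrt (k x x) \<noteq> 0" using real_sqrt_ge_zero[OF k0] by linarith
            then show ?thesis unfolding \<epsilon>_def by (simp add: field_simps)
          qed
          finally show ?thesis using e by (simp add: dist_real_def)
        qed
        then show "\<exists>M. \<forall>m\<ge>M. \<forall>n\<ge>M. dist (\<sigma> m x) (\<sigma> n x) < e" by blast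
      qed
    next
      case False
      then have "(\<lambda>n. \<sigma> n x) = (\<lambda>n. 0)" using \<sigma> by (auto simp: dual_def)
      then show ?thesis by (simp add: Cauchy_def)
    qed
    then have "\<exists>y. (\<lambda>n. \<sigma> n x) \<longlonglongrightarrow> y" for x by (simp add: Cauchy_convergent convergentD)
    then obtain g where g: "\<And>x. (\<lambda>n. \<sigma> n x) \<longlonglongrightarrow> g x" by metis
    have lag_small: "lag (\<lambda>x. \<sigma> n x - g x) a \<le> \<epsilon>\<^sup>2"
      if "\<And>n m. n \<ge> N \<Longrightarrow> m \<ge> N \<Longrightarrow> nsq (\<lambda>x. \<sigma> n x - \<sigma> m x) \<le> \<epsilon>\<^sup>2" "n \<ge> N" "a \<in> coeffs"
      for N n a \<epsilon>
    proof (rule LIMSEQ_le_const2)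
      show "(\<lambda>m. lag (\<lambda>x. \<sigma> n x - \<sigma> m x) a) \<longlonglongrightarrow> lag (\<lambda>x. \<sigma> n x - g x) a"
        unfolding lag_def pairing_def by (intro tendsto_intros g)
      show "\<exists>N. \<forall>m\<ge>N. lag (\<lambda>x. \<sigma> n x - \<sigma> m x) a \<le> \<epsilon>\<^sup>2"
        using dualD[OF dual_diff[OF \<sigma> \<sigma>] that(3)] that(1,2) order_trans by blast
    qed
    have zero: "g x = 0" if "x \<notin> X" for x
    proof -
      have "(\<lambda>n. \<sigma> n x) = (\<lambda>n. 0)" using \<sigma> that by (auto simp: dual_def)
      then show ?thesis using g[of x] by (simp add: LIMSEQ_const_iff)
    qed
    have diff: "\<exists>N. \<forall>n\<ge>N. (\<lambda>x. \<sigma> n x - g x) \<in> dual \<and> nsq (\<lambda>x. \<sigma> n x - g x) \<le> \<epsilon>\<^sup>2"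
      if \<epsilon>: "\<epsilon> > 0" for \<epsilon>
    proof -
      obtain N where N: "\<And>n m. n \<ge> N \<Longrightarrow> m \<ge> N \<Longrightarrow> nsq (\<lambda>x. \<sigma> n x - \<sigma> m x) \<le> \<epsilon>\<^sup>2"
        using nsq_small[OF \<epsilon>] by blast
      have "(\<lambda>x. \<sigma> n x - g x) \<in> dual \<and> nsq (\<lambda>x. \<sigma> n x - g x) \<le> \<epsilon>\<^sup>2" if "n \<ge> N" for n
      proof
        have off: "\<sigma> n x - g x = 0" if "x \<notin> X" for x
          using zero[OF that] \<sigma>[of n] that by (simp add: dual_def)
        show "(\<lambda>x. \<sigma> n x - g x) \<in> dual"
          by (rule dualI[OF off lag_small[OF N \<open>n \<ge> N\<close>]])
        show "nsq (\<lambda>x. \<sigma> n x - g x) \<le> \<epsilon>\<^sup>2"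
          by (rule nsq_leI) (rule lag_small[OF N \<open>n \<ge> N\<close>])
      qed
      then show ?thesis by blast
    qed
    obtain n where n: "(\<lambda>x. \<sigma> n x - g x) \<in> dual" using diff[of 1] by auto
    have gd: "g \<in> dual" using dual_diff[OF \<sigma>[of n] n] by simp
    have "\<exists>N. \<forall>n\<ge>N. ndist (\<sigma> n) g < \<epsilon>" if \<epsilon>: "\<epsilon> > 0" for \<epsilon>
    proof -
      obtain N where N: "\<And>n. n \<ge> N \<Longrightarrow> nsq (\<lambda>x. \<sigma> n x - g x) \<le> (\<epsilon>/2)\<^sup>2"
        using diff[of "\<epsilon>/2"] \<epsilon> by auto
      have "ndist (\<sigma> n) g < \<epsilon>" if "n \<ge> N" for n
      proof -
        have "sqrt (nsq (\<lambda>x. \<sigma> n x - g x)) \<le> \<epsilon>/2"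
          using N[OF that] \<epsilon> by (intro real_le_lsqrt) auto
        then show ?thesis using \<epsilon> by (simp add: ndist_eq \<sigma> gd)
      qed
      then show ?thesis by blast
    qed
    then show "\<exists>x. limitin mtopology \<sigma> x sequentially"
      using gd \<sigma> unfolding limitin_metric eventually_sequentially by metis
  qed
qed

lemma rkhs_dual: "rkhs X k dual ip\<^sub>0"
proof
  fix f g h :: "'a \<Rightarrow> real" and x :: 'a and a :: real
  show "f \<in> dual \<Longrightarrow> x \<notin> X \<Longrightarrow> f x = 0" by (simp add: dual_def)
  show "(\<lambda>x. 0) \<in> dual" by (rule dual_zero)
  show "f \<in> dual \<Longrightarrow> g \<in> dual \<Longrightarrow> (\<lambda>x. f x + g x) \<in> dual" by (rule dual_add)
  show "f \<in> dual \<Longrightarrow> (\<lambda>x. a * f x) \<in> dual" by (rule dual_scale_nsq_le(1))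
  show "f \<in> dual \<Longrightarrow> g \<in> dual \<Longrightarrow> ip\<^sub>0 f g = ip\<^sub>0 g f" by (simp add: ip\<^sub>0_def ip_commute)
  show "f \<in> dual \<Longrightarrow> g \<in> dual \<Longrightarrow> h \<in> dual
      \<Longrightarrow> ip\<^sub>0 (\<lambda>x. f x + g x) h = ip\<^sub>0 f h + ip\<^sub>0 g h"
    by (simp add: ip\<^sub>0_def ip_add dual_add)
  show "f \<in> dual \<Longrightarrow> g \<in> dual \<Longrightarrow> ip\<^sub>0 (\<lambda>x. a * f x) g = a * ip\<^sub>0 f g"
    by (simp add: ip\<^sub>0_def ip_scale dual_scale_nsq_le(1))
  show "f \<in> dual \<Longrightarrow> 0 \<le> ip\<^sub>0 f f" by (simp add: ip\<^sub>0_self nsq_nonneg)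
  show "f \<in> dual \<Longrightarrow> ip\<^sub>0 f f = 0 \<Longrightarrow> f = (\<lambda>x. 0)" by (simp add: ip\<^sub>0_self nsq_eq_zero)
  show "Metric_space.mcomplete dual ndist" by (rule mcomplete_dual)
  show "x \<in> X \<Longrightarrow> (\<lambda>y. if y \<in> X then k x y else 0) \<in> dual" by (rule section_dual)
  show "f \<in> dual \<Longrightarrow> x \<in> X \<Longrightarrow> ip\<^sub>0 f (\<lambda>y. if y \<in> X then k x y else 0) = f x"
    by (simp add: ip\<^sub>0_def section_dual ip_section)
qed

end

text \<open>The interface to the abstract construction: from here on, membership in the ball of
  radius r is checked through \<open>kernel_gap\<close> alone.\<close>

lemma in_rkhs_ballI:
  fixes X :: "'a set"
  assumes sym: "\<And>x y. x \<in> X \<Longrightarrow> y \<in> X \<Longrightarrow> k x y = k y x"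
    and psd: "\<And>S a. finite S \<Longrightarrow> S \<subseteq> X \<Longrightarrow> 0 \<le> (\<Sum>x\<in>S. \<Sum>y\<in>S. a x * a y * k x y)"
    and zero: "\<And>x. x \<notin> X \<Longrightarrow> f x = 0"
    and bound: "\<And>S a. finite S \<Longrightarrow> S \<subseteq> X \<Longrightarrow>
      kernel_gap k S a f \<le> r\<^sup>2"
    and r: "0 \<le> r"
  shows "in_rkhs_ball X k r f"
proof -
  interpret psd_kernel X k using sym psd by unfold_locales
  have le: "lag f a \<le> r\<^sup>2" if "a \<in> coeffs" for a
    using bound[of "{x. a x \<noteq> 0}" a] that unfolding lag_def pairing_def qform_def coeffs_def by simp
  have f: "f \<in> dual" by (rule dualI[OF zero le])
  have "sqrt (ip\<^sub>0 f f) \<le> r"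
    using f nsq_leI[of f, OF le] r by (simp add: ip\<^sub>0_self real_le_lsqrt nsq_nonneg)
  then show ?thesis unfolding in_rkhs_ball_def using rkhs_dual f by blast
qed

section \<open>Gaussian kernels and sinc bumps\<close>

abbreviation gauss :: "('d::finite \<Rightarrow> real) measure" where
  "gauss \<equiv> (\<Pi>\<^sub>M i\<in>UNIV. std_normal_distribution)"

lemma prob_space_gauss: "prob_space gauss"
  by (intro prob_space_PiM prob_space_normal_density) simp

lemma gauss_component_measurable [measurable]:
  "(\<lambda>\<omega>. \<omega> i) \<in> borel_measurable (gauss :: ('d::finite \<Rightarrow> real) measure)"
  using measurable_component_singleton[of i UNIV "\<lambda>_. std_normal_distribution"] by simp

abbreviation gauss_kernel :: "real \<Rightarrow> 'a::real_normed_vector \<Rightarrow> 'a \<Rightarrow> real" where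
  "gauss_kernel c x y \<equiv> exp (- (c\<^sup>2 * (norm (x - y))\<^sup>2 / 2))"

text \<open>The phase of the plane wave of frequency c \<omega>. With the length scale 1/c placed
  here, the frequency law stays standard normal for every scale.\<close>

definition phase :: "real \<Rightarrow> ('d::finite \<Rightarrow> real) \<Rightarrow> real ^ 'd \<Rightarrow> real" where
  "phase c \<omega> x = c * (\<Sum>i\<in>UNIV. \<omega> i * x $ i)"

lemma phase_diff: "phase c \<omega> (x - y) = phase c \<omega> x - phase c \<omega> y"
  by (simp add: phase_def algebra_simps sum_subtractf)

lemma phase_measurable [measurable]:
  fixes x :: "real ^ 'd"
  shows "(\<lambda>\<omega>. phase c \<omega> x) \<in> borel_measurable gauss"
  unfolding phase_def by measurable

text \<open>Complex exponentials factorise over the coordinates, which cosines do not; the real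
  identities below are real parts of this one.\<close>

lemma integral_gauss_prod_iexp:
  fixes g :: "real \<Rightarrow> real" and s :: "real ^ 'd"
  assumes [measurable]: "g \<in> borel_measurable borel" and bnd: "\<And>w. \<bar>g w\<bar> \<le> b"
  shows "(CLINT \<omega>|gauss. complex_of_real (\<Prod>i\<in>UNIV. g (\<omega> i)) * iexp (phase c \<omega> s))
    = (\<Prod>i\<in>UNIV. CLINT w|std_normal_distribution. complex_of_real (g w) * iexp (c * s $ i * w))"
proof -
  interpret N: prob_space std_normal_distribution by (intro prob_space_normal_density) simp
  interpret P: product_sigma_finite "\<lambda>_::'d. std_normal_distribution" ..
  have "complex_of_real (\<Prod>i\<in>UNIV. g (\<omega> i)) * iexp (phase c \<omega> s)
      = (\<Prod>i\<in>UNIV. complex_of_real (g (\<omega> i)) * iexp (c * s $ i * \<omega> i))" for \<omega>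
    by (simp add: phase_def prod.distrib exp_sum[symmetric] sum_distrib_left mult_ac)
  then show ?thesis
  proof (simp only:, intro P.product_integral_prod)
    fix i
    show "integrable std_normal_distribution (\<lambda>w. complex_of_real (g w) * iexp (c * s $ i * w))"
      by (rule N.integrable_const_bound[where B=b]) (auto simp: norm_mult bnd)
  qed simp
qed

lemma gaussian_eq_integral_cos:
  fixes s :: "real ^ 'd"
  shows "(\<integral>\<omega>. cos (phase c \<omega> s) \<partial>gauss) = exp (- (c\<^sup>2 * (norm s)\<^sup>2 / 2))"
proof -
  interpret prob_space "gauss :: ('d \<Rightarrow> real) measure" by (rule prob_space_gauss)
  have "complex_of_real (exp (- (c\<^sup>2 * (norm s)\<^sup>2 / 2)))
      = (\<Prod>i\<in>UNIV. complex_of_real (exp (- (c * s $ i)\<^sup>2 / 2)))"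
    unfolding of_real_prod[symmetric] exp_sum[OF finite, symmetric]
    by (simp add: norm_vec_def L2_set_def sum_nonneg power_mult_distrib sum_negf
        sum_distrib_left[symmetric] sum_divide_distrib[symmetric])
  also have "\<dots> = (\<Prod>i\<in>UNIV. char std_normal_distribution (c * s $ i))"
    by (simp add: char_std_normal_distribution)
  also have "\<dots> = (CLINT \<omega>|gauss. iexp (phase c \<omega> s))"
    using integral_gauss_prod_iexp[of "\<lambda>_. 1" 1 c s] by (simp add: char_def)
  finally have "exp (- (c\<^sup>2 * (norm s)\<^sup>2 / 2)) = Re (CLINT \<omega>|gauss. iexp (phase c \<omega> s))"
    by (metis Re_complex_of_real)
  also have "\<dots> = (\<integral>\<omega>. Re (iexp (phase c \<omega> s)) \<partial>gauss)"
    by (rule integral_Re[symmetric], rule integrable_const_bound[where B=1]) auto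
  also have "\<dots> = (\<integral>\<omega>. cos (phase c \<omega> s) \<partial>gauss)" by (simp add: Re_exp)
  finally show ?thesis by simp
qed

text \<open>Bochner: the form of the Gaussian kernel is \<open>\<integral> |A|\<^sup>2\<close> for the trigonometric sum \<open>A\<close>, so the
  function with spectral density \<open>h\<close> costs at most \<open>2 Re (h A) - |A|\<^sup>2 \<le> h\<^sup>2\<close> pointwise.\<close>

lemma gaussian_energy_le:
  fixes h :: "('d::finite \<Rightarrow> real) \<Rightarrow> real" and p :: "real ^ 'd"
  assumes [measurable]: "h \<in> borel_measurable gauss" and bnd: "\<And>\<omega>. \<bar>h \<omega>\<bar> \<le> b"
    and S: "finite S"
  shows "kernel_gap (gauss_kernel c) S a (\<lambda>x. \<integral>\<omega>. h \<omega> * cos (phase c \<omega> (x - p)) \<partial>gauss) \<le> b\<^sup>2"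
proof -
  interpret prob_space "gauss :: ('d \<Rightarrow> real) measure" by (rule prob_space_gauss)
  \<comment> \<open>Real and imaginary part of the trigonometric sum, with phases measured from p.
    This leaves its modulus unchanged and lets the bump centred at p have the real density
    h.\<close>
  define P where "P \<omega> = (\<Sum>x\<in>S. a x * cos (phase c \<omega> (x - p)))" for \<omega>
  define Q where "Q \<omega> = (\<Sum>x\<in>S. a x * sin (phase c \<omega> (x - p)))" for \<omega>
  have int_hcos: "integrable gauss (\<lambda>\<omega>. h \<omega> * cos (phase c \<omega> s))" for s
  proof (rule integrable_const_bound[where B=b])
    have "\<bar>h \<omega> * cos (phase c \<omega> s)\<bar> \<le> b * 1" for \<omega>
      unfolding abs_mult by (intro mult_mono bnd) (use bnd[of \<omega>] in auto)
    then show "AE \<omega> in gauss. norm (h \<omega> * cos (phase c \<omega> s)) \<le> b" by simp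
  qed simp
  have int_cos: "integrable gauss (\<lambda>\<omega>. cos (phase c \<omega> s))" for s :: "real ^ 'd"
    by (rule integrable_const_bound[where B=1]) auto
  have lin: "(\<Sum>x\<in>S. a x * (\<integral>\<omega>. h \<omega> * cos (phase c \<omega> (x - p)) \<partial>gauss)) = (\<integral>\<omega>. h \<omega> * P \<omega> \<partial>gauss)"
  proof -
    have "(\<integral>\<omega>. h \<omega> * P \<omega> \<partial>gauss) = (\<integral>\<omega>. (\<Sum>x\<in>S. a x * (h \<omega> * cos (phase c \<omega> (x - p)))) \<partial>gauss)"
      unfolding P_def sum_distrib_left by (simp add: mult_ac)
    then show ?thesis using int_hcos by simp
  qed
  have quad_pt: "(P \<omega>)\<^sup>2 + (Q \<omega>)\<^sup>2 = (\<Sum>x\<in>S. \<Sum>y\<in>S. a x * a y * cos (phase c \<omega> (x - y)))" for \<omega>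
  proof -
    have cos_split: "cos (phase c \<omega> (x - y)) = cos (phase c \<omega> (x - p)) * cos (phase c \<omega> (y - p))
        + sin (phase c \<omega> (x - p)) * sin (phase c \<omega> (y - p))" for x y
      unfolding cos_diff[symmetric] by (simp add: phase_diff)
    show ?thesis
      unfolding P_def Q_def power2_eq_square sum_product sum.distrib[symmetric]
    proof (intro sum.cong refl)
      fix x y
      show "a x * cos (phase c \<omega> (x - p)) * (a y * cos (phase c \<omega> (y - p)))
          + a x * sin (phase c \<omega> (x - p)) * (a y * sin (phase c \<omega> (y - p)))
          = a x * a y * cos (phase c \<omega> (x - y))"
        unfolding cos_split[of x y] by (simp only: distrib_left mult_ac)
    qed
  qed
  have int_quad: "integrable gauss (\<lambda>\<omega>. (P \<omega>)\<^sup>2 + (Q \<omega>)\<^sup>2)"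
    unfolding quad_pt using int_cos by simp
  have quad: "kernel_form (gauss_kernel c) S a
      = (\<integral>\<omega>. (P \<omega>)\<^sup>2 + (Q \<omega>)\<^sup>2 \<partial>gauss)"
    unfolding quad_pt gaussian_eq_integral_cos[symmetric] using int_cos by simp
  have int_hP: "integrable gauss (\<lambda>\<omega>. h \<omega> * P \<omega>)"
  proof -
    have "(\<lambda>\<omega>. h \<omega> * P \<omega>) = (\<lambda>\<omega>. (\<Sum>x\<in>S. a x * (h \<omega> * cos (phase c \<omega> (x - p)))))"
      unfolding P_def sum_distrib_left by (simp add: mult_ac)
    then show ?thesis using int_hcos by simp
  qed
  have "2 * (\<integral>\<omega>. h \<omega> * P \<omega> \<partial>gauss) - (\<integral>\<omega>. (P \<omega>)\<^sup>2 + (Q \<omega>)\<^sup>2 \<partial>gauss)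
      = (\<integral>\<omega>. 2 * (h \<omega> * P \<omega>) - ((P \<omega>)\<^sup>2 + (Q \<omega>)\<^sup>2) \<partial>gauss)"
    using int_hP int_quad by simp
  also have "\<dots> \<le> (\<integral>\<omega>. b\<^sup>2 \<partial>(gauss :: ('d \<Rightarrow> real) measure))"
  proof (rule integral_mono)
    fix \<omega> :: "'d \<Rightarrow> real"
    have "0 \<le> (h \<omega> - P \<omega>)\<^sup>2" "0 \<le> (Q \<omega>)\<^sup>2" by simp_all
    moreover have "(h \<omega> - P \<omega>)\<^sup>2 = (h \<omega>)\<^sup>2 + (P \<omega>)\<^sup>2 - 2 * (h \<omega> * P \<omega>)"
      by (simp add: power2_diff)
    ultimately have "2 * (h \<omega> * P \<omega>) - ((P \<omega>)\<^sup>2 + (Q \<omega>)\<^sup>2) \<le> (h \<omega>)\<^sup>2"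
      by linarith
    also have "(h \<omega>)\<^sup>2 \<le> b\<^sup>2" using bnd[of \<omega>] by (simp add: abs_le_square_iff[symmetric])
    finally show "2 * (h \<omega> * P \<omega>) - ((P \<omega>)\<^sup>2 + (Q \<omega>)\<^sup>2) \<le> b\<^sup>2" .
  qed (use int_hP int_quad in auto)
  also have "\<dots> = b\<^sup>2" by (simp add: prob_space)
  finally show ?thesis unfolding lin quad .
qed

text \<open>The case h = 0 of the energy bound: the gap of the zero function is minus the
  form.\<close>

lemma gaussian_psd:
  fixes S :: "(real ^ 'd::finite) set"
  assumes "finite S"
  shows "0 \<le> kernel_form (gauss_kernel c) S a"
  using gaussian_energy_le[of "\<lambda>_. 0" 0 S a c 0] assms by simp

lemma gaussian_section_energy_le:
  fixes S :: "(real ^ 'd::finite) set"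
  assumes "finite S"
  shows "kernel_gap (gauss_kernel c) S a (\<lambda>x. r * exp (- (c\<^sup>2 * (norm (x - p))\<^sup>2 / 2))) \<le> r\<^sup>2"
  using gaussian_energy_le[of "\<lambda>_. r" "\<bar>r\<bar>" S a c p] assms
  by (simp add: gaussian_eq_integral_cos)

section \<open>Sinc bumps from flat spectral densities\<close>

lemma integral_box_iexp:
  assumes W: "0 < W"
  shows "(CLINT w|lborel. indicator {-W..W} w *\<^sub>R iexp (t * w)) = complex_of_real (2 * W * sinc (W * t))"
proof (cases "t = 0")
  case True
  then show ?thesis using W by (simp add: scaleR_conv_of_real)
next
  case False
  define F where "F w = iexp (t * w) / (\<i> * t)" for w :: real
  have deriv: "(F has_vector_derivative iexp (t * w)) (at w within {-W..W})" for w
  proof -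
    have "((\<lambda>z. exp (\<i> * (complex_of_real t * z)) / (\<i> * t)) has_field_derivative
        exp (\<i> * (complex_of_real t * w))) (at (complex_of_real w))"
      using False by (auto intro!: derivative_eq_intros simp: field_simps)
    from has_vector_derivative_real_field[OF this] show ?thesis
      unfolding F_def by (simp add: mult_ac)
  qed
  have "(CLINT w|lborel. indicator {-W..W} w *\<^sub>R iexp (t * w)) = F W - F (- W)"
    using W by (intro integral_FTC_Icc deriv continuous_intros) auto
  also have "\<dots> = complex_of_real (2 * sin (W * t) / t)"
    using False unfolding F_def
    by (simp add: complex_eq_iff Re_divide Im_divide Re_exp Im_exp power2_eq_square field_simps)
  also have "2 * sin (W * t) / t = 2 * W * sinc (W * t)"
    using W False by simp
  finally show ?thesis .
qed

text \<open>The density of the uniform law on [-W, W] with respect to the standard normal law, so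
  that integration against it yields the characteristic function of the uniform law, a sinc.\<close>

definition flat_density :: "real \<Rightarrow> real \<Rightarrow> real" where
  "flat_density W w = indicator {-W..W} w / (2 * W * std_normal_density w)"

lemma flat_density_measurable [measurable]: "flat_density W \<in> borel_measurable borel"
  unfolding flat_density_def by measurable

text \<open>The worst point is the edge |w| = W, where the normal density is smallest; this is where
  the exponential cost of narrow bumps originates.\<close>

lemma flat_density_bound:
  assumes "0 < W"
  shows "\<bar>flat_density W w\<bar> \<le> sqrt (2 * pi) / (2 * W) * exp (W\<^sup>2 / 2)"
proof (cases "w \<in> {-W..W}")
  case True
  have "\<bar>flat_density W w\<bar> = sqrt (2 * pi) / (2 * W) * exp (w\<^sup>2 / 2)"
    using True assms by (simp add: flat_density_def std_normal_density_def exp_minus field_simps)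
  also have "\<dots> \<le> sqrt (2 * pi) / (2 * W) * exp (W\<^sup>2 / 2)"
    using True assms by (intro mult_left_mono) (auto simp: abs_le_square_iff[symmetric])
  finally show ?thesis .
qed (use assms in \<open>simp add: flat_density_def\<close>)

lemma integral_flat_density:
  assumes W: "0 < W"
  shows "(CLINT w|std_normal_distribution. complex_of_real (flat_density W w) * iexp (t * w))
    = complex_of_real (sinc (W * t))"
proof -
  have "(CLINT w|std_normal_distribution. complex_of_real (flat_density W w) * iexp (t * w))
    = (CLINT w|lborel. std_normal_density w *\<^sub>R (complex_of_real (flat_density W w) * iexp (t * w)))"
    by (rule integral_density) auto
  also have "\<dots> = (CLINT w|lborel. (1 / (2 * W)) *\<^sub>R (indicator {-W..W} w *\<^sub>R iexp (t * w)))"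
  proof (intro Bochner_Integration.integral_cong refl)
    fix w :: real
    have "std_normal_density w \<noteq> 0" using normal_density_pos[of 1 0 w] by simp
    then show "std_normal_density w *\<^sub>R (complex_of_real (flat_density W w) * iexp (t * w))
      = (1 / (2 * W)) *\<^sub>R (indicator {-W..W} w *\<^sub>R iexp (t * w))"
      unfolding flat_density_def by (simp add: scaleR_conv_of_real)
  qed
  also have "\<dots> = (1 / (2 * W)) *\<^sub>R complex_of_real (2 * W * sinc (W * t))"
    unfolding integral_box_iexp[OF W, symmetric] by (rule integral_scaleR_right)
  also have "\<dots> = complex_of_real (sinc (W * t))"
    using W by (simp add: scaleR_conv_of_real)
  finally show ?thesis .
qed

lemma sinc_product_eq_integral:
  fixes s :: "real ^ 'd::finite"
  assumes W: "0 < W"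
  shows "(\<integral>\<omega>. (\<Prod>i\<in>UNIV. flat_density W (\<omega> i)) * cos (phase c \<omega> s) \<partial>gauss)
    = (\<Prod>i\<in>UNIV. sinc (W * (c * s $ i)))"
proof -
  interpret prob_space "gauss :: ('d \<Rightarrow> real) measure" by (rule prob_space_gauss)
  let ?h = "\<lambda>\<omega>. \<Prod>i\<in>(UNIV :: 'd set). flat_density W (\<omega> i)"
  have int: "integrable gauss (\<lambda>\<omega>. complex_of_real (?h \<omega>) * iexp (phase c \<omega> s))"
  proof (rule integrable_const_bound)
    have "\<bar>?h \<omega>\<bar> \<le> (\<Prod>i\<in>(UNIV::'d set). sqrt (2 * pi) / (2 * W) * exp (W\<^sup>2 / 2))" for \<omega>
      unfolding abs_prod by (intro prod_mono conjI flat_density_bound W) auto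
    then show "AE \<omega> in gauss. norm (complex_of_real (?h \<omega>) * iexp (phase c \<omega> s))
        \<le> (\<Prod>i\<in>(UNIV::'d set). sqrt (2 * pi) / (2 * W) * exp (W\<^sup>2 / 2))"
      by (simp add: norm_mult del: of_real_prod prod_constant)
  qed measurable
  have "(\<integral>\<omega>. ?h \<omega> * cos (phase c \<omega> s) \<partial>gauss)
      = (\<integral>\<omega>. Re (complex_of_real (?h \<omega>) * iexp (phase c \<omega> s)) \<partial>gauss)"
    by (simp add: Re_exp del: of_real_prod)
  also have "\<dots> = Re (CLINT \<omega>|gauss. complex_of_real (?h \<omega>) * iexp (phase c \<omega> s))"
    by (rule integral_Re[OF int])
  also have "\<dots> = Re (\<Prod>i\<in>UNIV. complex_of_real (sinc (W * (c * s $ i))))"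
    by (subst integral_gauss_prod_iexp[OF flat_density_measurable flat_density_bound[OF W]])
       (simp only: integral_flat_density[OF W])
  also have "\<dots> = (\<Prod>i\<in>UNIV. sinc (W * (c * s $ i)))"
    unfolding of_real_prod[symmetric] by (rule Re_complex_of_real)
  finally show ?thesis .
qed

text \<open>The width \<open>1/N\<close> costs an RKHS norm exponential in \<open>N\<^sup>2\<close>, which is why the SE kernel only
  admits about \<open>(log T)\<^bsup>d/2\<^esup>\<close> separated bumps of height polynomial in \<open>1/T\<close>.\<close>

lemma sinc_bump_energy_le:
  fixes S :: "(real ^ 'd::finite) set"
  assumes l: "0 < l" and N: "0 < N" and S: "finite S"
  shows "kernel_gap (se_kernel l) S a (\<lambda>x. r * (\<Prod>i\<in>UNIV. sinc (N * (x $ i - p $ i))))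
    \<le> r\<^sup>2 * (pi / (2 * N\<^sup>2 * l\<^sup>2) * exp (N\<^sup>2 * l\<^sup>2)) ^ CARD('d)"
proof -
  \<comment> \<open>The cutoff W = N l combined with the phase scale 1/l gives sinc functions of
    width 1/N; b bounds the spectral density in each coordinate.\<close>
  define b where "b = sqrt (2 * pi) / (2 * (N * l)) * exp ((N * l)\<^sup>2 / 2)"
  let ?h = "\<lambda>\<omega>. r * (\<Prod>i\<in>(UNIV :: 'd set). flat_density (N * l) (\<omega> i))"
  have W: "0 < N * l" using l N by simp
  have b: "0 \<le> b" unfolding b_def using W by simp
  have "2 * (\<Sum>x\<in>S. a x * (\<integral>\<omega>. ?h \<omega> * cos (phase (1 / l) \<omega> (x - p)) \<partial>gauss))
    - (\<Sum>x\<in>S. \<Sum>y\<in>S. a x * a y * exp (- ((1 / l)\<^sup>2 * (norm (x - y))\<^sup>2 / 2)))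
    \<le> (\<bar>r\<bar> * b ^ CARD('d))\<^sup>2"
  proof (rule gaussian_energy_le[OF _ _ S])
    show "?h \<in> borel_measurable gauss"
      by (intro borel_measurable_times borel_measurable_prod borel_measurable_const
          measurable_compose[OF gauss_component_measurable flat_density_measurable])
    fix \<omega> :: "'d \<Rightarrow> real"
    have "(\<Prod>i\<in>UNIV. \<bar>flat_density (N * l) (\<omega> i)\<bar>) \<le> (\<Prod>i\<in>(UNIV :: 'd set). b)"
      unfolding b_def by (intro prod_mono conjI flat_density_bound W) auto
    then show "\<bar>?h \<omega>\<bar> \<le> \<bar>r\<bar> * b ^ CARD('d)"
      by (simp add: abs_mult abs_prod mult_left_mono)
  qed
  moreover have "(\<integral>\<omega>. ?h \<omega> * cos (phase (1 / l) \<omega> s) \<partial>gauss) = r * (\<Prod>i\<in>UNIV. sinc (N * s $ i))"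
    for s :: "real ^ 'd"
  proof -
    have "(\<integral>\<omega>. ?h \<omega> * cos (phase (1 / l) \<omega> s) \<partial>gauss)
      = r * (\<integral>\<omega>. (\<Prod>i\<in>UNIV. flat_density (N * l) (\<omega> i)) * cos (phase (1 / l) \<omega> s) \<partial>gauss)"
      unfolding mult.assoc by (rule integral_mult_right_zero)
    also have "\<dots> = r * (\<Prod>i\<in>UNIV. sinc (N * l * (1 / l * s $ i)))"
      unfolding sinc_product_eq_integral[OF W] ..
    also have "(\<lambda>i. N * l * (1 / l * s $ i)) = (\<lambda>i. N * s $ i)" using l by simp
    then have "(\<Prod>i\<in>UNIV. sinc (N * l * (1 / l * s $ i))) = (\<Prod>i\<in>UNIV. sinc (N * s $ i))"
      by metis
    finally show ?thesis .
  qed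
  moreover have "exp (- ((1 / l)\<^sup>2 * (norm (x - y))\<^sup>2 / 2)) = se_kernel l x y" for x y :: "real ^ 'd"
    using l by (simp add: se_kernel_def field_simps power_divide)
  moreover have "(\<bar>r\<bar> * b ^ CARD('d))\<^sup>2 = r\<^sup>2 * (pi / (2 * N\<^sup>2 * l\<^sup>2) * exp (N\<^sup>2 * l\<^sup>2)) ^ CARD('d)"
  proof -
    have "b\<^sup>2 = pi / (2 * N\<^sup>2 * l\<^sup>2) * exp (N\<^sup>2 * l\<^sup>2)"
      unfolding b_def power_mult_distrib power_divide
      by (simp add: exp_of_nat_mult[of 2, simplified, symmetric] power_mult_distrib)
    then show ?thesis by (metis power_mult power_mult_distrib mult.commute power2_abs)
  qed
  ultimately show ?thesis by (simp only: vector_minus_component)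
qed

section \<open>The Matern kernel as a Gaussian mixture\<close>

text \<open>The integrand has the shape of \<open>Gamma_conv_nn_integral_real\<close>, which makes
  the normalisation immediate. At \<tau> = 0 the value is 0, because 0 powr anything is 0.\<close>

definition gamma_density :: "real \<Rightarrow> real \<Rightarrow> real" where
  "gamma_density \<nu> \<tau> = indicator {0..} \<tau> * \<tau> powr (\<nu> - 1) / exp \<tau> / Gamma \<nu>"

abbreviation gamma_law :: "real \<Rightarrow> real measure" where
  "gamma_law \<nu> \<equiv> density lborel (\<lambda>\<tau>. ennreal (gamma_density \<nu> \<tau>))"

lemma gamma_density_measurable [measurable]: "gamma_density \<nu> \<in> borel_measurable borel"
  unfolding gamma_density_def by measurable

lemma gamma_density_nonneg: "0 < \<nu> \<Longrightarrow> 0 \<le> gamma_density \<nu> \<tau>"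
  unfolding gamma_density_def by (simp add: Gamma_real_pos less_imp_le)

lemma gamma_density_nonpos: "\<tau> \<le> 0 \<Longrightarrow> gamma_density \<nu> \<tau> = 0"
  by (cases "\<tau> = 0") (auto simp: gamma_density_def)

lemma prob_space_gamma_law:
  assumes "0 < \<nu>"
  shows "prob_space (gamma_law \<nu>)"
proof
  have G: "0 < Gamma \<nu>" using assms by (rule Gamma_real_pos)
  have "ennreal (gamma_density \<nu> \<tau>)
      = ennreal (1 / Gamma \<nu>) * ennreal (indicator {0..} \<tau> * \<tau> powr (\<nu> - 1) / exp \<tau>)" for \<tau>
    using G by (subst ennreal_mult'[symmetric]) (auto simp: gamma_density_def mult_ac)
  then have "emeasure (gamma_law \<nu>) UNIV
      = (\<integral>\<^sup>+\<tau>. ennreal (1 / Gamma \<nu>) * ennreal (indicator {0..} \<tau> * \<tau> powr (\<nu> - 1) / exp \<tau>) \<partial>lborel)"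
    by (subst emeasure_density) auto
  also have "\<dots> = ennreal (1 / Gamma \<nu>) * ennreal (Gamma \<nu>)"
    by (simp add: nn_integral_cmult Gamma_conv_nn_integral_real[OF assms])
  also have "\<dots> = 1"
    using G by (simp add: ennreal_mult'[symmetric])
  finally show "emeasure (gamma_law \<nu>) (space (gamma_law \<nu>)) = 1" by simp
qed

lemma AE_gamma_law_pos: "AE \<tau> in gamma_law \<nu>. 0 < \<tau>"
  by (subst AE_density) (auto intro!: AE_I2 simp: not_le[symmetric] gamma_density_nonpos)

lemma integral_gamma_law:
  assumes "0 < \<nu>" and [measurable]: "g \<in> borel_measurable borel"
  shows "(\<integral>\<tau>. g \<tau> \<partial>gamma_law \<nu>) = (\<integral>\<tau>. gamma_density \<nu> \<tau> * g \<tau> \<partial>lborel)"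
  using gamma_density_nonneg[OF assms(1)] by (subst integral_density) auto

text \<open>The substitution \<open>\<tau> = (z/2) e\<^sup>t\<close> in Schlaefli's integral.\<close>

lemma bessel_K_eq_gamma_mixture:
  assumes \<nu>: "0 < \<nu>" and z: "0 < z"
  shows "2 powr (1 - \<nu>) / Gamma \<nu> * z powr \<nu> * bessel_K \<nu> z
    = (\<integral>\<tau>. exp (- (z\<^sup>2 / 4 / \<tau>)) \<partial>gamma_law \<nu>)"
proof -
  interpret prob_space "gamma_law \<nu>" by (rule prob_space_gamma_law[OF \<nu>])
  have G: "0 < Gamma \<nu>" using \<nu> by (rule Gamma_real_pos)
  \<comment> \<open>One of the two exponentials in cosh (\<nu> t), taken over the whole line; g
    inverts \<tau> = (z/2) e^t, under which z cosh t = \<tau> + z^2 / (4 \<tau>).\<close>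
  define F where "F t = exp (- z * cosh t + \<nu> * t)" for t
  define g where "g \<tau> = ln (2 * \<tau> / z)" for \<tau>
  have F_g: "F (g \<tau>) * (1 / \<tau>) = (2 / z) powr \<nu> * Gamma \<nu> * (gamma_density \<nu> \<tau> * exp (- (z\<^sup>2 / 4 / \<tau>)))"
    if "0 < \<tau>" for \<tau>
  proof -
    have "- z * cosh (g \<tau>) + \<nu> * g \<tau> = - \<tau> + - (z\<^sup>2 / 4 / \<tau>) + \<nu> * g \<tau>"
      using that z unfolding g_def by (simp add: cosh_ln_real field_simps power2_eq_square)
    moreover have "exp (\<nu> * g \<tau>) = (2 / z) powr \<nu> * \<tau> powr \<nu>"
      using that z unfolding g_def
      by (simp add: powr_def[symmetric] powr_mult[symmetric] powr_def exp_add[symmetric] ln_mult ln_div algebra_simps)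
    ultimately have "F (g \<tau>) = exp (- \<tau>) * exp (- (z\<^sup>2 / 4 / \<tau>)) * ((2 / z) powr \<nu> * \<tau> powr \<nu>)"
      by (simp only: F_def exp_add)
    moreover have "gamma_density \<nu> \<tau> = \<tau> powr \<nu> / \<tau> * exp (- \<tau>) / Gamma \<nu>"
      using that by (simp add: gamma_density_def powr_diff exp_minus divide_inverse mult_ac)
    ultimately show ?thesis using that G by simp
  qed
  have int_mix: "integrable lborel (\<lambda>\<tau>. gamma_density \<nu> \<tau> * exp (- (z\<^sup>2 / 4 / \<tau>)))"
  proof -
    have "integrable (gamma_law \<nu>) (\<lambda>\<tau>. exp (- (z\<^sup>2 / 4 / \<tau>)))"
    proof (rule integrable_const_bound[where B=1])
      show "AE \<tau> in gamma_law \<nu>. norm (exp (- (z\<^sup>2 / 4 / \<tau>))) \<le> 1"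
        using AE_gamma_law_pos by eventually_elim simp
    qed simp
    then show ?thesis
      using gamma_density_nonneg[OF \<nu>] by (subst (asm) integrable_density) auto
  qed
  have eint: "einterval 0 \<infinity> = {0<..}" by (auto simp: einterval_def)
  have eint': "einterval (-\<infinity>) \<infinity> = (UNIV :: real set)" by (auto simp: einterval_def)
  have set_eq: "indicator (einterval 0 \<infinity>) \<tau> *\<^sub>R (F (g \<tau>) * (1 / \<tau>))
      = (2 / z) powr \<nu> * Gamma \<nu> * (gamma_density \<nu> \<tau> * exp (- (z\<^sup>2 / 4 / \<tau>)))" for \<tau>
    using F_g[of \<tau>] gamma_density_nonpos[of \<tau>] by (cases "0 < \<tau>") (auto simp: eint)
  have int_sub: "set_integrable lborel (einterval 0 \<infinity>) (\<lambda>\<tau>. F (g \<tau>) * (1 / \<tau>))"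
    unfolding set_integrable_def set_eq using int_mix by simp
  have deriv: "DERIV g x :> 1 / x" if "0 < ereal x" "ereal x < \<infinity>" for x
    using that z unfolding g_def by (auto intro!: derivative_eq_intros simp: field_simps)
  have contF: "isCont F (g x)" if "0 < ereal x" "ereal x < \<infinity>" for x
    unfolding F_def by (intro continuous_intros)
  have cont': "isCont (\<lambda>x. 1 / x) x" if "0 < ereal x" "ereal x < \<infinity>" for x
    using that by (intro continuous_intros) auto
  have F0: "0 \<le> F (g x)" if "0 < ereal x" "ereal x < \<infinity>" for x
    by (simp add: F_def)
  have pos': "0 \<le> 1 / x" if "0 \<le> ereal x" "ereal x \<le> \<infinity>" for x using that by simp
  have "filterlim (\<lambda>x. ln (2 * x / z)) at_bot (at_right 0)"
    using z by real_asymp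
  then have lim0: "((ereal \<circ> g \<circ> real_of_ereal) \<longlongrightarrow> - \<infinity>) (at_right 0)"
    unfolding zero_ereal_def ereal_tendsto_simps g_def .
  have "filterlim (\<lambda>x. ln (2 * x / z)) at_top at_top"
    using z by real_asymp
  then have lim_top: "((ereal \<circ> g \<circ> real_of_ereal) \<longlongrightarrow> \<infinity>) (at_left \<infinity>)"
    unfolding ereal_tendsto_simps g_def .
  note sub = interval_integral_substitution_nonneg[where a=0 and b="\<infinity>" and g=g
      and g'="\<lambda>x. 1 / x" and f=F, OF _ deriv contF cont' F0 pos' lim0 lim_top int_sub, simplified]
  have F_int: "integrable lborel F"
    using sub(1) by (simp add: eint' set_integrable_def)
  have F_eq: "(\<integral>t. F t \<partial>lborel) = (2 / z) powr \<nu> * Gamma \<nu> * (\<integral>\<tau>. exp (- (z\<^sup>2 / 4 / \<tau>)) \<partial>gamma_law \<nu>)"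
  proof -
    have "(\<integral>t. F t \<partial>lborel) = (LBINT x=-\<infinity>..\<infinity>. F x)"
      by (simp add: interval_lebesgue_integral_def eint' set_lebesgue_integral_def)
    also have "\<dots> = (\<integral>\<tau>. indicator (einterval 0 \<infinity>) \<tau> *\<^sub>R (F (g \<tau>) * (1 / \<tau>)) \<partial>lborel)"
      unfolding sub(2) by (simp add: interval_lebesgue_integral_def set_lebesgue_integral_def)
    also have "\<dots> = (2 / z) powr \<nu> * Gamma \<nu> * (\<integral>\<tau>. gamma_density \<nu> \<tau> * exp (- (z\<^sup>2 / 4 / \<tau>)) \<partial>lborel)"
      unfolding set_eq by simp
    also have "(\<integral>\<tau>. gamma_density \<nu> \<tau> * exp (- (z\<^sup>2 / 4 / \<tau>)) \<partial>lborel)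
        = (\<integral>\<tau>. exp (- (z\<^sup>2 / 4 / \<tau>)) \<partial>gamma_law \<nu>)"
      by (rule integral_gamma_law[OF \<nu>, symmetric]) measurable
    finally show ?thesis .
  qed
  \<comment> \<open>The even part of F: its integral over the line equals that of F and is twice the
    half-line integral of the Bessel function.\<close>
  define h where "h t = exp (- z * cosh t) * cosh (\<nu> * t)" for t
  have h_F: "h t = 1/2 * F t + 1/2 * F (- t)" for t
    unfolding h_def F_def by (simp add: cosh_def exp_add[symmetric] field_simps)
  have F_refl: "integrable lborel (\<lambda>t. F (- t))" "(\<integral>t. F (- t) \<partial>lborel) = (\<integral>t. F t \<partial>lborel)"
    using lborel_integrable_real_affine[OF F_int, of "-1" 0] lborel_integral_real_affine[of "-1" F 0]
    by simp_all
  have h_int: "integrable lborel h" and h_eq: "(\<integral>t. h t \<partial>lborel) = (\<integral>t. F t \<partial>lborel)"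
    unfolding h_F using F_int F_refl by simp_all
  have "has_bochner_integral lborel h (2 *\<^sub>R (\<integral>t. indicator {0..} t *\<^sub>R h t \<partial>lborel))"
  proof (rule has_bochner_integral_even_function)
    show "has_bochner_integral lborel (\<lambda>t. indicator {0..} t *\<^sub>R h t) (\<integral>t. indicator {0..} t *\<^sub>R h t \<partial>lborel)"
      using integrable_mult_indicator[OF _ h_int, of "{0..}"] by (intro has_bochner_integral_integrable) simp
    show "h (- t) = h t" for t by (simp add: h_F)
  qed
  then have "(\<integral>t. h t \<partial>lborel) = 2 * bessel_K \<nu> z"
    unfolding bessel_K_def set_lebesgue_integral_def h_def
    by (simp add: has_bochner_integral_integral_eq)
  then have bessel: "bessel_K \<nu> z = 1/2 * ((2 / z) powr \<nu> * Gamma \<nu> * (\<integral>\<tau>. exp (- (z\<^sup>2 / 4 / \<tau>)) \<partial>gamma_law \<nu>))"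
    using h_eq F_eq by simp
  have "2 powr (1 - \<nu>) / Gamma \<nu> * z powr \<nu> * (1/2 * ((2 / z) powr \<nu> * Gamma \<nu> * m)) = m" for m
  proof -
    have "2 powr (1 - \<nu>) = 2 / 2 powr \<nu>" by (simp add: powr_diff)
    moreover have "(2 / z) powr \<nu> = 2 powr \<nu> / z powr \<nu>" using z by (simp add: powr_divide)
    ultimately show ?thesis using z G by simp
  qed
  then show ?thesis unfolding bessel .
qed

text \<open>For given \<tau> the integrand is the Gaussian kernel of squared length scale l^2 \<tau>
  / \<nu>. On the diagonal it equals 1, and the total mass 1 agrees with the value prescribed
  there.\<close>

lemma matern_kernel_eq_gamma_mixture:
  fixes x y :: "'a::real_normed_vector"
  assumes \<nu>: "0 < \<nu>" and l: "0 < l"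
  shows "matern_kernel \<nu> l x y = (\<integral>\<tau>. exp (- (\<nu> / (2 * l\<^sup>2) / \<tau> * (norm (x - y))\<^sup>2)) \<partial>gamma_law \<nu>)"
proof (cases "x = y")
  case True
  then show ?thesis
    using prob_space.prob_space[OF prob_space_gamma_law[OF \<nu>]] by (simp add: matern_kernel_def)
next
  case False
  define z where "z = sqrt (2 * \<nu>) * norm (x - y) / l"
  have "0 < z" unfolding z_def using \<nu> l False by simp
  moreover have "z\<^sup>2 / 4 / \<tau> = \<nu> / (2 * l\<^sup>2) / \<tau> * (norm (x - y))\<^sup>2" for \<tau>
    unfolding z_def using \<nu> by (simp add: power_divide power_mult_distrib)
  ultimately show ?thesis
    using bessel_K_eq_gamma_mixture[OF \<nu>, of z] False
    unfolding matern_kernel_def z_def[symmetric] by simp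
qed

text \<open>The same coefficients a serve all scales, so the gap can be estimated scale by scale.
  For \<tau> in I the bump is a Gaussian section of height r/m, at cost (r/m)^2; outside I only
  minus a nonnegative form remains. Integration gives (r/m)^2 m.\<close>

lemma gaussian_mixture_energy_le:
  fixes S :: "(real ^ 'd::finite) set" and c :: "'b \<Rightarrow> real"
  assumes "prob_space M" and c[measurable]: "c \<in> borel_measurable M" and I[measurable]: "I \<in> sets M"
    and pos: "0 < measure M I" and S: "finite S"
  shows "2 * (\<Sum>x\<in>S. a x * (r / measure M I *
      (\<integral>\<tau>. indicator I \<tau> * exp (- ((c \<tau>)\<^sup>2 * (norm (x - p))\<^sup>2 / 2)) \<partial>M)))
    - (\<Sum>x\<in>S. \<Sum>y\<in>S. a x * a y * (\<integral>\<tau>. exp (- ((c \<tau>)\<^sup>2 * (norm (x - y))\<^sup>2 / 2)) \<partial>M))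
    \<le> r\<^sup>2 / measure M I"
proof -
  interpret prob_space M by fact
  define m where "m = measure M I"
  let ?e = "\<lambda>\<tau> s. exp (- ((c \<tau>)\<^sup>2 * (norm (s :: real ^ 'd))\<^sup>2 / 2))"
  have int_e: "integrable M (\<lambda>\<tau>. ?e \<tau> s)" for s
    by (rule integrable_const_bound[where B=1]) auto
  have int_ie: "integrable M (\<lambda>\<tau>. indicator I \<tau> * ?e \<tau> s)" for s
    using integrable_mult_indicator[OF I int_e[of s]] by simp
  have "2 * (\<Sum>x\<in>S. a x * (r / m * (\<integral>\<tau>. indicator I \<tau> * ?e \<tau> (x - p) \<partial>M)))
      - (\<Sum>x\<in>S. \<Sum>y\<in>S. a x * a y * (\<integral>\<tau>. ?e \<tau> (x - y) \<partial>M))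
    = (\<integral>\<tau>. 2 * (\<Sum>x\<in>S. a x * (r / m * (indicator I \<tau> * ?e \<tau> (x - p))))
        - (\<Sum>x\<in>S. \<Sum>y\<in>S. a x * a y * ?e \<tau> (x - y)) \<partial>M)"
    using int_e int_ie by simp
  also have "\<dots> \<le> (\<integral>\<tau>. (r / m)\<^sup>2 * indicator I \<tau> \<partial>M)"
  proof (rule integral_mono)
    show "integrable M (\<lambda>\<tau>. 2 * (\<Sum>x\<in>S. a x * (r / m * (indicator I \<tau> * ?e \<tau> (x - p))))
        - (\<Sum>x\<in>S. \<Sum>y\<in>S. a x * a y * ?e \<tau> (x - y)))"
      using int_e int_ie by simp
    show "integrable M (\<lambda>\<tau>. (r / m)\<^sup>2 * indicator I \<tau>)"
      by (intro integrable_mult_right integrable_real_indicator) (auto simp: emeasure_eq_measure)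
    fix \<tau>
    show "2 * (\<Sum>x\<in>S. a x * (r / m * (indicator I \<tau> * ?e \<tau> (x - p))))
        - (\<Sum>x\<in>S. \<Sum>y\<in>S. a x * a y * ?e \<tau> (x - y)) \<le> (r / m)\<^sup>2 * indicator I \<tau>"
    proof (cases "\<tau> \<in> I")
      case True
      then show ?thesis using gaussian_section_energy_le[OF S, of a "r / m" "c \<tau>" p] by simp
    next
      case False
      then show ?thesis using gaussian_psd[OF S, of a "c \<tau>"] by simp
    qed
  qed
  also have "\<dots> = (r / m)\<^sup>2 * m" by (simp add: m_def)
  also have "\<dots> = r\<^sup>2 / m" using pos by (simp add: m_def power2_eq_square)
  finally show ?thesis unfolding m_def .
qed

text \<open>Splitting \<tau> powr (\<nu> - 1) as \<tau> powr \<nu> / \<tau> avoids a case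
  distinction on the sign of \<nu> - 1: the numerator is bounded at the left end, 1/\<tau> and exp
  (-\<tau>) at the right end.\<close>

lemma gamma_law_dyadic_ge:
  assumes \<nu>: "0 < \<nu>" and \<theta>: "0 < \<theta>"
  shows "\<theta> powr \<nu> / (2 * Gamma \<nu> * exp (2 * \<theta>)) \<le> measure (gamma_law \<nu>) {\<theta>..2 * \<theta>}"
proof -
  interpret prob_space "gamma_law \<nu>" by (rule prob_space_gamma_law[OF \<nu>])
  have G: "0 < Gamma \<nu>" using \<nu> by (rule Gamma_real_pos)
  define C where "C = \<theta> powr \<nu> / (2 * \<theta>) / exp (2 * \<theta>) / Gamma \<nu>"
  have C: "0 \<le> C" unfolding C_def using G \<theta> by simp
  have dens: "C \<le> gamma_density \<nu> \<tau>" if "\<tau> \<in> {\<theta>..2 * \<theta>}" for \<tau>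
  proof -
    have "\<theta> powr \<nu> / (2 * \<theta>) \<le> \<tau> powr \<nu> / \<tau>"
      using that \<theta> \<nu> by (intro frac_le powr_mono2) auto
    also have "\<dots> = \<tau> powr (\<nu> - 1)" using that \<theta> by (simp add: powr_diff)
    finally have "C \<le> \<tau> powr (\<nu> - 1) / exp \<tau> / Gamma \<nu>"
      unfolding C_def using that G \<theta> by (intro divide_right_mono frac_le) auto
    then show ?thesis using that \<theta> by (simp add: gamma_density_def)
  qed
  have "ennreal (C * \<theta>) = (\<integral>\<^sup>+\<tau>. ennreal C * indicator {\<theta>..2 * \<theta>} \<tau> \<partial>lborel)"
    using C \<theta> by (simp add: nn_integral_cmult_indicator ennreal_mult)
  also have "\<dots> \<le> (\<integral>\<^sup>+\<tau>. ennreal (gamma_density \<nu> \<tau>) * indicator {\<theta>..2 * \<theta>} \<tau> \<partial>lborel)"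
    using dens by (intro nn_integral_mono) (auto simp: indicator_def intro!: ennreal_leI)
  also have "\<dots> = emeasure (gamma_law \<nu>) {\<theta>..2 * \<theta>}"
    by (subst emeasure_density) auto
  finally have "C * \<theta> \<le> measure (gamma_law \<nu>) {\<theta>..2 * \<theta>}"
    by (simp add: emeasure_eq_measure)
  then show ?thesis unfolding C_def using \<theta> by (simp add: mult_ac)
qed

lemma exists_matern_bump:
  fixes p :: "real ^ 'd::finite"
  assumes \<nu>: "0 < \<nu>" and l: "0 < l" and N: "1 \<le> N" and r: "0 \<le> r"
  shows "\<exists>f\<in>borel_measurable borel. f p = r \<and> (\<forall>x. f x \<le> r) \<and>
    (\<forall>x. (f x)\<^sup>2 \<le> r\<^sup>2 * exp (- (N\<^sup>2 * (norm (x - p))\<^sup>2))) \<and>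
    (\<forall>S a. finite S \<longrightarrow>
      kernel_gap (matern_kernel \<nu> l) S a f
      \<le> r\<^sup>2 * (2 * Gamma \<nu> * exp (\<nu> / l\<^sup>2) / (\<nu> / (2 * l\<^sup>2)) powr \<nu> * N powr (2 * \<nu>)))"
proof -
  interpret prob_space "gamma_law \<nu>" by (rule prob_space_gamma_law[OF \<nu>])
  have G: "0 < Gamma \<nu>" using \<nu> by (rule Gamma_real_pos)
  define b where "b = \<nu> / (2 * l\<^sup>2)"
  \<comment> \<open>Scales in [\<theta>, 2 \<theta>] satisfy b/\<tau> >= N^2/2, which gives the
    Gaussian decay at width 1/N; the mass of this interval is at least of order N powr (-2 \<nu>),
    which gives the norm.\<close>
  define \<theta> where "\<theta> = b / N\<^sup>2"
  define I where "I = {\<theta>..2 * \<theta>}"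
  \<comment> \<open>The law lives on \<tau> > 0, where (c \<tau>)^2 / 2 = b/\<tau>; the absolute
    value keeps the radicand nonnegative elsewhere.\<close>
  define c where "c \<tau> = sqrt (2 * (b / \<bar>\<tau>\<bar>))" for \<tau>
  define m where "m = measure (gamma_law \<nu>) I"
  have b: "0 < b" unfolding b_def using \<nu> l by simp
  have \<theta>: "0 < \<theta>" unfolding \<theta>_def using b N by simp
  have m_ge: "\<theta> powr \<nu> / (2 * Gamma \<nu> * exp (2 * \<theta>)) \<le> m"
    unfolding m_def I_def by (rule gamma_law_dyadic_ge[OF \<nu> \<theta>])
  have "0 < \<theta> powr \<nu> / (2 * Gamma \<nu> * exp (2 * \<theta>))" using \<theta> G by simp
  then have m: "0 < m" using m_ge by linarith
  let ?e = "\<lambda>\<tau> s. exp (- ((c \<tau>)\<^sup>2 * (norm (s :: real ^ 'd))\<^sup>2 / 2))"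
  define f where "f x = r / m * (\<integral>\<tau>. indicator I \<tau> * ?e \<tau> (x - p) \<partial>gamma_law \<nu>)" for x
  have c_meas[measurable]: "c \<in> borel_measurable borel" unfolding c_def by measurable
  have I_meas[measurable]: "I \<in> sets borel" unfolding I_def by simp
  have e_eq: "?e \<tau> s = exp (- (b / \<tau> * (norm s)\<^sup>2))" if "0 < \<tau>" for \<tau> s
    using that b by (simp add: c_def)
  have int_ie: "integrable (gamma_law \<nu>) (\<lambda>\<tau>. indicator I \<tau> * ?e \<tau> s)" for s
    by (rule integrable_const_bound[where B=1]) (auto simp: indicator_def)
  have int_I: "integrable (gamma_law \<nu>) (\<lambda>\<tau>. indicator I \<tau> * C)" for C :: real
    by (intro integrable_mult_left integrable_real_indicator) (auto simp: emeasure_eq_measure)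
  have f_le: "0 \<le> f x" "f x \<le> r * exp (- (N\<^sup>2 / 2 * (norm (x - p))\<^sup>2))" for x
  proof -
    show "0 \<le> f x" unfolding f_def using r m by (intro mult_nonneg_nonneg) auto
    have "(\<integral>\<tau>. indicator I \<tau> * ?e \<tau> (x - p) \<partial>gamma_law \<nu>)
        \<le> (\<integral>\<tau>. indicator I \<tau> * exp (- (N\<^sup>2 / 2 * (norm (x - p))\<^sup>2)) \<partial>gamma_law \<nu>)"
    proof (rule integral_mono[OF int_ie int_I])
      fix \<tau>
      show "indicator I \<tau> * ?e \<tau> (x - p) \<le> indicator I \<tau> * exp (- (N\<^sup>2 / 2 * (norm (x - p))\<^sup>2))"
      proof (cases "\<tau> \<in> I")
        case True
        then have \<tau>: "0 < \<tau>" "\<tau> \<le> 2 * \<theta>" using \<theta> by (auto simp: I_def)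
        have "N\<^sup>2 / 2 = b / (2 * \<theta>)" using b N by (simp add: \<theta>_def)
        also have "\<dots> \<le> b / \<tau>" using \<tau> b \<theta> by (intro divide_left_mono) auto
        finally have "N\<^sup>2 / 2 * (norm (x - p))\<^sup>2 \<le> b / \<tau> * (norm (x - p))\<^sup>2"
          by (rule mult_right_mono) simp
        then show ?thesis using True unfolding e_eq[OF \<tau>(1)] by simp
      qed simp
    qed
    also have "\<dots> = m * exp (- (N\<^sup>2 / 2 * (norm (x - p))\<^sup>2))" by (simp add: m_def)
    finally have "f x \<le> r / m * (m * exp (- (N\<^sup>2 / 2 * (norm (x - p))\<^sup>2)))"
      unfolding f_def using r m by (intro mult_left_mono) auto
    then show "f x \<le> r * exp (- (N\<^sup>2 / 2 * (norm (x - p))\<^sup>2))" using m by simp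
  qed
  show ?thesis
  proof (intro bexI[of _ f] conjI allI impI)
    have "(\<lambda>x. \<integral>\<tau>. indicator I \<tau> * ?e \<tau> (x - p) \<partial>gamma_law \<nu>) \<in> borel_measurable borel"
      by (rule borel_measurable_lebesgue_integral) measurable
    then show "f \<in> borel_measurable borel" unfolding f_def by measurable
    show "f p = r" unfolding f_def using m by (simp add: m_def)
    show "f x \<le> r" for x
      using f_le(2)[of x] mult_left_mono[of "exp (- (N\<^sup>2 / 2 * (norm (x - p))\<^sup>2))" 1 r] r by simp
    show "(f x)\<^sup>2 \<le> r\<^sup>2 * exp (- (N\<^sup>2 * (norm (x - p))\<^sup>2))" for x
    proof -
      have "(f x)\<^sup>2 \<le> (r * exp (- (N\<^sup>2 / 2 * (norm (x - p))\<^sup>2)))\<^sup>2" by (intro power_mono f_le)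
      also have "\<dots> = r\<^sup>2 * exp (- (N\<^sup>2 * (norm (x - p))\<^sup>2))"
        by (simp add: power_mult_distrib power2_eq_square exp_add[symmetric])
      finally show ?thesis .
    qed
    show "kernel_gap (matern_kernel \<nu> l) S a f
      \<le> r\<^sup>2 * (2 * Gamma \<nu> * exp (\<nu> / l\<^sup>2) / (\<nu> / (2 * l\<^sup>2)) powr \<nu> * N powr (2 * \<nu>))"
      if S: "finite S" for S :: "(real ^ 'd) set" and a
    proof -
      have kern: "matern_kernel \<nu> l x y = (\<integral>\<tau>. ?e \<tau> (x - y) \<partial>gamma_law \<nu>)" for x y :: "real ^ 'd"
        unfolding matern_kernel_eq_gamma_mixture[OF \<nu> l] b_def[symmetric]
      proof (rule integral_cong_AE)
        show "AE \<tau> in gamma_law \<nu>. exp (- (b / \<tau> * (norm (x - y))\<^sup>2)) = ?e \<tau> (x - y)"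
          using AE_gamma_law_pos by eventually_elim (simp add: e_eq)
      qed simp_all
      have "kernel_gap (matern_kernel \<nu> l) S a f \<le> r\<^sup>2 / m"
        unfolding kern f_def m_def
      proof (rule gaussian_mixture_energy_le[OF prob_space_axioms _ _ _ S])
        show "0 < prob I" using m unfolding m_def .
      qed simp_all
      also have "\<dots> = r\<^sup>2 * (1 / m)" by simp
      also have "\<dots> \<le> r\<^sup>2 * (1 / (\<theta> powr \<nu> / (2 * Gamma \<nu> * exp (2 * \<theta>))))"
        using m_ge \<open>0 < \<theta> powr \<nu> / (2 * Gamma \<nu> * exp (2 * \<theta>))\<close>
        by (intro mult_left_mono frac_le) auto
      also have "1 / (\<theta> powr \<nu> / (2 * Gamma \<nu> * exp (2 * \<theta>)))
          \<le> 2 * Gamma \<nu> * exp (2 * b) / b powr \<nu> * N powr (2 * \<nu>)"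
      proof -
        have "N powr (2 * \<nu>) = (N\<^sup>2) powr \<nu>"
          using N powr_powr[of N 2 \<nu>] by simp
        then have "\<theta> powr \<nu> = b powr \<nu> / N powr (2 * \<nu>)"
          unfolding \<theta>_def using b N by (simp add: powr_divide)
        then have "1 / (\<theta> powr \<nu> / (2 * Gamma \<nu> * exp (2 * \<theta>)))
            = 2 * Gamma \<nu> * exp (2 * \<theta>) / b powr \<nu> * N powr (2 * \<nu>)" by simp
        \<comment> \<open>N >= 1 gives \<theta> <= b, so the exponential factor is bounded
          independently of N.\<close>
        also have "\<dots> \<le> 2 * Gamma \<nu> * exp (2 * b) / b powr \<nu> * N powr (2 * \<nu>)"
        proof -
          have "b \<le> b * N\<^sup>2" using b N by simp
          then have "\<theta> \<le> b" unfolding \<theta>_def using N by (simp add: divide_le_eq)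
          then show ?thesis using G
            by (intro mult_right_mono divide_right_mono mult_left_mono) auto
        qed
        finally show ?thesis .
      qed
      also have "2 * b = \<nu> / l\<^sup>2" by (simp add: b_def)
      finally show ?thesis by (simp add: b_def mult_left_mono)
    qed
  qed
qed

section \<open>Grids of bumps\<close>

text \<open>Mean value theorem for arctan: every \<xi> within distance 1 of s satisfies 1 + \<xi>^2
  <= 3 (1 + s^2). Bounding by increments of arctan lets sums over the grid telescope.\<close>

lemma inverse_one_plus_square_le_arctan:
  fixes s :: real
  shows "1 / (1 + s\<^sup>2) \<le> 3 * (arctan (s + 1) - arctan s)"
proof -
  have "\<exists>\<xi>. s < \<xi> \<and> \<xi> < s + 1 \<and> arctan (s + 1) - arctan s = (s + 1 - s) * inverse (1 + \<xi>\<^sup>2)"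
    by (rule MVT2) (auto intro!: DERIV_arctan)
  then obtain \<xi> where \<xi>: "s < \<xi>" "\<xi> < s + 1" "arctan (s + 1) - arctan s = inverse (1 + \<xi>\<^sup>2)"
    by auto
  have "\<xi>\<^sup>2 \<le> 2 * s\<^sup>2 + 2 * (\<xi> - s)\<^sup>2"
  proof -
    have "0 \<le> (\<xi> - 2 * s)\<^sup>2" by simp
    then show ?thesis by (simp add: power2_eq_square algebra_simps)
  qed
  moreover have "(\<xi> - s)\<^sup>2 \<le> 1" using \<xi> by (intro power_le_one) auto
  ultimately have "1 + \<xi>\<^sup>2 \<le> 3 * (1 + s\<^sup>2)" using zero_le_power2[of s] by argo
  then have le: "1 / (3 * (1 + s\<^sup>2)) \<le> 1 / (1 + \<xi>\<^sup>2)"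
    by (intro divide_left_mono) (auto intro!: mult_pos_pos add_pos_nonneg)
  have "1 + s\<^sup>2 \<noteq> 0" using zero_le_power2[of s] by linarith
  then have "1 / (1 + s\<^sup>2) = 3 * (1 / (3 * (1 + s\<^sup>2)))" by (simp add: field_simps)
  also have "\<dots> \<le> 3 * (1 / (1 + \<xi>\<^sup>2))" by (rule mult_left_mono[OF le]) simp
  finally show ?thesis unfolding \<xi>(3) inverse_eq_divide .
qed

text \<open>The telescoped sum is 6 times an increment of arctan, which is below pi < 4; hence a
  constant free of y and of the number of terms.\<close>

lemma sum_decay_le: "(\<Sum>k<N. 2 / (1 + (y - real k)\<^sup>2)) \<le> 24"
proof -
  have "(\<Sum>k<N. 2 / (1 + (y - real k)\<^sup>2))
      \<le> (\<Sum>k<N. 6 * (arctan (real (Suc k) - y) - arctan (real k - y)))"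
  proof (rule sum_mono)
    fix k
    have "2 / (1 + (y - real k)\<^sup>2) = 2 * (1 / (1 + (real k - y)\<^sup>2))"
      by (simp add: power2_commute)
    also have "\<dots> \<le> 6 * (arctan (real k - y + 1) - arctan (real k - y))"
      using inverse_one_plus_square_le_arctan[of "real k - y"] by linarith
    finally show "2 / (1 + (y - real k)\<^sup>2) \<le> 6 * (arctan (real (Suc k) - y) - arctan (real k - y))"
      by (simp add: algebra_simps)
  qed
  also have "\<dots> = 6 * (arctan (real N - y) - arctan (real 0 - y))"
    unfolding sum_distrib_left[symmetric] by (subst sum_lessThan_telescope) simp
  also have "\<dots> \<le> 24"
  proof -
    have "arctan a - arctan b \<le> 4" for a b :: real
      using arctan_ubound[of a] arctan_lbound[of b] pi_less_4 by argo
    from this[of "real N - y" "real 0 - y"] show ?thesis by simp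
  qed
  finally show ?thesis .
qed

type_synonym 'd kernel = "(real, 'd) vec \<Rightarrow> (real, 'd) vec \<Rightarrow> real"

definition grid :: "nat \<Rightarrow> ('d::finite \<Rightarrow> nat) set" where
  "grid N = (\<Pi>\<^sub>E i\<in>UNIV. {..<N})"

lemma finite_grid: "finite (grid N)"
  unfolding grid_def by (intro finite_PiE) auto

lemma card_grid: "card (grid N :: ('d::finite \<Rightarrow> nat) set) = N ^ CARD('d)"
  unfolding grid_def by (simp add: card_PiE)

text \<open>A sum of products over the grid is a product of one-dimensional sums. The bound does not
  grow with N: at any point only boundedly many bumps matter in the square sense.\<close>

lemma sum_grid_decay_le:
  fixes x :: "real ^ 'd::finite"
  assumes N: "0 < N"
  shows "(\<Sum>m\<in>grid N. \<Prod>i\<in>UNIV. 2 / (1 + (real N * (x $ i - real (m i) / real N))\<^sup>2)) \<le> 24 ^ CARD('d)"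
proof -
  have "(\<Sum>m\<in>grid N. \<Prod>i\<in>UNIV. 2 / (1 + (real N * (x $ i - real (m i) / real N))\<^sup>2))
      = (\<Prod>i\<in>UNIV. \<Sum>k<N. 2 / (1 + (real N * (x $ i - real k / real N))\<^sup>2))"
    unfolding grid_def by (rule prod_sum_PiE[symmetric]) auto
  also have "\<dots> = (\<Prod>i\<in>UNIV. \<Sum>k<N. 2 / (1 + (real N * x $ i - real k)\<^sup>2))"
    using N by (simp add: right_diff_distrib)
  also have "\<dots> \<le> (\<Prod>i\<in>(UNIV :: 'd set). 24)"
    by (intro prod_mono conjI sum_nonneg sum_decay_le) auto
  finally show ?thesis by simp
qed

text \<open>Overlapping bumps are allowed; the last clause is the substitute for disjoint supports,
  and its constant is uniform in N.\<close>

definition bump_family ::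
    "'d::finite kernel \<Rightarrow> real \<Rightarrow> nat \<Rightarrow> real
      \<Rightarrow> (('d \<Rightarrow> nat) \<Rightarrow> real ^ 'd \<Rightarrow> real) \<Rightarrow> (('d \<Rightarrow> nat) \<Rightarrow> real ^ 'd) \<Rightarrow> bool" where
  "bump_family k \<Psi> N \<epsilon> F xs \<longleftrightarrow>
     (\<forall>m\<in>grid N. in_rkhs_ball unit_cube k \<Psi> (F m) \<and> F m \<in> borel_measurable borel \<and>
        xs m \<in> unit_cube \<and> F m (xs m) = \<epsilon> \<and> (\<forall>x\<in>unit_cube. F m x \<le> \<epsilon>)) \<and>
     (\<forall>x\<in>unit_cube. (\<Sum>m\<in>grid N. (F m x)\<^sup>2) \<le> 24 ^ CARD('d) * \<epsilon>\<^sup>2)"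

lemma closed_unit_cube: "closed (unit_cube :: (real ^ 'd::finite) set)"
  unfolding unit_cube_def by (intro closed_Collect_all closed_Collect_conj closed_Collect_le continuous_intros)

text \<open>The product envelope with factors 2/(1 + s^2) dominates both squared sinc functions and
  Gaussians, so one decay condition serves both kernels.\<close>

lemma exists_bump_family:
  fixes k :: "'d::finite kernel" and f :: "real ^ 'd \<Rightarrow> real ^ 'd \<Rightarrow> real"
  assumes sym: "\<And>x y. k x y = k y x"
    and psd: "\<And>S a. finite S \<Longrightarrow> 0 \<le> kernel_form k S a"
    and N: "0 < N" and \<Psi>: "0 \<le> \<Psi>"
    and meas: "\<And>p. f p \<in> borel_measurable borel"
    and peak: "\<And>p. f p p = \<epsilon>" and le: "\<And>p x. f p x \<le> \<epsilon>"
    and decay: "\<And>p x. (f p x)\<^sup>2 \<le> \<epsilon>\<^sup>2 * (\<Prod>i\<in>UNIV. 2 / (1 + (real N * (x $ i - p $ i))\<^sup>2))"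
    and energy: "\<And>p S a. finite S \<Longrightarrow>
      kernel_gap k S a (f p) \<le> \<Psi>\<^sup>2"
  shows "\<exists>F xs. bump_family k \<Psi> N \<epsilon> F xs"
proof (intro exI)
  define xs where "xs m = (\<chi> i. real (m i) / real N)" for m :: "'d \<Rightarrow> nat"
  \<comment> \<open>Members of the RKHS over the cube are extended by 0. The gap only sees points of
    the cube, so this cutoff costs no norm.\<close>
  define F where "F m x = (if x \<in> unit_cube then f (xs m) x else 0)" for m :: "'d \<Rightarrow> nat" and x
  have [measurable]: "unit_cube \<in> sets (borel :: (real ^ 'd) measure)"
    using closed_unit_cube by (rule borel_closed)
  have xs: "xs m \<in> unit_cube" if "m \<in> grid N" for m
  proof -
    have "m i < N" for i using that unfolding grid_def by auto
    then show ?thesis using N by (auto simp: xs_def unit_cube_def intro: less_imp_le)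
  qed
  have rkhs: "in_rkhs_ball unit_cube k \<Psi> (F m)" for m
  proof (rule in_rkhs_ballI[OF sym psd _ _ \<Psi>])
    show "F m x = 0" if "x \<notin> unit_cube" for x using that by (simp add: F_def)
    show "kernel_gap k S a (F m) \<le> \<Psi>\<^sup>2"
      if "finite S" "S \<subseteq> unit_cube" for S a
    proof -
      have "(\<Sum>x\<in>S. a x * F m x) = (\<Sum>x\<in>S. a x * f (xs m) x)"
        using that(2) by (intro sum.cong) (auto simp: F_def)
      then show ?thesis using energy[OF that(1), of a "xs m"] by simp
    qed
  qed
  have F_meas: "F m \<in> borel_measurable borel" for m
    unfolding F_def using meas[of "xs m"] by measurable
  have sq: "(\<Sum>m\<in>grid N. (F m x)\<^sup>2) \<le> 24 ^ CARD('d) * \<epsilon>\<^sup>2" if x: "x \<in> unit_cube" for x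
  proof -
    have "(\<Sum>m\<in>grid N. (F m x)\<^sup>2)
        \<le> (\<Sum>m\<in>grid N. \<epsilon>\<^sup>2 * (\<Prod>i\<in>UNIV. 2 / (1 + (real N * (x $ i - real (m i) / real N))\<^sup>2)))"
    proof (rule sum_mono)
      fix m
      show "(F m x)\<^sup>2 \<le> \<epsilon>\<^sup>2 * (\<Prod>i\<in>UNIV. 2 / (1 + (real N * (x $ i - real (m i) / real N))\<^sup>2))"
        using decay[of "xs m" x] x by (simp add: F_def xs_def)
    qed
    also have "\<dots> \<le> \<epsilon>\<^sup>2 * 24 ^ CARD('d)"
      unfolding sum_distrib_left[symmetric] by (intro mult_left_mono sum_grid_decay_le N) simp
    finally show ?thesis by (simp add: mult.commute)
  qed
  show "bump_family k \<Psi> N \<epsilon> F xs"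
    unfolding bump_family_def using rkhs F_meas xs sq peak le by (auto simp: F_def)
qed

section \<open>Bump families for the SE and the Matern kernel\<close>

lemma sinc_square_le: "(sinc t)\<^sup>2 \<le> 2 / (1 + t\<^sup>2)"
proof (cases "t = 0")
  case False
  have "\<bar>sin t\<bar> \<le> \<bar>t\<bar>" by (rule abs_sin_x_le_abs_x)
  then have "(sin t)\<^sup>2 \<le> t\<^sup>2" by (simp only: abs_le_square_iff)
  moreover have "(sin t)\<^sup>2 * t\<^sup>2 \<le> 1 * t\<^sup>2" by (intro mult_right_mono) (auto simp: abs_square_le_1)
  ultimately have "(sin t)\<^sup>2 * (1 + t\<^sup>2) \<le> 2 * t\<^sup>2" by (simp add: distrib_left)
  moreover have "0 < 1 + t\<^sup>2" by (simp add: add_pos_nonneg)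
  ultimately show ?thesis using False by (simp add: power_divide divide_le_eq le_divide_eq)
qed simp

lemma se_bump_family:
  assumes l: "0 < l" and N: "0 < N" and \<Psi>: "0 \<le> \<Psi>" and \<epsilon>: "0 \<le> \<epsilon>"
    and norm: "\<epsilon>\<^sup>2 * ((pi / (2 * l\<^sup>2)) ^ CARD('d::finite) * exp (real CARD('d) * l\<^sup>2 * (real N)\<^sup>2)) \<le> \<Psi>\<^sup>2"
  shows "\<exists>F xs. bump_family (se_kernel l :: 'd kernel) \<Psi> N \<epsilon> F xs"
proof (rule exists_bump_family[where f = "\<lambda>p x. \<epsilon> * (\<Prod>i\<in>UNIV. sinc (real N * (x $ i - p $ i)))"])
  fix p x y :: "real ^ 'd" and S :: "(real ^ 'd) set" and a
  show "se_kernel l x y = se_kernel l y x" by (simp add: se_kernel_def norm_minus_commute)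
  show "0 \<le> kernel_form (se_kernel l) S a" if "finite S"
    using sinc_bump_energy_le[OF l, of 1 S a 0 0] that by simp
  have [measurable]: "(\<lambda>x. x $ i) \<in> borel_measurable (borel :: (real ^ 'd) measure)" for i
    by (intro borel_measurable_continuous_onI continuous_intros)
  have "(\<lambda>x. sinc (real N * (x $ i - p $ i))) \<in> borel_measurable (borel :: (real ^ 'd) measure)" for i
    by (rule measurable_compose[OF _ borel_measurable_sinc]) measurable
  then show "(\<lambda>x. \<epsilon> * (\<Prod>i\<in>UNIV. sinc (real N * (x $ i - p $ i)))) \<in> borel_measurable borel"
    by (intro borel_measurable_times borel_measurable_prod borel_measurable_const)
  show "\<epsilon> * (\<Prod>i\<in>(UNIV :: 'd set). sinc (real N * (p $ i - p $ i))) = \<epsilon>" by simp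
  have "\<bar>sinc t\<bar> \<le> 1" for t
    using abs_sin_x_le_abs_x[of t] by (simp add: abs_divide divide_le_eq)
  then have "\<bar>\<Prod>i\<in>(UNIV :: 'd set). sinc (real N * (x $ i - p $ i))\<bar> \<le> 1"
    unfolding abs_prod by (intro prod_le_1 conjI abs_ge_zero)
  then have "(\<Prod>i\<in>(UNIV :: 'd set). sinc (real N * (x $ i - p $ i))) \<le> 1" by (rule abs_le_D1)
  from mult_left_mono[OF this \<epsilon>]
  show "\<epsilon> * (\<Prod>i\<in>(UNIV :: 'd set). sinc (real N * (x $ i - p $ i))) \<le> \<epsilon>" by simp
  have "(\<Prod>i\<in>(UNIV :: 'd set). (sinc (real N * (x $ i - p $ i)))\<^sup>2)
      \<le> (\<Prod>i\<in>UNIV. 2 / (1 + (real N * (x $ i - p $ i))\<^sup>2))"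
    by (intro prod_mono conjI sinc_square_le) simp
  then show "(\<epsilon> * (\<Prod>i\<in>(UNIV :: 'd set). sinc (real N * (x $ i - p $ i))))\<^sup>2
      \<le> \<epsilon>\<^sup>2 * (\<Prod>i\<in>UNIV. 2 / (1 + (real N * (x $ i - p $ i))\<^sup>2))"
    unfolding power_mult_distrib prod_power_distrib[symmetric] by (rule mult_left_mono) simp
  have "pi / (2 * (real N)\<^sup>2 * l\<^sup>2) \<le> pi / (2 * l\<^sup>2)"
    using N l by (intro divide_left_mono) auto
  then have "(pi / (2 * (real N)\<^sup>2 * l\<^sup>2) * exp ((real N)\<^sup>2 * l\<^sup>2)) ^ CARD('d)
      \<le> (pi / (2 * l\<^sup>2) * exp ((real N)\<^sup>2 * l\<^sup>2)) ^ CARD('d)"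
    using l by (intro power_mono mult_right_mono) auto
  also have "\<dots> = (pi / (2 * l\<^sup>2)) ^ CARD('d) * exp (real CARD('d) * l\<^sup>2 * (real N)\<^sup>2)"
    unfolding power_mult_distrib exp_of_nat_mult[symmetric] by (simp add: mult_ac)
  finally have "\<epsilon>\<^sup>2 * (pi / (2 * (real N)\<^sup>2 * l\<^sup>2) * exp ((real N)\<^sup>2 * l\<^sup>2)) ^ CARD('d) \<le> \<Psi>\<^sup>2"
    using norm by (meson mult_left_mono order_trans zero_le_power2)
  then show "kernel_gap (se_kernel l) S a (\<lambda>x. \<epsilon> * (\<Prod>i\<in>UNIV. sinc (real N * (x $ i - p $ i)))) \<le> \<Psi>\<^sup>2"
    if "finite S"
    using sinc_bump_energy_le[OF l, of "real N" S a \<epsilon> p] that N by simp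
qed (use N \<Psi> in auto)

lemma matern_bump_family:
  assumes l: "0 < l" and \<nu>: "0 < \<nu>" and N: "0 < N" and \<Psi>: "0 \<le> \<Psi>" and \<epsilon>: "0 \<le> \<epsilon>"
    and norm: "\<epsilon>\<^sup>2 * (2 * Gamma \<nu> * exp (\<nu> / l\<^sup>2) / (\<nu> / (2 * l\<^sup>2)) powr \<nu> * real N powr (2 * \<nu>)) \<le> \<Psi>\<^sup>2"
  shows "\<exists>F xs. bump_family (matern_kernel \<nu> l :: 'd::finite kernel) \<Psi> N \<epsilon> F xs"
proof -
  have N1: "1 \<le> real N" using N by simp
  define good where "good p f \<longleftrightarrow> f \<in> borel_measurable borel \<and> f p = \<epsilon> \<and> (\<forall>x. f x \<le> \<epsilon>) \<and>
    (\<forall>x. (f x)\<^sup>2 \<le> \<epsilon>\<^sup>2 * exp (- ((real N)\<^sup>2 * (norm (x - p))\<^sup>2))) \<and>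
    (\<forall>S a. finite S \<longrightarrow> kernel_gap (matern_kernel \<nu> l) S a f \<le> \<Psi>\<^sup>2)"
    for p :: "real ^ 'd" and f
  have "\<exists>f. good p f" for p
  proof -
    obtain f where "f \<in> borel_measurable borel" "f p = \<epsilon>" "\<forall>x. f x \<le> \<epsilon>"
      "\<forall>x. (f x)\<^sup>2 \<le> \<epsilon>\<^sup>2 * exp (- ((real N)\<^sup>2 * (norm (x - p))\<^sup>2))"
      and energy: "\<forall>S a. finite S \<longrightarrow>
        kernel_gap (matern_kernel \<nu> l) S a f
        \<le> \<epsilon>\<^sup>2 * (2 * Gamma \<nu> * exp (\<nu> / l\<^sup>2) / (\<nu> / (2 * l\<^sup>2)) powr \<nu> * real N powr (2 * \<nu>))"
      using exists_matern_bump[OF \<nu> l N1 \<epsilon>, of p] by (elim bexE conjE)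
    moreover have "\<forall>S a. finite S \<longrightarrow>
        kernel_gap (matern_kernel \<nu> l) S a f \<le> \<Psi>\<^sup>2"
      by (intro allI impI) (rule order_trans[OF energy[rule_format] norm])
    ultimately show ?thesis unfolding good_def by (intro exI[of _ f] conjI)
  qed
  then obtain f where "\<And>p. good p (f p)" by metis
  then have f: "\<And>p. f p \<in> borel_measurable borel" "\<And>p. f p p = \<epsilon>" "\<And>p x. f p x \<le> \<epsilon>"
    and decay: "\<And>p x. (f p x)\<^sup>2 \<le> \<epsilon>\<^sup>2 * exp (- ((real N)\<^sup>2 * (norm (x - p))\<^sup>2))"
    and energy: "\<And>p S a. finite S \<Longrightarrow> kernel_gap (matern_kernel \<nu> l) S a (f p) \<le> \<Psi>\<^sup>2"
    unfolding good_def by blast+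
  show ?thesis
  proof (rule exists_bump_family[OF _ _ N \<Psi> f])
    fix p x y :: "real ^ 'd" and S :: "(real ^ 'd) set" and a
    show "matern_kernel \<nu> l x y = matern_kernel \<nu> l y x"
      by (simp add: matern_kernel_def norm_minus_commute)
    show "0 \<le> kernel_form (matern_kernel \<nu> l) S a" if S: "finite S"
    proof -
      \<comment> \<open>A bump of height 0 is the zero function, for which the energy bound says
        that minus the form is at most 0.\<close>
      obtain g :: "real ^ 'd \<Rightarrow> real" where g: "\<And>x. (g x)\<^sup>2 \<le> 0\<^sup>2 * exp (- (1\<^sup>2 * (norm (x - p))\<^sup>2))"
        and g': "\<forall>S a. finite S \<longrightarrow> kernel_gap (matern_kernel \<nu> l) S a g
        \<le> 0\<^sup>2 * (2 * Gamma \<nu> * exp (\<nu> / l\<^sup>2) / (\<nu> / (2 * l\<^sup>2)) powr \<nu> * 1 powr (2 * \<nu>))"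
        using exists_matern_bump[OF \<nu> l order_refl order_refl, of p] by blast
      have "g x = 0" for x using g[of x] by simp
      then show ?thesis using g'[rule_format, OF S, of a] by simp
    qed
    have "exp (- ((real N)\<^sup>2 * (norm (x - p))\<^sup>2)) = (\<Prod>i\<in>UNIV. exp (- (real N * (x $ i - p $ i))\<^sup>2))"
      unfolding exp_sum[OF finite, symmetric]
      by (simp add: norm_vec_def L2_set_def sum_nonneg power_mult_distrib sum_negf sum_distrib_left)
    also have "\<dots> \<le> (\<Prod>i\<in>UNIV. 2 / (1 + (real N * (x $ i - p $ i))\<^sup>2))"
    proof (intro prod_mono conjI)
      fix i
      let ?t = "real N * (x $ i - p $ i)"
      have pos: "0 < 1 + ?t\<^sup>2" by (simp add: add_pos_nonneg)
      have "1 + ?t\<^sup>2 \<le> exp (?t\<^sup>2)" by (rule exp_ge_add_one_self)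
      then have "exp (- ?t\<^sup>2) \<le> 1 / (1 + ?t\<^sup>2)"
        using pos unfolding exp_minus inverse_eq_divide by (intro divide_left_mono) auto
      also have "\<dots> \<le> 2 / (1 + ?t\<^sup>2)" using pos by (intro divide_right_mono) auto
      finally show "exp (- ?t\<^sup>2) \<le> 2 / (1 + ?t\<^sup>2)" .
    qed simp
    finally have "\<epsilon>\<^sup>2 * exp (- ((real N)\<^sup>2 * (norm (x - p))\<^sup>2))
        \<le> \<epsilon>\<^sup>2 * (\<Prod>i\<in>UNIV. 2 / (1 + (real N * (x $ i - p $ i))\<^sup>2))"
      by (rule mult_left_mono) simp
    then show "(f p x)\<^sup>2 \<le> \<epsilon>\<^sup>2 * (\<Prod>i\<in>UNIV. 2 / (1 + (real N * (x $ i - p $ i))\<^sup>2))"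
      using decay[of p x] by linarith
  qed (rule energy)
qed

section \<open>Change of measure under adaptive Gaussian observations\<close>

abbreviation normal_law :: "real \<Rightarrow> real measure" where
  "normal_law \<sigma> \<equiv> density lborel (\<lambda>x. ennreal (normal_density 0 \<sigma> x))"

text \<open>One step of the Cameron-Martin formula: translating the Lebesgue integral moves the
  shift into the normal density.\<close>

lemma nn_integral_normal_shift:
  fixes h :: "real \<Rightarrow> ennreal"
  assumes [measurable]: "h \<in> borel_measurable borel" and "0 < \<sigma>"
  shows "(\<integral>\<^sup>+v. h (\<alpha> + v) \<partial>normal_law \<sigma>)
    = (\<integral>\<^sup>+v. h v * ennreal (exp ((\<alpha> * v - \<alpha>\<^sup>2 / 2) / \<sigma>\<^sup>2))
        \<partial>normal_law \<sigma>)"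
proof -
  have shift: "normal_density 0 \<sigma> (v - \<alpha>)
      = normal_density 0 \<sigma> v * exp ((\<alpha> * v - \<alpha>\<^sup>2 / 2) / \<sigma>\<^sup>2)" for v
  proof -
    have "- (v - \<alpha>)\<^sup>2 / (2 * \<sigma>\<^sup>2) = - v\<^sup>2 / (2 * \<sigma>\<^sup>2) + (\<alpha> * v - \<alpha>\<^sup>2 / 2) / \<sigma>\<^sup>2"
      using \<open>0 < \<sigma>\<close> by (simp add: field_simps power2_eq_square)
    then show ?thesis unfolding normal_density_def by (simp add: exp_add[symmetric])
  qed
  have "(\<integral>\<^sup>+v. h (\<alpha> + v) \<partial>normal_law \<sigma>)
      = (\<integral>\<^sup>+v. ennreal (normal_density 0 \<sigma> v) * h (\<alpha> + v) \<partial>lborel)"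
    by (subst nn_integral_density) auto
  also have "\<dots> = (\<integral>\<^sup>+v. ennreal (normal_density 0 \<sigma> (v - \<alpha>)) * h v \<partial>lborel)"
    by (subst nn_integral_real_affine[of "\<lambda>v. ennreal (normal_density 0 \<sigma> (v - \<alpha>)) * h v" 1 \<alpha>]) auto
  also have "\<dots> = (\<integral>\<^sup>+v. ennreal (normal_density 0 \<sigma> v)
      * (h v * ennreal (exp ((\<alpha> * v - \<alpha>\<^sup>2 / 2) / \<sigma>\<^sup>2))) \<partial>lborel)"
    unfolding shift by (intro nn_integral_cong) (simp add: ennreal_mult' mult_ac)
  also have "\<dots> = (\<integral>\<^sup>+v. h v * ennreal (exp ((\<alpha> * v - \<alpha>\<^sup>2 / 2) / \<sigma>\<^sup>2))
        \<partial>normal_law \<sigma>)"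
    by (subst nn_integral_density) auto
  finally show ?thesis .
qed

text \<open>The cross term vanishes because the noise has mean 0; \<alpha>^2 E v^2 / \<sigma>^4
  leaves \<alpha>^2 / \<sigma>^2. This is one step of the second moment of the drift.\<close>

lemma nn_integral_normal_affine_square:
  fixes w \<alpha> :: real
  assumes "0 < \<sigma>"
  shows "(\<integral>\<^sup>+v. ennreal ((w + \<alpha> * v / \<sigma>\<^sup>2)\<^sup>2) \<partial>normal_law \<sigma>)
    = ennreal (w\<^sup>2) + ennreal (\<alpha>\<^sup>2 / \<sigma>\<^sup>2)"
proof -
  have 0: "has_bochner_integral lborel (normal_density 0 \<sigma>) 1"
    using assms by (simp add: has_bochner_integral_iff)
  have 1: "has_bochner_integral lborel (\<lambda>x. normal_density 0 \<sigma> x * x) 0"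
    using normal_moment_nz_1[OF assms, of 0] by simp
  have 2: "has_bochner_integral lborel (\<lambda>x. normal_density 0 \<sigma> x * x\<^sup>2) (\<sigma>\<^sup>2)"
    using normal_moment_even[OF assms, of 0 1] assms by (simp add: fact_numeral power2_eq_square)
  have "has_bochner_integral lborel (\<lambda>x. w\<^sup>2 * normal_density 0 \<sigma> x
      + (2 * w * \<alpha> / \<sigma>\<^sup>2) * (normal_density 0 \<sigma> x * x)
      + (\<alpha>\<^sup>2 / \<sigma>\<^sup>2 / \<sigma>\<^sup>2) * (normal_density 0 \<sigma> x * x\<^sup>2))
      (w\<^sup>2 * 1 + (2 * w * \<alpha> / \<sigma>\<^sup>2) * 0 + (\<alpha>\<^sup>2 / \<sigma>\<^sup>2 / \<sigma>\<^sup>2) * \<sigma>\<^sup>2)"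
    by (intro has_bochner_integral_add has_bochner_integral_mult_right 0 1 2)
  moreover have "(\<lambda>x. w\<^sup>2 * normal_density 0 \<sigma> x
      + (2 * w * \<alpha> / \<sigma>\<^sup>2) * (normal_density 0 \<sigma> x * x)
      + (\<alpha>\<^sup>2 / \<sigma>\<^sup>2 / \<sigma>\<^sup>2) * (normal_density 0 \<sigma> x * x\<^sup>2))
      = (\<lambda>x. normal_density 0 \<sigma> x * (w + \<alpha> * x / \<sigma>\<^sup>2)\<^sup>2)"
  proof
    fix x
    have "(w + \<alpha> * x / \<sigma>\<^sup>2)\<^sup>2 = w\<^sup>2 + 2 * w * \<alpha> / \<sigma>\<^sup>2 * x + \<alpha>\<^sup>2 / \<sigma>\<^sup>2 / \<sigma>\<^sup>2 * x\<^sup>2"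
      unfolding power2_sum by (simp add: power2_eq_square mult_ac add_ac)
    then show "w\<^sup>2 * normal_density 0 \<sigma> x
      + (2 * w * \<alpha> / \<sigma>\<^sup>2) * (normal_density 0 \<sigma> x * x)
      + (\<alpha>\<^sup>2 / \<sigma>\<^sup>2 / \<sigma>\<^sup>2) * (normal_density 0 \<sigma> x * x\<^sup>2)
      = normal_density 0 \<sigma> x * (w + \<alpha> * x / \<sigma>\<^sup>2)\<^sup>2"
      by (simp only: ring_distribs mult_ac)
  qed
  moreover have "w\<^sup>2 * 1 + (2 * w * \<alpha> / \<sigma>\<^sup>2) * 0 + (\<alpha>\<^sup>2 / \<sigma>\<^sup>2 / \<sigma>\<^sup>2) * \<sigma>\<^sup>2 = w\<^sup>2 + \<alpha>\<^sup>2 / \<sigma>\<^sup>2"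
    using assms by (simp add: field_simps power2_eq_square)
  ultimately have B: "has_bochner_integral lborel
      (\<lambda>x. normal_density 0 \<sigma> x * (w + \<alpha> * x / \<sigma>\<^sup>2)\<^sup>2) (w\<^sup>2 + \<alpha>\<^sup>2 / \<sigma>\<^sup>2)"
    by (simp only:)
  have "(\<integral>\<^sup>+v. ennreal ((w + \<alpha> * v / \<sigma>\<^sup>2)\<^sup>2) \<partial>normal_law \<sigma>)
    = (\<integral>\<^sup>+v. ennreal (normal_density 0 \<sigma> v) * ennreal ((w + \<alpha> * v / \<sigma>\<^sup>2)\<^sup>2) \<partial>lborel)"
    by (subst nn_integral_density) auto
  also have "\<dots> = (\<integral>\<^sup>+v. ennreal (normal_density 0 \<sigma> v * (w + \<alpha> * v / \<sigma>\<^sup>2)\<^sup>2) \<partial>lborel)"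
    by (intro nn_integral_cong) (simp add: ennreal_mult')
  also have "\<dots> = ennreal (w\<^sup>2 + \<alpha>\<^sup>2 / \<sigma>\<^sup>2)"
    using B by (subst nn_integral_eq_integral)
      (auto simp: has_bochner_integral_iff)
  also have "\<dots> = ennreal (w\<^sup>2) + ennreal (\<alpha>\<^sup>2 / \<sigma>\<^sup>2)"
    by (rule ennreal_plus) auto
  finally show ?thesis .
qed

text \<open>Observations whose mean at each time is a function of the past. They are total
  sequences, 0 outside the times already reached, so that all time steps share one measurable space;
  with mean 0 the path is the noise itself.\<close>

primrec shifted_path ::
    "(nat \<Rightarrow> (nat \<Rightarrow> real) \<Rightarrow> real) \<Rightarrow> (nat \<Rightarrow> real) \<Rightarrow> nat \<Rightarrow> nat \<Rightarrow> real" where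
  "shifted_path a z 0 = (\<lambda>_. 0)"
| "shifted_path a z (Suc t) =
    (shifted_path a z t)(Suc t := a (Suc t) (shifted_path a z t) + z (Suc t))"

abbreviation zero_path :: "(nat \<Rightarrow> real) \<Rightarrow> nat \<Rightarrow> nat \<Rightarrow> real" where
  "zero_path \<equiv> shifted_path (\<lambda>_ _. 0)"

lemma zero_path_eq: "zero_path z m = (\<lambda>s. if 1 \<le> s \<and> s \<le> m then z s else 0)"
  by (induction m) (auto simp: fun_eq_iff le_Suc_eq)

lemma shifted_path_cong:
  "(\<And>s. 1 \<le> s \<Longrightarrow> s \<le> m \<Longrightarrow> z s = z' s) \<Longrightarrow> shifted_path a z m = shifted_path a z' m"
  by (induction m) auto

abbreviation (input) seqs :: "(nat \<Rightarrow> real) measure" where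
  "seqs \<equiv> (\<Pi>\<^sub>M i\<in>UNIV. borel)"

locale adaptive_shift =
  fixes a :: "nat \<Rightarrow> (nat \<Rightarrow> real) \<Rightarrow> real" and \<sigma> :: real
  assumes a_measurable [measurable]: "\<And>t. a t \<in> borel_measurable seqs"
    and nonanticipating: "\<And>t y y'. (\<And>s. s < t \<Longrightarrow> y s = y' s) \<Longrightarrow> a t y = a t y'"
    and \<sigma>: "0 < \<sigma>"
begin

abbreviation noise :: "real measure" where
  "noise \<equiv> normal_law \<sigma>"

abbreviation noises :: "nat \<Rightarrow> (nat \<Rightarrow> real) measure" where
  "noises m \<equiv> (\<Pi>\<^sub>M t\<in>{1..m}. noise)"

text \<open>The log likelihood ratio against pure noise is \<open>drift - energy / 2\<close>, as in
  Girsanov's theorem: a discrete stochastic integral and its predictable quadratic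
  variation.\<close>

definition drift :: "nat \<Rightarrow> (nat \<Rightarrow> real) \<Rightarrow> real" where
  "drift m y = (\<Sum>t=1..m. a t y * y t / \<sigma>\<^sup>2)"

definition energy :: "nat \<Rightarrow> (nat \<Rightarrow> real) \<Rightarrow> real" where
  "energy m y = (\<Sum>t=1..m. (a t y)\<^sup>2 / \<sigma>\<^sup>2)"

sublocale noise: prob_space noise
  by (rule prob_space_normal_density[OF \<sigma>])

sublocale product_sigma_finite "\<lambda>_::nat. noise"
  by unfold_locales

lemma energy_nonneg: "0 \<le> energy m y"
  by (simp add: energy_def sum_nonneg)

lemma seqs_upd_measurable [measurable]:
  assumes "f \<in> M \<rightarrow>\<^sub>M seqs" "g \<in> borel_measurable M"
  shows "(\<lambda>x. (f x)(i := g x)) \<in> M \<rightarrow>\<^sub>M seqs"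
  by (rule measurable_fun_upd[where J=UNIV]) (use assms in auto)

lemma drift_measurable [measurable]: "drift m \<in> borel_measurable seqs"
  unfolding drift_def by measurable

lemma energy_measurable [measurable]: "energy m \<in> borel_measurable seqs"
  unfolding energy_def by measurable

lemma path_measurable:
  assumes "\<And>t. b t \<in> borel_measurable seqs" and "m \<le> n"
  shows "(\<lambda>z. shifted_path b z m) \<in> noises n \<rightarrow>\<^sub>M seqs"
  using assms(2)
proof (induction m)
  case 0
  show ?case by (simp add: measurable_PiM_single')
next
  case (Suc m)
  note [measurable] = Suc.IH[OF Suc_leD[OF Suc.prems]] assms(1)
  have [measurable]: "(\<lambda>z. z (Suc m)) \<in> borel_measurable (noises n)"
    using Suc.prems measurable_component_singleton[of "Suc m" "{1..n}" "\<lambda>_. noise"] by simp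
  show ?case unfolding shifted_path.simps by measurable
qed

lemma zero_path_measurable [measurable]: "(\<lambda>z. zero_path z m) \<in> noises m \<rightarrow>\<^sub>M seqs"
  by (rule path_measurable) auto

lemma a_path_measurable [measurable]: "(\<lambda>z. shifted_path a z m) \<in> noises m \<rightarrow>\<^sub>M seqs"
  by (rule path_measurable[OF a_measurable order_refl])

lemma nn_integral_noises_Suc:
  assumes "f \<in> borel_measurable (noises (Suc m))"
  shows "(\<integral>\<^sup>+z. f z \<partial>noises (Suc m)) = (\<integral>\<^sup>+z. (\<integral>\<^sup>+v. f (z(Suc m := v)) \<partial>noise) \<partial>noises m)"
proof -
  have "{1..Suc m} = insert (Suc m) {1..m}" by auto
  then show ?thesis using assms by (simp only:) (subst product_nn_integral_insert, auto)
qed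

lemma zero_path_upd: "zero_path (z(Suc m := v)) (Suc m) = (zero_path z m)(Suc m := v)"
  by (auto simp: zero_path_eq fun_eq_iff)

lemma a_upd: "t \<le> Suc m \<Longrightarrow> a t (y(Suc m := v)) = a t y"
  by (intro nonanticipating) auto

lemma drift_upd: "drift (Suc m) (y(Suc m := v)) = drift m y + a (Suc m) y * v / \<sigma>\<^sup>2"
  by (simp add: drift_def a_upd)

lemma energy_upd: "energy (Suc m) (y(Suc m := v)) = energy m y + (a (Suc m) y)\<^sup>2 / \<sigma>\<^sup>2"
  by (simp add: energy_def a_upd)

text \<open>Induction with G arbitrary: integrating out the last observation, given the past,
  replaces G by H, to which the hypothesis for the first m observations applies; the one-step
  density ratios multiply up.\<close>

lemma change_of_measure:
  assumes "G \<in> borel_measurable seqs"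
  shows "(\<integral>\<^sup>+z. G (shifted_path a z m) \<partial>noises m)
    = (\<integral>\<^sup>+z. G (zero_path z m)
        * ennreal (exp (drift m (zero_path z m) - energy m (zero_path z m) / 2)) \<partial>noises m)"
  using assms
proof (induction m arbitrary: G)
  case 0
  show ?case by (simp add: drift_def energy_def)
next
  case (Suc m)
  note G[measurable] = Suc.prems
  define l where "l y v = exp ((a (Suc m) y * v - (a (Suc m) y)\<^sup>2 / 2) / \<sigma>\<^sup>2)" for y v
  have [measurable]: "(\<lambda>p. l (fst p) (snd p)) \<in> borel_measurable (seqs \<Otimes>\<^sub>M borel)"
    unfolding l_def by measurable
  have [measurable]: "(\<lambda>(y, v). G (y(Suc m := v)) * ennreal (l y v))
      \<in> borel_measurable (seqs \<Otimes>\<^sub>M borel)"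
    unfolding split_beta by measurable
  have G_upd[measurable]: "(\<lambda>v. G (y(Suc m := v))) \<in> borel_measurable borel" for y
    by (rule measurable_compose[OF seqs_upd_measurable G]) (auto simp: space_PiM)
  have l_right[measurable]: "(\<lambda>v. l y v) \<in> borel_measurable borel" for y
    unfolding l_def by measurable
  define H where "H y = (\<integral>\<^sup>+v. G (y(Suc m := v)) * ennreal (l y v) \<partial>noise)" for y
  have H[measurable]: "H \<in> borel_measurable seqs"
    unfolding H_def by measurable
  have "(\<integral>\<^sup>+z. G (shifted_path a z (Suc m)) \<partial>noises (Suc m))
      = (\<integral>\<^sup>+z. (\<integral>\<^sup>+v. G (shifted_path a (z(Suc m := v)) (Suc m)) \<partial>noise) \<partial>noises m)"
    by (rule nn_integral_noises_Suc) measurable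
  also have "\<dots> = (\<integral>\<^sup>+z. H (shifted_path a z m) \<partial>noises m)"
  proof (rule nn_integral_cong)
    fix z
    have "shifted_path a (z(Suc m := v)) m = shifted_path a z m" for v
      by (rule shifted_path_cong) auto
    then have "(\<integral>\<^sup>+v. G (shifted_path a (z(Suc m := v)) (Suc m)) \<partial>noise)
      = (\<integral>\<^sup>+v. G ((shifted_path a z m)(Suc m := a (Suc m) (shifted_path a z m) + v)) \<partial>noise)"
      by simp
    also have "\<dots> = H (shifted_path a z m)"
      unfolding H_def l_def
      by (rule nn_integral_normal_shift[OF G_upd \<sigma>])
    finally show "(\<integral>\<^sup>+v. G (shifted_path a (z(Suc m := v)) (Suc m)) \<partial>noise) = H (shifted_path a z m)" .
  qed
  also have "\<dots> = (\<integral>\<^sup>+z. H (zero_path z m)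
        * ennreal (exp (drift m (zero_path z m) - energy m (zero_path z m) / 2)) \<partial>noises m)"
    by (rule Suc.IH[OF H])
  also have "\<dots> = (\<integral>\<^sup>+z. (\<integral>\<^sup>+v. G (zero_path (z(Suc m := v)) (Suc m))
        * ennreal (exp (drift (Suc m) (zero_path (z(Suc m := v)) (Suc m))
            - energy (Suc m) (zero_path (z(Suc m := v)) (Suc m)) / 2)) \<partial>noise) \<partial>noises m)"
  proof (rule nn_integral_cong)
    fix z
    let ?y = "zero_path z m"
    have exp_eq: "exp (drift (Suc m) (?y(Suc m := v)) - energy (Suc m) (?y(Suc m := v)) / 2)
        = l ?y v * exp (drift m ?y - energy m ?y / 2)" for v
      unfolding drift_upd energy_upd l_def exp_add[symmetric]
      by (simp add: diff_divide_distrib add_divide_distrib)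
    have "H ?y * ennreal (exp (drift m ?y - energy m ?y / 2))
      = (\<integral>\<^sup>+v. G (?y(Suc m := v)) * ennreal (l ?y v)
          * ennreal (exp (drift m ?y - energy m ?y / 2)) \<partial>noise)"
      unfolding H_def by (rule nn_integral_multc[symmetric]) (simp add: G_upd l_right)
    also have "\<dots> = (\<integral>\<^sup>+v. G (zero_path (z(Suc m := v)) (Suc m))
        * ennreal (exp (drift (Suc m) (zero_path (z(Suc m := v)) (Suc m))
            - energy (Suc m) (zero_path (z(Suc m := v)) (Suc m)) / 2)) \<partial>noise)"
      unfolding zero_path_upd exp_eq
      by (intro nn_integral_cong) (simp add: ennreal_mult' mult.assoc l_def)
    finally show "H ?y * ennreal (exp (drift m ?y - energy m ?y / 2))
      = (\<integral>\<^sup>+v. G (zero_path (z(Suc m := v)) (Suc m))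
        * ennreal (exp (drift (Suc m) (zero_path (z(Suc m := v)) (Suc m))
            - energy (Suc m) (zero_path (z(Suc m := v)) (Suc m)) / 2)) \<partial>noise)" .
  qed
  also have "\<dots> = (\<integral>\<^sup>+z. G (zero_path z (Suc m))
        * ennreal (exp (drift (Suc m) (zero_path z (Suc m)) - energy (Suc m) (zero_path z (Suc m)) / 2))
        \<partial>noises (Suc m))"
    by (rule nn_integral_noises_Suc[symmetric]) measurable
  finally show ?case .
qed

text \<open>Martingale isometry: each increment has conditional mean 0, so squares add up without
  cross terms.\<close>

lemma nn_integral_drift_square:
  "(\<integral>\<^sup>+z. ennreal ((drift m (zero_path z m))\<^sup>2) \<partial>noises m)
    = (\<integral>\<^sup>+z. ennreal (energy m (zero_path z m)) \<partial>noises m)"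
proof (induction m)
  case 0
  show ?case by (simp add: drift_def energy_def)
next
  case (Suc m)
  have "(\<integral>\<^sup>+z. ennreal ((drift (Suc m) (zero_path z (Suc m)))\<^sup>2) \<partial>noises (Suc m))
    = (\<integral>\<^sup>+z. (\<integral>\<^sup>+v. ennreal ((drift (Suc m) (zero_path (z(Suc m := v)) (Suc m)))\<^sup>2) \<partial>noise) \<partial>noises m)"
    by (rule nn_integral_noises_Suc) measurable
  also have "\<dots> = (\<integral>\<^sup>+z. ennreal ((drift m (zero_path z m))\<^sup>2)
      + ennreal ((a (Suc m) (zero_path z m))\<^sup>2 / \<sigma>\<^sup>2) \<partial>noises m)"
    unfolding zero_path_upd drift_upd
    by (intro nn_integral_cong nn_integral_normal_affine_square \<sigma>)
  also have "\<dots> = (\<integral>\<^sup>+z. ennreal (energy m (zero_path z m)) \<partial>noises m)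
      + (\<integral>\<^sup>+z. ennreal ((a (Suc m) (zero_path z m))\<^sup>2 / \<sigma>\<^sup>2) \<partial>noises m)"
    unfolding Suc.IH[symmetric] by (rule nn_integral_add) measurable
  also have "\<dots> = (\<integral>\<^sup>+z. ennreal (energy m (zero_path z m))
      + ennreal ((a (Suc m) (zero_path z m))\<^sup>2 / \<sigma>\<^sup>2) \<partial>noises m)"
    by (rule nn_integral_add[symmetric]) measurable
  also have "\<dots> = (\<integral>\<^sup>+z. (\<integral>\<^sup>+v. ennreal (energy (Suc m) (zero_path (z(Suc m := v)) (Suc m))) \<partial>noise)
      \<partial>noises m)"
    unfolding zero_path_upd energy_upd
    using noise.emeasure_space_1 by (intro nn_integral_cong) (simp add: energy_nonneg)
  also have "\<dots> = (\<integral>\<^sup>+z. ennreal (energy (Suc m) (zero_path z (Suc m))) \<partial>noises (Suc m))"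
    by (rule nn_integral_noises_Suc[symmetric]) measurable
  finally show ?case .
qed

text \<open>Linearised change of measure: the likelihood ratio \<open>exp (W - S/2)\<close> is at least
  \<open>1 + W - S/2 \<ge> 3/4 - W\<^sup>2 - S/2\<close>, and the drift \<open>W\<close> is a martingale with second moment
  \<open>E S\<close>.\<close>

lemma shifted_event_lower_bound:
  assumes [measurable]: "Measurable.pred seqs D"
  shows "ennreal (3/4) * (\<integral>\<^sup>+z. indicator {y. D y} (zero_path z m) \<partial>noises m)
    \<le> (\<integral>\<^sup>+z. indicator {y. D y} (shifted_path a z m) \<partial>noises m)
      + ennreal (3/2) * (\<integral>\<^sup>+z. ennreal (energy m (zero_path z m)) \<partial>noises m)"
proof -
  let ?I = "\<lambda>y. indicator {y. D y} y :: ennreal"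
  let ?L = "\<lambda>y. ennreal (exp (drift m y - energy m y / 2))"
  have I[measurable]: "?I \<in> borel_measurable seqs"
    by (intro borel_measurable_indicator) (use assms in \<open>simp add: pred_def space_PiM\<close>)
  have pointwise: "ennreal (3/4) * ?I y
      \<le> ?I y * ?L y + (ennreal ((drift m y)\<^sup>2) + ennreal (1/2) * ennreal (energy m y))" for y
  proof (cases "D y")
    case True
    \<comment> \<open>Written as W + W^2 >= -1/4, this is the source of 3/4 = 1 - 1/4.\<close>
    have "(drift m y + 1/2)\<^sup>2 \<ge> 0" by simp
    then have "3/4 \<le> 1 + (drift m y - energy m y / 2) + ((drift m y)\<^sup>2 + 1/2 * energy m y)"
      by (simp add: power2_sum power2_eq_square algebra_simps)
    also have "\<dots> \<le> exp (drift m y - energy m y / 2) + ((drift m y)\<^sup>2 + 1/2 * energy m y)"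
      using exp_ge_add_one_self[of "drift m y - energy m y / 2"] by linarith
    finally have "ennreal (3/4)
        \<le> ennreal (exp (drift m y - energy m y / 2) + ((drift m y)\<^sup>2 + 1/2 * energy m y))"
      by (rule ennreal_leI)
    also have "\<dots> = ?L y + (ennreal ((drift m y)\<^sup>2) + ennreal (1/2) * ennreal (energy m y))"
      using energy_nonneg[of m y]
      by (subst ennreal_mult[symmetric]) (auto simp: ennreal_plus[symmetric] simp del: ennreal_plus)
    finally show ?thesis using True by simp
  qed simp
  have "ennreal (3/4) * (\<integral>\<^sup>+z. ?I (zero_path z m) \<partial>noises m)
      = (\<integral>\<^sup>+z. ennreal (3/4) * ?I (zero_path z m) \<partial>noises m)"
    by (rule nn_integral_cmult[symmetric]) measurable
  also have "\<dots> \<le> (\<integral>\<^sup>+z. ?I (zero_path z m) * ?L (zero_path z m)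
      + (ennreal ((drift m (zero_path z m))\<^sup>2) + ennreal (1/2) * ennreal (energy m (zero_path z m)))
      \<partial>noises m)"
    by (intro nn_integral_mono pointwise)
  also have "\<dots> = (\<integral>\<^sup>+z. ?I (zero_path z m) * ?L (zero_path z m) \<partial>noises m)
      + ((\<integral>\<^sup>+z. ennreal ((drift m (zero_path z m))\<^sup>2) \<partial>noises m)
        + ennreal (1/2) * (\<integral>\<^sup>+z. ennreal (energy m (zero_path z m)) \<partial>noises m))"
    by (subst nn_integral_add, measurable, subst nn_integral_add, measurable,
        subst nn_integral_cmult, measurable)
  also have "(\<integral>\<^sup>+z. ?I (zero_path z m) * ?L (zero_path z m) \<partial>noises m)
      = (\<integral>\<^sup>+z. ?I (shifted_path a z m) \<partial>noises m)"
    by (rule change_of_measure[symmetric, OF I])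
  also have "(\<integral>\<^sup>+z. ennreal ((drift m (zero_path z m))\<^sup>2) \<partial>noises m)
        + ennreal (1/2) * (\<integral>\<^sup>+z. ennreal (energy m (zero_path z m)) \<partial>noises m)
      = ennreal (3/2) * (\<integral>\<^sup>+z. ennreal (energy m (zero_path z m)) \<partial>noises m)"
  proof -
    have "ennreal (3/2) = 1 + ennreal (1/2)"
      by (simp add: ennreal_1[symmetric] ennreal_plus[symmetric] del: ennreal_1 ennreal_plus ennreal_half)
    then show ?thesis unfolding nn_integral_drift_square by (simp only: distrib_right mult_1_left)
  qed
  finally show ?thesis .
qed

end

section \<open>Batched algorithms\<close>

lemma observations_eq_shifted_path:
  "observations A B f u z t = shifted_path (\<lambda>t y. f (query A B u y t)) z t"
  by (induction t) (auto simp: Let_def)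

lemma zero_path_eq_observations: "zero_path z t = observations A B (\<lambda>_. 0) u z t"
  by (simp add: observations_eq_shifted_path)

lemma observations_earlier: "s \<le> t \<Longrightarrow> t \<le> t' \<Longrightarrow> observations A B f u z t' s = observations A B f u z t s"
  by (induction t') (auto simp: Let_def le_Suc_eq)

locale batched_run =
  fixes X :: "'a::topological_space set" and T B :: nat and A :: "'a batched_alg"
  assumes alg: "batched_algorithm X T B A"
begin

lemma seed_prob: "prob_space (seed_law A)"
  using alg by (simp add: batched_algorithm_def)

lemma batch_end_less:
  "u \<in> space (seed_law A) \<Longrightarrow> i < B \<Longrightarrow> batch_end A u y i < batch_end A u y (Suc i)"
  using alg by (simp add: batched_algorithm_def)

lemma batch_end_last: "u \<in> space (seed_law A) \<Longrightarrow> batch_end A u y B = T"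
  using alg by (simp add: batched_algorithm_def)

lemma batch_end_strict_mono:
  assumes u: "u \<in> space (seed_law A)"
  shows "i < j \<Longrightarrow> j \<le> B \<Longrightarrow> batch_end A u y i < batch_end A u y j"
proof (induction j)
  case (Suc j)
  then show ?case
    using batch_end_less[OF u, of j y] by (cases "i = j") (auto intro: less_trans)
qed simp

lemma batch_end_mono:
  "u \<in> space (seed_law A) \<Longrightarrow> i \<le> j \<Longrightarrow> j \<le> B \<Longrightarrow> batch_end A u y i \<le> batch_end A u y j"
  using batch_end_strict_mono[of u i j y] by (cases "i = j") auto

lemma batch_end_le: "u \<in> space (seed_law A) \<Longrightarrow> i \<le> B \<Longrightarrow> batch_end A u y i \<le> T"
  using batch_end_mono[of u i B y] by (simp add: batch_end_last)

text \<open>The end of batch i is fixed at the end of batch i - 1. If the latter is at most n, the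
  former is a function of the first n observations.\<close>

lemma batch_end_local:
  assumes u: "u \<in> space (seed_law A)" and eq: "\<And>s. 1 \<le> s \<Longrightarrow> s \<le> n \<Longrightarrow> y s = y' s"
  shows "i \<le> B \<Longrightarrow> i = 0 \<or> batch_end A u y (i - 1) \<le> n \<Longrightarrow> batch_end A u y' i = batch_end A u y i"
proof (induction i)
  case (Suc i)
  show ?case
  proof (cases i)
    case (Suc k)
    have i: "batch_end A u y i \<le> n" using Suc.prems by simp
    have "batch_end A u y (i - 1) \<le> n"
      using batch_end_mono[OF u, of "i - 1" i y] Suc.prems i by simp
    then have IH: "batch_end A u y' i = batch_end A u y i" using Suc.IH Suc.prems by simp
    have "restrict y' {1..batch_end A u y i} = restrict y {1..batch_end A u y i}"
      using i eq by (intro restrict_ext) auto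
    then show ?thesis using IH Suc by (simp add: Let_def)
  qed simp
qed simp

lemma finite_batch_ends: "finite {batch_end A u y i |i. i \<le> B \<and> batch_end A u y i < t}"
  by (rule finite_subset[of _ "{..<t}"]) auto

lemma revealed_less: "1 \<le> t \<Longrightarrow> revealed A B u y t < t"
proof -
  assume "1 \<le> t"
  let ?S = "{batch_end A u y i |i. i \<le> B \<and> batch_end A u y i < t}"
  have "0 \<in> ?S" using \<open>1 \<le> t\<close> by (auto intro!: exI[of _ 0])
  then have "Max ?S \<in> ?S" using finite_batch_ends by (intro Max_in) auto
  then show ?thesis unfolding revealed_def by auto
qed

lemma revealed_le:
  assumes u: "u \<in> space (seed_law A)" and "1 \<le> t" "t \<le> batch_end A u y (Suc j)" "Suc j \<le> B"
  shows "revealed A B u y t \<le> batch_end A u y j"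
proof -
  let ?S = "{batch_end A u y i |i. i \<le> B \<and> batch_end A u y i < t}"
  have "0 \<in> ?S" using \<open>1 \<le> t\<close> by (auto intro!: exI[of _ 0])
  moreover have "x \<le> batch_end A u y j" if "x \<in> ?S" for x
  proof -
    obtain i where i: "x = batch_end A u y i" "i \<le> B" "batch_end A u y i < t"
      using \<open>x \<in> ?S\<close> by auto
    have "i \<le> j"
    proof (rule ccontr)
      assume "\<not> i \<le> j"
      then show False using batch_end_mono[OF u, of "Suc j" i y] i assms by simp
    qed
    then show ?thesis using batch_end_mono[OF u, of i j y] i assms by simp
  qed
  ultimately show ?thesis
    unfolding revealed_def using finite_batch_ends by (subst Max_le_iff) auto
qed

text \<open>The one consequence of batching that drives the bound: once batch j has ended, every
  query up to the end of batch j + 1 is settled, because nothing later is revealed before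
  it.\<close>

lemma query_local_batch:
  assumes u: "u \<in> space (seed_law A)" and eq: "\<And>s. 1 \<le> s \<Longrightarrow> s \<le> n \<Longrightarrow> y s = y' s"
    and j: "Suc j \<le> B" "batch_end A u y j \<le> n"
    and t: "1 \<le> t" "t \<le> batch_end A u y (Suc j)"
  shows "query A B u y' t = query A B u y t"
proof -
  have same: "batch_end A u y' i = batch_end A u y i" if "i \<le> Suc j" for i
  proof (rule batch_end_local[OF u eq])
    show "i \<le> B" using that j by simp
    have "batch_end A u y (i - 1) \<le> batch_end A u y j"
      using that j by (intro batch_end_mono[OF u]) auto
    then show "i = 0 \<or> batch_end A u y (i - 1) \<le> n" using j by simp
  qed
  have "i \<le> B \<and> batch_end A u y' i < t \<longleftrightarrow> i \<le> B \<and> batch_end A u y i < t" for i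
  proof (cases "i \<le> Suc j")
    case False
    then show ?thesis
      using batch_end_mono[OF u, of "Suc j" i y] batch_end_mono[OF u, of "Suc j" i y'] t same[of "Suc j"]
      by auto
  qed (simp add: same)
  moreover have "batch_end A u y' i = batch_end A u y i" if "i \<le> B" "batch_end A u y i < t" for i
  proof (rule same, rule ccontr)
    assume "\<not> i \<le> Suc j"
    then show False using that batch_end_mono[OF u, of "Suc j" i y] t by simp
  qed
  ultimately have "{batch_end A u y' i |i. i \<le> B \<and> batch_end A u y' i < t}
      = {batch_end A u y i |i. i \<le> B \<and> batch_end A u y i < t}"
    by metis
  then have rev: "revealed A B u y' t = revealed A B u y t" by (simp add: revealed_def)
  have "revealed A B u y t \<le> n" using revealed_le[OF u t j(1)] j(2) by simp
  then have "restrict y' {1..revealed A B u y t} = restrict y {1..revealed A B u y t}"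
    using eq by (intro restrict_ext) auto
  then show ?thesis by (simp add: query_def rev)
qed

lemma batch_containing:
  assumes u: "u \<in> space (seed_law A)" and t: "1 \<le> t" "t \<le> T"
  obtains j where "Suc j \<le> B" "batch_end A u y j < t" "t \<le> batch_end A u y (Suc j)"
proof -
  define i where "i = (LEAST i. t \<le> batch_end A u y i)"
  have ex: "t \<le> batch_end A u y B" using t batch_end_last[OF u] by simp
  then have i: "t \<le> batch_end A u y i" unfolding i_def by (rule LeastI)
  have "i \<le> B" unfolding i_def using ex by (rule Least_le)
  have "i \<noteq> 0"
  proof
    assume "i = 0"
    then show False using i t by simp
  qed
  then obtain j where j: "i = Suc j" by (cases i) auto
  have "batch_end A u y j < t"
    using not_less_Least[of j "\<lambda>i. t \<le> batch_end A u y i"] j unfolding i_def by simp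
  then show ?thesis using that i \<open>i \<le> B\<close> j by blast
qed

text \<open>Ordinary adaptedness, the case n = t - 1 of the batch version; it makes the queries
  nonanticipating in the change of measure.\<close>

lemma query_local:
  assumes u: "u \<in> space (seed_law A)" and t: "1 \<le> t" "t \<le> T"
    and eq: "\<And>s. s < t \<Longrightarrow> y s = y' s"
  shows "query A B u y' t = query A B u y t"
proof -
  obtain j where "Suc j \<le> B" "batch_end A u y j < t" "t \<le> batch_end A u y (Suc j)"
    by (rule batch_containing[OF u t])
  then show ?thesis using t eq by (intro query_local_batch[OF u, of "t - 1"]) auto
qed

lemma query_in:
  assumes u: "u \<in> space (seed_law A)" and t: "1 \<le> t" "t \<le> T"
  shows "query A B u y t \<in> X"
proof -
  have "(u, restrict y {1..n}) \<in> space (seed_law A \<Otimes>\<^sub>M (\<Pi>\<^sub>M j\<in>{1..n}. (borel :: real measure)))" for n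
    using u by (auto simp: space_pair_measure space_PiM)
  then show ?thesis
    using alg revealed_less[OF t(1)] t
    unfolding query_def Let_def batched_algorithm_def by auto
qed

text \<open>By adaptedness the observations of the whole horizon may replace those available at time
  t, so that all events become functions of the seed and one observation sequence.\<close>

lemma played_eq_query:
  assumes u: "u \<in> space (seed_law A)" and t: "1 \<le> t" "t \<le> T"
  shows "played A B f u z t = query A B u (observations A B f u z T) t"
  unfolding played_def
  by (rule query_local[OF u t]) (use t in \<open>auto intro!: observations_earlier\<close>)

lemma batch_end_measurable:
  assumes U[measurable]: "U \<in> M \<rightarrow>\<^sub>M seed_law A"
    and Y: "\<And>s. s \<in> {1..T} \<Longrightarrow> (\<lambda>\<omega>. Y \<omega> s) \<in> borel_measurable M"
  shows "i \<le> B \<Longrightarrow> (\<lambda>\<omega>. batch_end A (U \<omega>) (Y \<omega>) i) \<in> M \<rightarrow>\<^sub>M count_space UNIV"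
proof (induction i)
  case (Suc i)
  show ?case
  proof (cases i)
    case (Suc k)
    have i: "Suc (Suc k) \<in> {2..B}" using Suc.prems Suc by simp
    \<comment> \<open>Measurability of \<open>next_end\<close> is given for n < T only, hence the
      guard. For i < B the end of batch i is below T, so the default 0 is never taken.\<close>
    define g where "g n \<omega> = (if n < T
      then next_end A (Suc (Suc k)) n (U \<omega>, restrict (Y \<omega>) {1..n}) else 0)" for n \<omega>
    have g: "g n \<in> M \<rightarrow>\<^sub>M count_space UNIV" for n
    proof (cases "n < T")
      case True
      have "(\<lambda>\<omega>. restrict (Y \<omega>) {1..n}) \<in> M \<rightarrow>\<^sub>M (\<Pi>\<^sub>M j\<in>{1..n}. borel)"
        using True by (intro measurable_restrict Y) auto
      moreover have "next_end A (Suc (Suc k)) n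
          \<in> seed_law A \<Otimes>\<^sub>M (\<Pi>\<^sub>M j\<in>{1..n}. borel) \<rightarrow>\<^sub>M count_space UNIV"
        using alg i True unfolding batched_algorithm_def by blast
      ultimately show ?thesis
        unfolding g_def using True by (auto intro!: measurable_compose[OF measurable_Pair[OF U]])
    next
      case False
      then have "g n = (\<lambda>_. 0)" by (simp add: g_def fun_eq_iff)
      then show ?thesis by simp
    qed
    have "(\<lambda>\<omega>. g (batch_end A (U \<omega>) (Y \<omega>) i) \<omega>) \<in> M \<rightarrow>\<^sub>M count_space UNIV"
      by (rule measurable_compose_countable[OF g Suc.IH]) (use Suc.prems in simp)
    moreover have "g (batch_end A (U \<omega>) (Y \<omega>) i) \<omega> = batch_end A (U \<omega>) (Y \<omega>) (Suc i)"
      if "\<omega> \<in> space M" for \<omega>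
    proof -
      have u: "U \<omega> \<in> space (seed_law A)" using measurable_space[OF U that] .
      have "batch_end A (U \<omega>) (Y \<omega>) i < T"
        using batch_end_less[OF u, of i "Y \<omega>"] batch_end_le[OF u Suc.prems, of "Y \<omega>"] Suc.prems
        by simp
      then show ?thesis by (simp add: g_def Suc Let_def)
    qed
    ultimately show ?thesis by (rule measurable_cong[THEN iffD1, rotated]) auto
  qed simp
qed simp

lemma revealed_measurable:
  assumes U[measurable]: "U \<in> M \<rightarrow>\<^sub>M seed_law A"
    and Y: "\<And>s. s \<in> {1..T} \<Longrightarrow> (\<lambda>\<omega>. Y \<omega> s) \<in> borel_measurable M" and t: "1 \<le> t"
  shows "(\<lambda>\<omega>. revealed A B (U \<omega>) (Y \<omega>) t) \<in> M \<rightarrow>\<^sub>M count_space UNIV"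
proof -
  have b[measurable]: "(\<lambda>\<omega>. batch_end A (U \<omega>) (Y \<omega>) i) \<in> M \<rightarrow>\<^sub>M count_space UNIV" if "i \<in> {..B}" for i
    using batch_end_measurable[OF U Y, where i=i] that by auto
  \<comment> \<open>Spelling out the maximum as finitely many comparisons of batch ends reduces its
    measurability to theirs.\<close>
  have "revealed A B u y t = r \<longleftrightarrow> (\<exists>i\<in>{..B}. batch_end A u y i = r \<and> batch_end A u y i < t)
      \<and> (\<forall>i\<in>{..B}. batch_end A u y i < t \<longrightarrow> batch_end A u y i \<le> r)" for u y r
  proof -
    let ?S = "{batch_end A u y i |i. i \<le> B \<and> batch_end A u y i < t}"
    have "0 \<in> ?S" using t by (auto intro!: exI[of _ 0])
    then have "Max ?S = r \<longleftrightarrow> r \<in> ?S \<and> (\<forall>s\<in>?S. s \<le> r)"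
      using finite_batch_ends by (intro Max_eq_iff) auto
    then show ?thesis unfolding revealed_def by auto
  qed
  then have eq: "(\<lambda>\<omega>. revealed A B (U \<omega>) (Y \<omega>) t) -` {r} \<inter> space M
    = {\<omega>\<in>space M. (\<exists>i\<in>{..B}. batch_end A (U \<omega>) (Y \<omega>) i = r \<and> batch_end A (U \<omega>) (Y \<omega>) i < t)
      \<and> (\<forall>i\<in>{..B}. batch_end A (U \<omega>) (Y \<omega>) i < t \<longrightarrow> batch_end A (U \<omega>) (Y \<omega>) i \<le> r)}" for r
    by auto
  show ?thesis
    unfolding measurable_count_space_eq2_countable
    by (auto simp: eq) 
qed

lemma query_measurable:
  assumes U[measurable]: "U \<in> M \<rightarrow>\<^sub>M seed_law A"
    and Y: "\<And>s. s \<in> {1..T} \<Longrightarrow> (\<lambda>\<omega>. Y \<omega> s) \<in> borel_measurable M" and t: "1 \<le> t" "t \<le> T"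
  shows "(\<lambda>\<omega>. query A B (U \<omega>) (Y \<omega>) t) \<in> borel_measurable M"
proof -
  define g where "g n \<omega> = (if n < t then select A t n (U \<omega>, restrict (Y \<omega>) {1..n}) else undefined)"
    for n \<omega>
  have g: "g n \<in> borel_measurable M" for n
  proof (cases "n < t")
    case True
    have "(\<lambda>\<omega>. restrict (Y \<omega>) {1..n}) \<in> M \<rightarrow>\<^sub>M (\<Pi>\<^sub>M j\<in>{1..n}. borel)"
      using True t by (intro measurable_restrict Y) auto
    moreover have "select A t n \<in> seed_law A \<Otimes>\<^sub>M (\<Pi>\<^sub>M j\<in>{1..n}. borel) \<rightarrow>\<^sub>M borel"
      using alg t True unfolding batched_algorithm_def by auto
    ultimately show ?thesis
      unfolding g_def using True by (auto intro!: measurable_compose[OF measurable_Pair[OF U]])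
  next
    case False
    then have "g n = (\<lambda>_. undefined)" by (simp add: g_def fun_eq_iff)
    then show ?thesis by simp
  qed
  have "(\<lambda>\<omega>. g (revealed A B (U \<omega>) (Y \<omega>) t) \<omega>) \<in> borel_measurable M"
    by (rule measurable_compose_countable[OF g revealed_measurable[OF U Y t(1)]]) auto
  moreover have "g (revealed A B (U \<omega>) (Y \<omega>) t) \<omega> = query A B (U \<omega>) (Y \<omega>) t" for \<omega>
    using revealed_less[OF t(1)] by (simp add: g_def query_def Let_def)
  ultimately show ?thesis by simp
qed

lemma observations_measurable:
  assumes U[measurable]: "U \<in> M \<rightarrow>\<^sub>M seed_law A"
    and Z: "\<And>s. s \<in> {1..T} \<Longrightarrow> (\<lambda>\<omega>. Z \<omega> s) \<in> borel_measurable M"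
    and f: "f \<in> borel_measurable borel"
  shows "t \<le> T \<Longrightarrow> (\<lambda>\<omega>. observations A B f (U \<omega>) (Z \<omega>) t s) \<in> borel_measurable M"
proof (induction t arbitrary: s)
  case (Suc t)
  have "(\<lambda>\<omega>. query A B (U \<omega>) (observations A B f (U \<omega>) (Z \<omega>) t) (Suc t)) \<in> borel_measurable M"
    using Suc by (intro query_measurable U) auto
  note [measurable] = measurable_compose[OF this f]
  have [measurable]: "(\<lambda>\<omega>. Z \<omega> (Suc t)) \<in> borel_measurable M" using Suc.prems by (intro Z) auto
  show ?case
  proof (cases "s = Suc t")
    case True
    then show ?thesis by (simp add: Let_def)
  next
    case False
    then show ?thesis using Suc by (simp add: Let_def)
  qed
qed simp

end

section \<open>From information and missed bumps to regret\<close>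

lemma shifted_path_earlier:
  "s \<le> t \<Longrightarrow> t \<le> t' \<Longrightarrow> shifted_path a z t' s = shifted_path a z t s"
  by (induction t') (auto simp: le_Suc_eq)

lemma shifted_path_drift_cong:
  "(\<And>s y. 1 \<le> s \<Longrightarrow> s \<le> t \<Longrightarrow> a s y = b s y) \<Longrightarrow> shifted_path a z t = shifted_path b z t"
  by (induction t) auto

lemma sum_truncated:
  fixes g :: "nat \<Rightarrow> real"
  assumes "n \<le> T"
  shows "(\<Sum>t=1..T. if t \<le> n then g t else 0) = (\<Sum>t=1..n. g t)"
proof -
  have "(\<Sum>t=1..T. if t \<le> n then g t else 0) = (\<Sum>t\<in>{1..T} \<inter> {t. t \<le> n}. g t)"
    using sum.inter_restrict[of "{1..T}" g "{t. t \<le> n}"] by simp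
  also have "{1..T} \<inter> {t. t \<le> n} = {1..n}" using assms by auto
  finally show ?thesis .
qed

text \<open>A Chebyshev count. Cauchy-Schwarz over time bounds the sum over i of the squared totals
  by C (\<epsilon> n)^2, while each counted i contributes more than (\<epsilon> n / 2)^2.\<close>

lemma card_above_half_le:
  fixes F :: "'i \<Rightarrow> 'x \<Rightarrow> real" and x :: "nat \<Rightarrow> 'x"
  assumes fin: "finite I" and \<epsilon>: "0 < \<epsilon>"
    and sq: "\<And>t. t \<in> {1..n} \<Longrightarrow> (\<Sum>i\<in>I. (F i (x t))\<^sup>2) \<le> C * \<epsilon>\<^sup>2"
    and C: "0 \<le> C"
  shows "real (card {i\<in>I. \<epsilon> * real n / 2 < (\<Sum>t=1..n. F i (x t))}) \<le> 4 * C"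
proof (cases "n = 0")
  case False
  let ?Bad = "{i\<in>I. \<epsilon> * real n / 2 < (\<Sum>t=1..n. F i (x t))}"
  have "real (card ?Bad) * (\<epsilon> * real n / 2)\<^sup>2 = (\<Sum>i\<in>?Bad. (\<epsilon> * real n / 2)\<^sup>2)"
    by simp
  also have "\<dots> \<le> (\<Sum>i\<in>?Bad. (\<Sum>t=1..n. F i (x t))\<^sup>2)"
    using \<epsilon> by (intro sum_mono power_mono) auto
  also have "\<dots> \<le> (\<Sum>i\<in>I. (\<Sum>t=1..n. F i (x t))\<^sup>2)"
    using fin by (intro sum_mono2) auto
  also have "\<dots> \<le> (\<Sum>i\<in>I. real n * (\<Sum>t=1..n. (F i (x t))\<^sup>2))"
    using sum_squared_le_sum_of_squares[of _ "{1..n}"] by (intro sum_mono) (simp add: mult.commute)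
  also have "\<dots> = real n * (\<Sum>t=1..n. \<Sum>i\<in>I. (F i (x t))\<^sup>2)"
    by (simp add: sum_distrib_left[symmetric] sum.swap[of _ I])
  also have "\<dots> \<le> real n * (\<Sum>t=1..n. C * \<epsilon>\<^sup>2)"
    by (intro mult_left_mono sum_mono sq) auto
  also have "\<dots> = 4 * C * (\<epsilon> * real n / 2)\<^sup>2"
    by (simp add: power2_eq_square)
  finally show ?thesis
    using False \<epsilon> by (simp add: mult_le_cancel_right)
qed (use C in simp)

locale noisy_batched_run = batched_run X T B A
  for X :: "'a::topological_space set" and T B A +
  fixes \<sigma> :: real
  assumes \<sigma>: "0 < \<sigma>"
begin

abbreviation law :: "((nat \<Rightarrow> real) \<times> (nat \<Rightarrow> real)) measure" where
  "law \<equiv> interaction_law A \<sigma> T"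

abbreviation noises :: "(nat \<Rightarrow> real) measure" where
  "noises \<equiv> (\<Pi>\<^sub>M t\<in>{1..T}. normal_law \<sigma>)"

abbreviation obs :: "('a \<Rightarrow> real) \<Rightarrow> (nat \<Rightarrow> real) \<times> (nat \<Rightarrow> real) \<Rightarrow> nat \<Rightarrow> real" where
  "obs f \<omega> \<equiv> observations A B f (fst \<omega>) (snd \<omega>) T"

abbreviation event ::
    "((nat \<Rightarrow> real) \<Rightarrow> (nat \<Rightarrow> real) \<Rightarrow> bool) \<Rightarrow> ('a \<Rightarrow> real) \<Rightarrow> ((nat \<Rightarrow> real) \<times> (nat \<Rightarrow> real)) set" where
  "event D f \<equiv> {\<omega>\<in>space law. D (fst \<omega>) (obs f \<omega>)}"

sublocale seed: prob_space "seed_law A" by (rule seed_prob)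

sublocale noises: prob_space noises
  by (intro prob_space_PiM prob_space_normal_density \<sigma>)

sublocale law: prob_space law
proof -
  interpret pair_prob_space "seed_law A" noises ..
  show "prob_space law" unfolding interaction_law_def by (rule prob_space_axioms)
qed

lemma fst_measurable: "fst \<in> law \<rightarrow>\<^sub>M seed_law A"
  unfolding interaction_law_def by (rule measurable_fst)

lemma fst_in_space: "\<omega> \<in> space law \<Longrightarrow> fst \<omega> \<in> space (seed_law A)"
  by (rule measurable_space[OF fst_measurable])

lemma noise_measurable: "s \<in> {1..T} \<Longrightarrow> (\<lambda>\<omega>. snd \<omega> s) \<in> borel_measurable law"
proof -
  assume "s \<in> {1..T}"
  then have "(\<lambda>z. z s) \<in> noises \<rightarrow>\<^sub>M normal_law \<sigma>"
    by (rule measurable_component_singleton)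
  from measurable_compose[OF measurable_snd this] show ?thesis
    unfolding interaction_law_def by simp
qed

lemma obs_coordinate_measurable:
  "f \<in> borel_measurable borel \<Longrightarrow> (\<lambda>\<omega>. obs f \<omega> s) \<in> borel_measurable law"
  by (rule observations_measurable[OF fst_measurable noise_measurable]) auto

lemma obs_measurable [measurable]:
  assumes "f \<in> borel_measurable borel"
  shows "(\<lambda>\<omega>. (fst \<omega>, obs f \<omega>)) \<in> law \<rightarrow>\<^sub>M seed_law A \<Otimes>\<^sub>M seqs"
  by (intro measurable_Pair fst_measurable measurable_PiM_single')
     (use obs_coordinate_measurable[OF assms] in auto)

lemma query_measurable':
  "t \<in> {1..T} \<Longrightarrow> (\<lambda>\<omega>. query A B (fst \<omega>) (snd \<omega>) t) \<in> borel_measurable (seed_law A \<Otimes>\<^sub>M seqs)"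
  by (rule query_measurable) auto

lemma batch_end_measurable':
  "i \<le> B \<Longrightarrow> (\<lambda>\<omega>. batch_end A (fst \<omega>) (snd \<omega>) i)
    \<in> seed_law A \<Otimes>\<^sub>M seqs \<rightarrow>\<^sub>M count_space UNIV"
  by (rule batch_end_measurable) auto

text \<open>For a fixed seed this is \<open>shifted_event_lower_bound\<close>; being linear, it
  integrates over the seed by Fubini. Only the first n queries enter the information term because D
  ignores all later observations.\<close>

lemma prob_event_shift:
  assumes f[measurable]: "f \<in> borel_measurable borel" and n: "n \<le> T"
    and D: "Measurable.pred (seed_law A \<Otimes>\<^sub>M seqs) (\<lambda>\<omega>. D (fst \<omega>) (snd \<omega>))"
    and D_local: "\<And>u y y'. u \<in> space (seed_law A) \<Longrightarrow> (\<And>s. 1 \<le> s \<Longrightarrow> s \<le> n \<Longrightarrow> y s = y' s)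
      \<Longrightarrow> D u y = D u y'"
  shows "ennreal (3/4) * emeasure law (event D (\<lambda>_. 0))
    \<le> emeasure law (event D f)
      + ennreal (3/2) * (\<integral>\<^sup>+\<omega>. ennreal (\<Sum>t=1..n.
          (f (query A B (fst \<omega>) (obs (\<lambda>_. 0) \<omega>) t))\<^sup>2 / \<sigma>\<^sup>2) \<partial>law)"
proof -
  have event: "event D g \<in> sets law"
    if "g \<in> borel_measurable borel" for g
    using measurable_compose[OF obs_measurable[OF that] D] by (simp add: pred_def)
  have emeasure_eq: "emeasure law (event D g)
      = (\<integral>\<^sup>+u. (\<integral>\<^sup>+z. indicator {y. D u y} (observations A B g u z T) \<partial>noises) \<partial>seed_law A)"
    if g: "g \<in> borel_measurable borel" for g
  proof -
    have "emeasure law (event D g)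
      = (\<integral>\<^sup>+\<omega>. indicator (event D g) \<omega> \<partial>law)"
      by (rule nn_integral_indicator[symmetric, OF event[OF g]])
    also have "\<dots> = (\<integral>\<^sup>+u. (\<integral>\<^sup>+z. indicator (event D g) (u, z) \<partial>noises)
        \<partial>seed_law A)"
      using borel_measurable_indicator[OF event[OF g]] unfolding interaction_law_def
      by (rule noises.nn_integral_fst[symmetric])
    also have "\<dots> = (\<integral>\<^sup>+u. (\<integral>\<^sup>+z. indicator {y. D u y} (observations A B g u z T) \<partial>noises)
        \<partial>seed_law A)"
      by (intro nn_integral_cong)
         (auto simp: indicator_def interaction_law_def space_pair_measure)
    finally show ?thesis .
  qed
  define S where "S \<omega> = (\<Sum>t=1..n. (f (query A B (fst \<omega>) (obs (\<lambda>_. 0) \<omega>) t))\<^sup>2 / \<sigma>\<^sup>2)" for \<omega>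
  have S[measurable]: "S \<in> borel_measurable law"
  proof -
    have "(\<lambda>\<omega>. query A B (fst \<omega>) (obs (\<lambda>_. 0) \<omega>) t) \<in> borel_measurable law" if "t \<in> {1..n}" for t
      using that n measurable_compose[OF obs_measurable query_measurable'[of t], of "\<lambda>_. 0"] by auto
    from measurable_compose[OF this f] show ?thesis unfolding S_def by measurable
  qed
  have fixed_seed: "ennreal (3/4) * (\<integral>\<^sup>+z. indicator {y. D u y} (observations A B (\<lambda>_. 0) u z T) \<partial>noises)
    \<le> (\<integral>\<^sup>+z. indicator {y. D u y} (observations A B f u z T) \<partial>noises)
      + ennreal (3/2) * (\<integral>\<^sup>+z. ennreal (S (u, z)) \<partial>noises)"
    if u: "u \<in> space (seed_law A)" for u
  proof -
    \<comment> \<open>The mean shift is switched off after time n. This leaves D unchanged and stops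
      the energy at n.\<close>
    define a where "a t y = (if 1 \<le> t \<and> t \<le> n then f (query A B u y t) else 0)" for t y
    interpret shift: adaptive_shift a \<sigma>
    proof
      fix t
      show "a t \<in> borel_measurable seqs"
      proof (cases "1 \<le> t \<and> t \<le> n")
        case True
        have "(\<lambda>y. query A B u y t) \<in> borel_measurable seqs"
          using True n u by (intro query_measurable) auto
        from measurable_compose[OF this f] show ?thesis
          using True unfolding a_def by simp
      next
        case False
        then have "a t = (\<lambda>_. 0)" by (auto simp: a_def fun_eq_iff)
        then show ?thesis by simp
      qed
      show "a t y = a t y'" if "\<And>s. s < t \<Longrightarrow> y s = y' s" for y y'
        using query_local[OF u, of t y y'] that n by (auto simp: a_def)
    qed (rule \<sigma>)
    have Du: "Measurable.pred seqs (D u)"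
      using measurable_compose[OF measurable_Pair1'[OF u] D] by simp
    have path: "D u (shifted_path a z T) \<longleftrightarrow> D u (observations A B f u z T)" for z
    proof (rule D_local[OF u])
      fix s assume s: "1 \<le> s" "s \<le> n"
      have "shifted_path a z T s = shifted_path a z s s"
        using s n by (intro shifted_path_earlier) auto
      also have "shifted_path a z s = shifted_path (\<lambda>t y. f (query A B u y t)) z s"
        using s by (intro shifted_path_drift_cong) (auto simp: a_def)
      also have "\<dots> = observations A B f u z s"
        by (rule observations_eq_shifted_path[symmetric])
      also have "observations A B f u z s s = observations A B f u z T s"
        using s n by (intro observations_earlier[symmetric]) auto
      finally show "shifted_path a z T s = observations A B f u z T s" .
    qed
    have en: "shift.energy T (zero_path z T) = S (u, z)" for z
    proof -
      have "shift.energy T (zero_path z T)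
        = (\<Sum>t=1..T. if t \<le> n then (f (query A B u (zero_path z T) t))\<^sup>2 / \<sigma>\<^sup>2 else 0)"
        unfolding shift.energy_def a_def by (intro sum.cong) auto
      also have "\<dots> = S (u, z)"
        unfolding sum_truncated[OF n] S_def zero_path_eq_observations[of z T A B u] by simp
      finally show ?thesis .
    qed
    have "indicator {y. D u y} (shifted_path a z T)
        = (indicator {y. D u y} (observations A B f u z T) :: ennreal)" for z
      using path[of z] by (simp add: indicator_def)
    then show ?thesis
      using shift.shifted_event_lower_bound[OF Du, of T]
      unfolding en unfolding zero_path_eq_observations[of _ T A B u] by simp
  qed
  have inner: "(\<lambda>u. (\<integral>\<^sup>+z. indicator {y. D u y} (observations A B g u z T) \<partial>noises))
      \<in> borel_measurable (seed_law A)" if g: "g \<in> borel_measurable borel" for g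
  proof -
    have "(\<lambda>u. (\<integral>\<^sup>+z. indicator (event D g) (u, z) \<partial>noises))
        \<in> borel_measurable (seed_law A)"
      using borel_measurable_indicator[OF event[OF g]] unfolding interaction_law_def
      by (rule noises.borel_measurable_nn_integral_fst)
    then show ?thesis
      by (rule measurable_cong[THEN iffD1, rotated])
         (auto simp: indicator_def interaction_law_def space_pair_measure intro!: nn_integral_cong)
  qed
  have S': "(\<lambda>\<omega>. ennreal (S \<omega>)) \<in> borel_measurable (seed_law A \<Otimes>\<^sub>M noises)"
    using S unfolding interaction_law_def by measurable
  have "ennreal (3/4) * emeasure law (event D (\<lambda>_. 0))
      = (\<integral>\<^sup>+u. ennreal (3/4) * (\<integral>\<^sup>+z. indicator {y. D u y} (observations A B (\<lambda>_. 0) u z T) \<partial>noises)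
          \<partial>seed_law A)"
    using emeasure_eq[of "\<lambda>_. 0"] inner[of "\<lambda>_. 0"] by (simp add: nn_integral_cmult)
  also have "\<dots> \<le> (\<integral>\<^sup>+u. (\<integral>\<^sup>+z. indicator {y. D u y} (observations A B f u z T) \<partial>noises)
      + ennreal (3/2) * (\<integral>\<^sup>+z. ennreal (S (u, z)) \<partial>noises) \<partial>seed_law A)"
    by (intro nn_integral_mono fixed_seed)
  also have "\<dots> = (\<integral>\<^sup>+u. (\<integral>\<^sup>+z. indicator {y. D u y} (observations A B f u z T) \<partial>noises) \<partial>seed_law A)
      + ennreal (3/2) * (\<integral>\<^sup>+u. (\<integral>\<^sup>+z. ennreal (S (u, z)) \<partial>noises) \<partial>seed_law A)"
    using inner[OF f] noises.borel_measurable_nn_integral_fst[OF S']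
    by (simp add: nn_integral_add nn_integral_cmult)
  also have "(\<integral>\<^sup>+u. (\<integral>\<^sup>+z. ennreal (S (u, z)) \<partial>noises) \<partial>seed_law A) = (\<integral>\<^sup>+\<omega>. ennreal (S \<omega>) \<partial>law)"
    unfolding interaction_law_def by (rule noises.nn_integral_fst[OF S'])
  finally show ?thesis
    unfolding emeasure_eq[OF f, symmetric] S_def .
qed

lemma regret_measurable:
  assumes f[measurable]: "f \<in> borel_measurable borel"
  shows "(\<lambda>\<omega>. regret A B T f xs (fst \<omega>) (snd \<omega>)) \<in> borel_measurable law"
proof -
  have q: "(\<lambda>\<omega>. query A B (fst \<omega>) (obs f \<omega>) t) \<in> borel_measurable law" if "t \<in> {1..T}" for t
    using measurable_compose[OF obs_measurable[OF f] query_measurable'[OF that]] by simp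
  have "(\<lambda>\<omega>. \<Sum>t=1..T. f xs - f (query A B (fst \<omega>) (obs f \<omega>) t)) \<in> borel_measurable law"
    using measurable_compose[OF q f] by measurable
  then show ?thesis
    by (rule measurable_cong[THEN iffD1, rotated])
       (auto simp: regret_def played_eq_query[OF fst_in_space] intro!: sum.cong)
qed

lemma regret_ge:
  assumes \<omega>: "\<omega> \<in> space law" and n: "n \<le> T"
    and max: "\<And>x. x \<in> X \<Longrightarrow> f x \<le> f xs"
    and few: "(\<Sum>t=1..n. f (query A B (fst \<omega>) (obs f \<omega>) t)) \<le> f xs * real n / 2"
  shows "f xs * real n / 2 \<le> regret A B T f xs (fst \<omega>) (snd \<omega>)"
proof -
  have "f xs * real n / 2 \<le> (\<Sum>t=1..n. f xs - f (query A B (fst \<omega>) (obs f \<omega>) t))"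
    using few by (simp add: sum_subtractf algebra_simps)
  also have "\<dots> \<le> (\<Sum>t=1..T. f xs - f (query A B (fst \<omega>) (obs f \<omega>) t))"
    using n max[OF query_in[OF fst_in_space[OF \<omega>]]] by (intro sum_mono2) auto
  also have "\<dots> = regret A B T f xs (fst \<omega>) (snd \<omega>)"
    unfolding regret_def by (intro sum.cong) (auto simp: played_eq_query[OF fst_in_space[OF \<omega>]])
  finally show ?thesis .
qed

definition late_batch :: "(nat \<Rightarrow> real) \<Rightarrow> nat \<Rightarrow> (nat \<Rightarrow> real) \<Rightarrow> (nat \<Rightarrow> real) \<Rightarrow> bool" where
  "late_batch \<tau> j u y \<longleftrightarrow> real (batch_end A u y j) \<le> \<tau> j \<and> \<tau> (Suc j) \<le> real (batch_end A u y (Suc j))"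

lemma late_batch_measurable:
  "j < B \<Longrightarrow> Measurable.pred (seed_law A \<Otimes>\<^sub>M seqs) (\<lambda>\<omega>. late_batch \<tau> j (fst \<omega>) (snd \<omega>))"
  unfolding late_batch_def
  using batch_end_measurable'[of j] batch_end_measurable'[of "Suc j"] by measurable

text \<open>Take the least i for which batch i + 1 ends past \<tau> (i + 1): i = B - 1 qualifies,
  and minimality says that batch i ended before \<tau> i.\<close>

lemma exists_late_batch:
  assumes u: "u \<in> space (seed_law A)" and "0 < B" "0 \<le> \<tau> 0" "\<tau> B \<le> real T"
  shows "\<exists>j<B. late_batch \<tau> j u y"
proof -
  define i where "i = (LEAST i. \<tau> (Suc i) \<le> real (batch_end A u y (Suc i)))"
  have ex: "\<tau> (Suc (B - 1)) \<le> real (batch_end A u y (Suc (B - 1)))"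
    using assms batch_end_last[OF u, of y] by simp
  have "i \<le> B - 1" unfolding i_def using ex by (rule Least_le)
  moreover have "\<tau> (Suc i) \<le> real (batch_end A u y (Suc i))"
    unfolding i_def using ex by (rule LeastI)
  moreover have "real (batch_end A u y i) \<le> \<tau> i"
  proof (cases i)
    case (Suc k)
    then show ?thesis
      using not_less_Least[of k "\<lambda>i. \<tau> (Suc i) \<le> real (batch_end A u y (Suc i))"]
      unfolding i_def[symmetric] by simp
  qed (use assms in simp)
  ultimately show ?thesis using \<open>0 < B\<close> unfolding late_batch_def by (intro exI[of _ i]) auto
qed

text \<open>Two averaging steps: the stage j is chosen by a union bound under the zero function,
  where it does not depend on any bump; then the bump i is chosen by averaging over the family of
  that stage.\<close>

theorem regret_lower_bound:
  fixes F :: "nat \<Rightarrow> 'i \<Rightarrow> 'a \<Rightarrow> real" and xs :: "nat \<Rightarrow> 'i \<Rightarrow> 'a" and C :: real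
  assumes B: "0 < B" and \<tau>: "\<And>j. j < B \<Longrightarrow> 0 \<le> \<tau> j" "\<tau> B \<le> real T"
    and fin: "\<And>j. j < B \<Longrightarrow> finite (I j)" "\<And>j. j < B \<Longrightarrow> I j \<noteq> {}"
    and F_meas: "\<And>j i. j < B \<Longrightarrow> i \<in> I j \<Longrightarrow> F j i \<in> borel_measurable borel"
    and F_peak: "\<And>j i. j < B \<Longrightarrow> i \<in> I j \<Longrightarrow> F j i (xs j i) = \<epsilon> j"
    and F_le: "\<And>j i x. j < B \<Longrightarrow> i \<in> I j \<Longrightarrow> x \<in> X \<Longrightarrow> F j i x \<le> \<epsilon> j"
    and F_sq: "\<And>j x. j < B \<Longrightarrow> x \<in> X \<Longrightarrow> (\<Sum>i\<in>I j. (F j i x)\<^sup>2) \<le> C * (\<epsilon> j)\<^sup>2"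
    and \<epsilon>: "\<And>j. j < B \<Longrightarrow> 0 < \<epsilon> j" and C: "0 \<le> C"
    and many: "\<And>j. j < B \<Longrightarrow> 16 * C \<le> real (card (I j))"
    and info: "\<And>j. j < B \<Longrightarrow> 8 * real B * \<tau> j * C * (\<epsilon> j)\<^sup>2 \<le> \<sigma>\<^sup>2 * real (card (I j))"
  obtains j i where "j < B" "i \<in> I j"
    "3 / (8 * real B) \<le> \<P>((u, z) in law. regret A B T (F j i) (xs j i) u z \<ge> \<epsilon> j * \<tau> (Suc j) / 2)"
proof -
  let ?E = "\<lambda>j. event (late_batch \<tau> j) (\<lambda>_. 0)"
  have E_meas: "?E j \<in> sets law" if "j < B" for j
    using measurable_compose[OF obs_measurable late_batch_measurable[OF that], of "\<lambda>_. 0"]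
    by (simp add: pred_def)
  have "space law \<subseteq> (\<Union>j\<in>{..<B}. ?E j)"
    using exists_late_batch[OF fst_in_space B, of _ \<tau>] \<tau> B by blast
  then have "1 \<le> law.prob (\<Union>j\<in>{..<B}. ?E j)"
    using law.finite_measure_mono[of "space law" "\<Union>j\<in>{..<B}. ?E j"] E_meas
    by (simp add: law.prob_space sets.finite_UN)
  also have "\<dots> \<le> (\<Sum>j<B. law.prob (?E j))"
    using E_meas by (intro law.finite_measure_subadditive_finite) auto
  finally have one: "1 \<le> (\<Sum>j<B. law.prob (?E j))" .
  obtain j where j: "j < B" and p: "1 / real B \<le> law.prob (?E j)"
  proof (rule ccontr)
    assume "\<not> thesis"
    then have "law.prob (?E j) < 1 / real B" if "j < B" for j
      using that \<open>\<And>j. \<lbrakk>j < B; 1 / real B \<le> law.prob (?E j)\<rbrakk> \<Longrightarrow> thesis\<close> by (meson not_le)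
    then have "(\<Sum>j<B. law.prob (?E j)) < (\<Sum>j<B. 1 / real B)"
      using B by (intro sum_strict_mono) auto
    then show False using one B by simp
  qed
  \<comment> \<open>Batch ends are integers, so \<tau> j may be rounded down and \<tau> (j + 1)
    rounded up. The cap at T is for thresholds that exceed the horizon.\<close>
  define n where "n = min T (nat \<lfloor>\<tau> j\<rfloor>)"
  define n' where "n' = nat \<lceil>\<tau> (Suc j)\<rceil>"
  \<comment> \<open>A stage of positive probability occurs in some run, whose batch end lies beyond
    \<tau> (j + 1); since batch ends are at most T, so is this threshold.\<close>
  have "law.prob (?E j) > 0" using p B by (auto intro: less_le_trans[of _ "1 / real B"])
  then have "?E j \<noteq> {}" by (metis measure_empty less_irrefl)
  then obtain \<omega> where \<omega>: "\<omega> \<in> space law" "late_batch \<tau> j (fst \<omega>) (obs (\<lambda>_. 0) \<omega>)" by blast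
  then have "\<tau> (Suc j) \<le> real T"
    using batch_end_le[OF fst_in_space[OF \<omega>(1)], of "Suc j" "obs (\<lambda>_. 0) \<omega>"] j
    unfolding late_batch_def by simp
  then have n'T: "n' \<le> T" unfolding n'_def by linarith
  have nT: "n \<le> T" by (simp add: n_def)
  have n_le: "real n \<le> \<tau> j" using \<tau>(1)[OF j] unfolding n_def by linarith
  \<comment> \<open>The stage occurs and the queries up to n' mostly miss bump i. The first conjunct
    forces batch j to end by n and batch j + 1 to reach n', so D is a function of the observations
    up to n.\<close>
  define D where "D i u y \<longleftrightarrow> late_batch \<tau> j u y
      \<and> (\<Sum>t=1..n'. F j i (query A B u y t)) \<le> \<epsilon> j * real n' / 2" for i u y
  have D_meas: "Measurable.pred (seed_law A \<Otimes>\<^sub>M seqs) (\<lambda>\<omega>. D i (fst \<omega>) (snd \<omega>))"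
    if i: "i \<in> I j" for i
  proof -
    have [measurable]: "(\<lambda>\<omega>. F j i (query A B (fst \<omega>) (snd \<omega>) t)) \<in> borel_measurable (seed_law A \<Otimes>\<^sub>M seqs)"
      if "t \<in> {1..n'}" for t
      using that n'T by (intro measurable_compose[OF query_measurable' F_meas[OF j i]]) auto
    note [measurable] = late_batch_measurable[OF j]
    show ?thesis unfolding D_def by measurable
  qed
  have D_local: "D i u y = D i u y'"
    if u: "u \<in> space (seed_law A)" and eq: "\<And>s. 1 \<le> s \<Longrightarrow> s \<le> n \<Longrightarrow> y s = y' s" for i u y y'
  proof -
    have imp: "D i u y'" if D: "D i u y" and eq: "\<And>s. 1 \<le> s \<Longrightarrow> s \<le> n \<Longrightarrow> y s = y' s" for y y'
    proof -
      have le: "batch_end A u y j \<le> n"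
        using D batch_end_le[OF u, of j y] j unfolding D_def late_batch_def n_def
        by (simp add: le_nat_floor)
      have "batch_end A u y (j - 1) \<le> n"
        using batch_end_mono[OF u, of "j - 1" j y] le j by simp
      then have ends: "batch_end A u y' j = batch_end A u y j"
        "batch_end A u y' (Suc j) = batch_end A u y (Suc j)"
        using batch_end_local[OF u, of n y y' j, OF eq] batch_end_local[OF u, of n y y' "Suc j", OF eq]
          le j by simp_all
      have "n' \<le> batch_end A u y (Suc j)"
        using D unfolding D_def late_batch_def n'_def by linarith
      then have "query A B u y' t = query A B u y t" if "t \<in> {1..n'}" for t
        using that j le eq by (intro query_local_batch[OF u, of n]) auto
      then show ?thesis using D ends unfolding D_def late_batch_def by simp
    qed
    show ?thesis using imp[of y y'] imp[of y' y] eq by metis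
  qed
  let ?Q = "\<lambda>i. law.prob (event (D i) (\<lambda>_. 0))"
  let ?P = "\<lambda>i. law.prob (event (D i) (F j i))"
  let ?q = "\<lambda>\<omega> t. query A B (fst \<omega>) (obs (\<lambda>_. 0) \<omega>) t"
  define S where "S i \<omega> = (\<Sum>t=1..n. (F j i (?q \<omega> t))\<^sup>2 / \<sigma>\<^sup>2)" for i \<omega>
  have q_meas: "(\<lambda>\<omega>. ?q \<omega> t) \<in> borel_measurable law" if "t \<in> {1..T}" for t
    using measurable_compose[OF obs_measurable query_measurable'[OF that], of "\<lambda>_. 0"] by simp
  have S_meas: "S i \<in> borel_measurable law" if "i \<in> I j" for i
  proof -
    have "(\<lambda>\<omega>. F j i (?q \<omega> t)) \<in> borel_measurable law" if "t \<in> {1..n}" for t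
      using that nT by (intro measurable_compose[OF q_meas F_meas[OF j \<open>i \<in> I j\<close>]]) auto
    then show ?thesis unfolding S_def by measurable
  qed
  have D0_meas: "event (D i) (\<lambda>_. 0) \<in> sets law" if "i \<in> I j" for i
    using measurable_compose[OF obs_measurable D_meas[OF that], of "\<lambda>_. 0"] by (simp add: pred_def)
  have S_sum: "(\<Sum>i\<in>I j. S i \<omega>) \<le> real (card (I j)) / (8 * real B)" if \<omega>: "\<omega> \<in> space law" for \<omega>
  proof -
    have "(\<Sum>i\<in>I j. S i \<omega>) = (\<Sum>t=1..n. (\<Sum>i\<in>I j. (F j i (?q \<omega> t))\<^sup>2) / \<sigma>\<^sup>2)"
      unfolding S_def by (subst sum.swap) (simp add: sum_divide_distrib)
    also have "\<dots> \<le> (\<Sum>t=1..n. C * (\<epsilon> j)\<^sup>2 / \<sigma>\<^sup>2)"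
      using nT by (intro sum_mono divide_right_mono F_sq[OF j] query_in fst_in_space[OF \<omega>]) auto
    also have "\<dots> = real n * (C * (\<epsilon> j)\<^sup>2 / \<sigma>\<^sup>2)" by simp
    also have "\<dots> \<le> \<tau> j * (C * (\<epsilon> j)\<^sup>2 / \<sigma>\<^sup>2)"
      using n_le C by (intro mult_right_mono) auto
    also have "\<dots> \<le> real (card (I j)) / (8 * real B)"
      using info[OF j] \<sigma> B by (simp add: field_simps)
    finally show ?thesis .
  qed
  have S_int: "(\<Sum>i\<in>I j. \<integral>\<^sup>+\<omega>. ennreal (S i \<omega>) \<partial>law) \<le> ennreal (real (card (I j)) / (8 * real B))"
  proof -
    have "(\<Sum>i\<in>I j. \<integral>\<^sup>+\<omega>. ennreal (S i \<omega>) \<partial>law) = (\<integral>\<^sup>+\<omega>. (\<Sum>i\<in>I j. ennreal (S i \<omega>)) \<partial>law)"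
      using S_meas by (intro nn_integral_sum[symmetric]) auto
    also have "\<dots> \<le> (\<integral>\<^sup>+\<omega>. ennreal (real (card (I j)) / (8 * real B)) \<partial>law)"
    proof (rule nn_integral_mono)
      fix \<omega> assume "\<omega> \<in> space law"
      then show "(\<Sum>i\<in>I j. ennreal (S i \<omega>)) \<le> ennreal (real (card (I j)) / (8 * real B))"
        using S_sum by (subst sum_ennreal) (auto simp: S_def sum_nonneg intro!: ennreal_leI)
    qed
    also have "\<dots> = ennreal (real (card (I j)) / (8 * real B))"
      by (simp add: law.emeasure_space_1)
    finally show ?thesis .
  qed
  have "ennreal (\<Sum>i\<in>I j. 3/4 * ?Q i) = (\<Sum>i\<in>I j. ennreal (3/4 * ?Q i))"
    by (rule sum_ennreal[symmetric]) simp
  also have "\<dots> = (\<Sum>i\<in>I j. ennreal (3/4) * emeasure law (event (D i) (\<lambda>_. 0)))"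
    by (intro sum.cong refl, subst law.emeasure_eq_measure, rule ennreal_mult') simp
  also have "\<dots> \<le> (\<Sum>i\<in>I j. emeasure law (event (D i) (F j i))
        + ennreal (3/2) * (\<integral>\<^sup>+\<omega>. ennreal (S i \<omega>) \<partial>law))"
    unfolding S_def by (intro sum_mono prob_event_shift[OF F_meas[OF j] nT D_meas D_local])
  also have "\<dots> = ennreal (\<Sum>i\<in>I j. ?P i) + ennreal (3/2) * (\<Sum>i\<in>I j. \<integral>\<^sup>+\<omega>. ennreal (S i \<omega>) \<partial>law)"
    by (simp add: sum.distrib sum_distrib_left law.emeasure_eq_measure)
  also have "\<dots> \<le> ennreal (\<Sum>i\<in>I j. ?P i)
      + ennreal (3/2) * ennreal (real (card (I j)) / (8 * real B))"
    by (intro add_left_mono mult_left_mono S_int) auto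
  also have "\<dots> = ennreal ((\<Sum>i\<in>I j. ?P i) + 3/2 * (real (card (I j)) / (8 * real B)))"
    by (simp add: ennreal_mult'[symmetric] ennreal_plus[symmetric] sum_nonneg del: ennreal_plus)
  finally have main: "(\<Sum>i\<in>I j. 3/4 * ?Q i)
      \<le> (\<Sum>i\<in>I j. ?P i) + 3/2 * (real (card (I j)) / (8 * real B))"
    by (subst (asm) ennreal_le_iff) (auto intro!: add_nonneg_nonneg sum_nonneg)
  \<comment> \<open>Integrates the number of bumps satisfying D: on the stage event, at most 4 C of
    them are hit too often.\<close>
  have "(real (card (I j)) - 4 * C) * law.prob (?E j)
      = (\<integral>\<omega>. (real (card (I j)) - 4 * C) * indicator (?E j) \<omega> \<partial>law)"
    using E_meas[OF j] by simp
  also have "\<dots> \<le> (\<integral>\<omega>. (\<Sum>i\<in>I j. indicator (event (D i) (\<lambda>_. 0)) \<omega>) \<partial>law)"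
  proof (rule integral_mono)
    show "integrable law (\<lambda>\<omega>. (real (card (I j)) - 4 * C) * indicator (?E j) \<omega>)"
      using E_meas[OF j] by (intro integrable_mult_right integrable_real_indicator) (auto simp: law.emeasure_eq_measure)
    show "integrable law (\<lambda>\<omega>. \<Sum>i\<in>I j. indicator (event (D i) (\<lambda>_. 0)) \<omega> :: real)"
      using D0_meas by (intro Bochner_Integration.integrable_sum integrable_real_indicator)
        (auto simp: law.emeasure_eq_measure)
    fix \<omega> assume \<omega>: "\<omega> \<in> space law"
    show "(real (card (I j)) - 4 * C) * indicator (?E j) \<omega>
        \<le> (\<Sum>i\<in>I j. indicator (event (D i) (\<lambda>_. 0)) \<omega> :: real)"
    proof (cases "\<omega> \<in> ?E j")
      case True
      let ?Bad = "{i\<in>I j. \<epsilon> j * real n' / 2 < (\<Sum>t=1..n'. F j i (?q \<omega> t))}"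
      have "real (card ?Bad) \<le> 4 * C"
        using n'T by (intro card_above_half_le fin(1) \<epsilon> j C F_sq query_in fst_in_space \<omega>) auto
      moreover have "(\<Sum>i\<in>I j. indicator (event (D i) (\<lambda>_. 0)) \<omega>)
          = real (card (I j - ?Bad))"
      proof -
        have "(\<Sum>i\<in>I j. indicator (event (D i) (\<lambda>_. 0)) \<omega> :: real)
          = (\<Sum>i\<in>I j. indicator (I j - ?Bad) i)"
          using True by (intro sum.cong) (auto simp: indicator_def D_def)
        also have "\<dots> = (\<Sum>i\<in>I j - ?Bad. 1)"
          using fin(1)[OF j] by (intro sum.mono_neutral_cong_right) auto
        finally show ?thesis by simp
      qed
      moreover have "card (I j) = card (I j - ?Bad) + card ?Bad"
        using fin(1)[OF j] by (subst card_Un_disjoint[symmetric]) (auto intro: arg_cong[where f=card])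
      ultimately show ?thesis using True by simp
    next
      case False
      then show ?thesis by (simp add: sum_nonneg)
    qed
  qed
  also have "\<dots> = (\<Sum>i\<in>I j. ?Q i)"
    using D0_meas by (subst Bochner_Integration.integral_sum)
      (auto intro!: integrable_real_indicator simp: law.emeasure_eq_measure)
  finally have P0: "(real (card (I j)) - 4 * C) * law.prob (?E j) \<le> (\<Sum>i\<in>I j. ?Q i)" .
  define M where "M = real (card (I j))"
  have M: "0 < M" "16 * C \<le> M" using fin[OF j] many[OF j] by (auto simp: M_def card_gt_0_iff)
  \<comment> \<open>16 C <= M leaves three quarters of the bumps. With the factor 3/4 and the loss
    3/16 from the change of measure, 9/16 - 3/16 = 3/8.\<close>
  have "3/4 * M * (1 / real B) \<le> (M - 4 * C) * law.prob (?E j)"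
    using M p by (intro mult_mono) auto
  then have "3/4 * (3/4 * M * (1 / real B)) \<le> (\<Sum>i\<in>I j. ?P i) + 3/2 * (M / (8 * real B))"
    using main P0 unfolding M_def[symmetric] sum_distrib_left[symmetric] by linarith
  then have total: "M * (3 / (8 * real B)) \<le> (\<Sum>i\<in>I j. ?P i)"
    using B by (simp add: field_simps)
  obtain i where i: "i \<in> I j" "3 / (8 * real B) \<le> ?P i"
  proof (rule ccontr)
    assume *: "\<not> thesis"
    have "?P i < 3 / (8 * real B)" if "i \<in> I j" for i
      using * \<open>\<And>i. \<lbrakk>i \<in> I j; 3 / (8 * real B) \<le> ?P i\<rbrakk> \<Longrightarrow> thesis\<close> that by (meson not_le)
    then have "(\<Sum>i\<in>I j. ?P i) < (\<Sum>i\<in>I j. 3 / (8 * real B))"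
      using fin j by (intro sum_strict_mono) auto
    then show False using total by (simp add: M_def)
  qed
  let ?R = "{(u, z) \<in> space law. \<epsilon> j * \<tau> (Suc j) / 2 \<le> regret A B T (F j i) (xs j i) u z}"
  have R: "?R = {\<omega> \<in> space law.
      \<epsilon> j * \<tau> (Suc j) / 2 \<le> regret A B T (F j i) (xs j i) (fst \<omega>) (snd \<omega>)}"
    by auto
  have "?P i \<le> \<P>((u, z) in law. regret A B T (F j i) (xs j i) u z \<ge> \<epsilon> j * \<tau> (Suc j) / 2)"
  proof (rule law.finite_measure_mono)
    show "event (D i) (F j i) \<subseteq> ?R"
    proof
      fix \<omega> assume "\<omega> \<in> event (D i) (F j i)"
      then have \<omega>: "\<omega> \<in> space law" and "D i (fst \<omega>) (obs (F j i) \<omega>)" by auto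
      then have "\<epsilon> j * real n' / 2 \<le> regret A B T (F j i) (xs j i) (fst \<omega>) (snd \<omega>)"
        using regret_ge[OF \<omega> n'T, of "F j i" "xs j i"] F_le[OF j i(1)] F_peak[OF j i(1)]
        by (simp add: D_def)
      moreover have "\<epsilon> j * \<tau> (Suc j) \<le> \<epsilon> j * real n'"
        using \<epsilon>[OF j] unfolding n'_def by (intro mult_left_mono) linarith+
      ultimately have "\<epsilon> j * \<tau> (Suc j) / 2 \<le> regret A B T (F j i) (xs j i) (fst \<omega>) (snd \<omega>)"
        by linarith
      then show "\<omega> \<in> ?R" unfolding R using \<omega> by simp
    qed
    show "?R \<in> sets law"
      unfolding R using regret_measurable[OF F_meas[OF j i(1)], of "xs j i"] by measurable
  qed
  then show thesis using that[OF j i(1)] i(2) by linarith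
qed

end

section \<open>Lower bounds for the two kernels\<close>

text \<open>All that one stage needs, with w standing for B \<tau> j. The last two clauses are the
  hypotheses \<open>many\<close> and \<open>info\<close> of the general bound with C = 24^d and N^d
  bumps; h is a closed-form lower bound on the height.\<close>

definition hard_bumps ::
    "'d::finite kernel \<Rightarrow> real \<Rightarrow> real \<Rightarrow> real \<Rightarrow> real \<Rightarrow> bool" where
  "hard_bumps k \<Psi> \<sigma> w h \<longleftrightarrow> (\<exists>N \<epsilon> F xs. bump_family k \<Psi> N \<epsilon> F xs \<and> 0 < \<epsilon> \<and> h \<le> \<epsilon> \<and>
     16 * 24 ^ CARD('d) \<le> real N ^ CARD('d) \<and>
     8 * w * 24 ^ CARD('d) * \<epsilon>\<^sup>2 \<le> \<sigma>\<^sup>2 * real N ^ CARD('d))"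

text \<open>Reduces the bound to numbers: thresholds \<tau> and heights h whose products h j *
  \<tau> (j + 1) stay above one \<rho>. The maximiser is the peak of the bump.\<close>

lemma hard_instance:
  fixes A :: "(real ^ 'd::finite) batched_alg"
  assumes \<sigma>: "0 < \<sigma>" and A: "batched_algorithm unit_cube T B A" and B: "0 < B"
    and \<delta>: "\<delta> < 1 / (11 * real B)"
    and \<tau>: "\<And>j. 0 \<le> \<tau> j" "\<tau> B \<le> real T"
    and bumps: "\<And>j. hard_bumps k \<Psi> \<sigma> (real B * \<tau> j) (h j)"
    and \<rho>: "\<And>j. \<rho> \<le> h j * \<tau> (Suc j) / 2"
  shows "\<exists>f xstar. in_rkhs_ball unit_cube k \<Psi> f \<and> is_arg_max f (\<lambda>x. x \<in> unit_cube) xstar \<and>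
    \<P>((u, z) in interaction_law A \<sigma> T. regret A B T f xstar u z \<ge> \<rho>) \<ge> \<delta>"
proof -
  interpret noisy_batched_run unit_cube T B A \<sigma>
    using A \<sigma> by unfold_locales
  from bumps obtain N \<epsilon> F xs where fam: "\<And>j. bump_family k \<Psi> (N j) (\<epsilon> j) (F j) (xs j)"
    and \<epsilon>: "\<And>j. 0 < \<epsilon> j" "\<And>j. h j \<le> \<epsilon> j"
    and N: "\<And>j. 16 * 24 ^ CARD('d) \<le> real (N j) ^ CARD('d)"
    and info: "\<And>j. 8 * (real B * \<tau> j) * 24 ^ CARD('d) * (\<epsilon> j)\<^sup>2 \<le> \<sigma>\<^sup>2 * real (N j) ^ CARD('d)"
    unfolding hard_bumps_def by metis
  obtain j m where jm: "j < B" "m \<in> grid (N j)"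
    and prob: "3 / (8 * real B)
      \<le> \<P>((u, z) in law. regret A B T (F j m) (xs j m) u z \<ge> \<epsilon> j * \<tau> (Suc j) / 2)"
  proof (rule regret_lower_bound[where \<tau> = \<tau> and I = "\<lambda>j. grid (N j)" and C = "24 ^ CARD('d)"
        and F = F and xs = xs and \<epsilon> = \<epsilon>, OF B])
    show "\<tau> B \<le> real T" by (rule \<tau>(2))
    fix j
    note fam = fam[of j, unfolded bump_family_def]
    show "0 \<le> \<tau> j" by (rule \<tau>(1))
    show "finite (grid (N j) :: ('d \<Rightarrow> nat) set)" by (rule finite_grid)
    have "0 < real (N j) ^ CARD('d)"
      using N[of j] by (rule less_le_trans[rotated]) simp
    then have "card (grid (N j) :: ('d \<Rightarrow> nat) set) \<noteq> 0" by (simp add: card_grid)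
    then show "grid (N j) \<noteq> ({} :: ('d \<Rightarrow> nat) set)" by (metis card.empty)
    show "F j m \<in> borel_measurable borel" "F j m (xs j m) = \<epsilon> j" if "m \<in> grid (N j)" for m
      using fam that by auto
    show "F j m x \<le> \<epsilon> j" if "m \<in> grid (N j)" "x \<in> unit_cube" for m x
      using fam that by auto
    show "(\<Sum>m\<in>grid (N j). (F j m x)\<^sup>2) \<le> 24 ^ CARD('d) * (\<epsilon> j)\<^sup>2" if "x \<in> unit_cube" for x
      using fam that by auto
    show "0 < \<epsilon> j" by (rule \<epsilon>(1))
    show "16 * 24 ^ CARD('d) \<le> real (card (grid (N j) :: ('d \<Rightarrow> nat) set))"
      using N[of j] by (simp add: card_grid)
    show "8 * real B * \<tau> j * 24 ^ CARD('d) * (\<epsilon> j)\<^sup>2 \<le> \<sigma>\<^sup>2 * real (card (grid (N j) :: ('d \<Rightarrow> nat) set))"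
      using info[of j] by (simp add: card_grid mult.assoc)
  qed simp_all
  note fam = fam[of j, unfolded bump_family_def]
  let ?S = "\<lambda>\<rho>. {(u, z) \<in> space law. \<rho> \<le> regret A B T (F j m) (xs j m) u z}"
  have "law.prob (?S (\<epsilon> j * \<tau> (Suc j) / 2)) \<le> law.prob (?S \<rho>)"
  proof (rule law.finite_measure_mono)
    have "h j * \<tau> (Suc j) \<le> \<epsilon> j * \<tau> (Suc j)" by (intro mult_right_mono \<epsilon> \<tau>)
    then show "?S (\<epsilon> j * \<tau> (Suc j) / 2) \<subseteq> ?S \<rho>" using \<rho>[of j] by auto
    have S: "?S \<rho> = {\<omega> \<in> space law. \<rho> \<le> regret A B T (F j m) (xs j m) (fst \<omega>) (snd \<omega>)}" by auto
    have "F j m \<in> borel_measurable borel" using fam jm(2) by auto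
    from regret_measurable[OF this, of "xs j m"]
    show "?S \<rho> \<in> sets law" unfolding S by measurable
  qed
  moreover have "\<delta> \<le> 3 / (8 * real B)"
    using \<delta> B by (simp add: field_simps)
  ultimately have "\<delta> \<le> law.prob (?S \<rho>)" using prob by linarith
  then show ?thesis
    using fam jm(2) by (intro exI[of _ "F j m"] exI[of _ "xs j m"]) (auto simp: is_arg_max_def not_less)
qed

text \<open>400 exceeds 16 * 24, and 16 <= 16^d.\<close>

lemma four_hundred_power_ge:
  fixes N :: real
  assumes "0 < d" "400 \<le> N"
  shows "16 * 24 ^ d \<le> N ^ d"
proof -
  have "16 ^ 1 \<le> (16::real) ^ d" using assms by (intro power_increasing) auto
  then have "16 * 24 ^ d \<le> (16 * 24 :: real) ^ d"
    unfolding power_mult_distrib by (intro mult_right_mono) auto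
  also have "\<dots> \<le> N ^ d" using assms by (intro power_mono) auto
  finally show ?thesis .
qed

text \<open>The norm allows height \<epsilon> of order N powr (-\<nu>), and the information
  condition asks for w \<epsilon>^2 of order at most N^d. Both hold with N of order w powr (1/(2
  \<nu> + d)), which makes \<epsilon> of order w powr (-\<eta>).\<close>

lemma matern_stage:
  assumes l: "0 < l" and \<nu>: "0 < \<nu>" and \<Psi>: "0 < \<Psi>" and \<sigma>: "0 < \<sigma>"
  defines "\<eta> \<equiv> \<nu> / (2 * \<nu> + real CARD('d::finite))"
  shows "\<exists>c>0. \<forall>w\<ge>1.
    hard_bumps (matern_kernel \<nu> l :: 'd kernel) \<Psi> \<sigma> w (c * w powr (- \<eta>))"
proof -
  define d where "d = CARD('d)"
  have d: "0 < d" unfolding d_def by simp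
  define s where "s = 2 * \<nu> + real d"
  have s: "0 < s" unfolding s_def using \<nu> by simp
  define K where "K = 2 * Gamma \<nu> * exp (\<nu> / l\<^sup>2) / (\<nu> / (2 * l\<^sup>2)) powr \<nu>"
  have K: "0 < K" unfolding K_def using \<nu> l Gamma_real_pos[OF \<nu>] by simp
  define G where "G = 8 * 24 ^ d * \<Psi>\<^sup>2 / (K * \<sigma>\<^sup>2)"
  have G: "0 < G" unfolding G_def using K \<sigma> \<Psi> by simp
  \<comment> \<open>N is about Q w powr (1/s): the first bound supplies enough bumps, the second
    makes G w <= N powr s, which is the information condition with its constants collected in
    G.\<close>
  define Q where "Q = max 400 (G powr (1 / s))"
  have Q: "400 \<le> Q" "0 < Q" by (simp_all add: Q_def)
  have QG: "G \<le> Q powr s"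
  proof -
    have "G = (G powr (1 / s)) powr s" using G s by (simp add: powr_powr)
    also have "\<dots> \<le> Q powr s" using s by (intro powr_mono2) (auto simp: Q_def)
    finally show ?thesis .
  qed
  define c where "c = \<Psi> / sqrt K * (2 * Q) powr (- \<nu>)"
  have c: "0 < c" unfolding c_def using \<Psi> K Q by simp
  show ?thesis
  proof (intro exI[of _ c] conjI allI impI c)
    fix w :: real assume w: "1 \<le> w"
    define y where "y = w powr (1 / s)"
    have y: "1 \<le> y" unfolding y_def using w s by (simp add: ge_one_powr_ge_zero)
    define N where "N = nat \<lceil>Q * y\<rceil>"
    have Qy: "Q \<le> Q * y" using Q y by simp
    have N: "Q * y \<le> real N" "real N \<le> 2 * Q * y"
      using Q Qy unfolding N_def by linarith+
    have Npos: "0 < real N" "400 \<le> real N" using N Q Qy by linarith+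
    define \<epsilon> where "\<epsilon> = \<Psi> / sqrt K * real N powr (- \<nu>)"
    have \<epsilon>: "0 < \<epsilon>" unfolding \<epsilon>_def using \<Psi> K Npos by simp
    have \<epsilon>2: "\<epsilon>\<^sup>2 = \<Psi>\<^sup>2 / K * real N powr (- 2 * \<nu>)"
      unfolding \<epsilon>_def power_mult_distrib power_divide using K
      by (simp add: power2_eq_square powr_add[symmetric])
    have "\<epsilon>\<^sup>2 * (K * real N powr (2 * \<nu>)) = \<Psi>\<^sup>2 * (real N powr (- 2 * \<nu>) * real N powr (2 * \<nu>))"
      unfolding \<epsilon>2 using K by simp
    also have "real N powr (- 2 * \<nu>) * real N powr (2 * \<nu>) = 1"
      unfolding powr_add[symmetric] using Npos by simp
    finally obtain F xs where
      fam: "bump_family (matern_kernel \<nu> l :: 'd kernel) \<Psi> N \<epsilon> F xs"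
      using matern_bump_family[OF l \<nu>, of N \<Psi> \<epsilon>] Npos \<Psi> \<epsilon> unfolding K_def by auto
    have info: "8 * w * 24 ^ d * \<epsilon>\<^sup>2 \<le> \<sigma>\<^sup>2 * real N ^ d"
    proof -
      have "G * w \<le> Q powr s * w" using QG w by (intro mult_right_mono) auto
      also have "\<dots> = (Q * y) powr s"
        unfolding y_def using Q w s by (simp add: powr_mult powr_powr)
      also have "\<dots> \<le> real N powr s" using N Q y s by (intro powr_mono2) auto
      also have "\<dots> = real N powr (2 * \<nu>) * real N ^ d"
        unfolding s_def powr_add using Npos by (simp add: powr_realpow)
      finally have "G * w * real N powr (- 2 * \<nu>)
          \<le> real N powr (2 * \<nu>) * real N ^ d * real N powr (- 2 * \<nu>)"
        by (rule mult_right_mono) simp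
      also have "\<dots> = (real N powr (2 * \<nu>) * real N powr (- 2 * \<nu>)) * real N ^ d" by simp
      also have "real N powr (2 * \<nu>) * real N powr (- 2 * \<nu>) = 1"
        unfolding powr_add[symmetric] using Npos by simp
      finally have "\<sigma>\<^sup>2 * (G * w * real N powr (- 2 * \<nu>)) \<le> \<sigma>\<^sup>2 * real N ^ d"
        by (intro mult_left_mono) auto
      moreover have "\<sigma>\<^sup>2 * (G * w * real N powr (- 2 * \<nu>)) = 8 * w * 24 ^ d * \<epsilon>\<^sup>2"
        unfolding \<epsilon>2 G_def using \<sigma> by simp
      ultimately show ?thesis by (simp only:)
    qed
    have "c * w powr (- \<eta>) = \<Psi> / sqrt K * (2 * Q * y) powr (- \<nu>)"
    proof -
      have "w powr (- \<eta>) = y powr (- \<nu>)"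
        unfolding y_def \<eta>_def powr_powr by (simp add: s_def d_def)
      then show ?thesis unfolding c_def using Q y by (simp add: powr_mult)
    qed
    also have "\<dots> \<le> \<epsilon>"
      unfolding \<epsilon>_def using N \<nu> \<Psi> K Npos by (intro mult_left_mono powr_mono2') auto
    finally have "c * w powr (- \<eta>) \<le> \<epsilon>" .
    then show "hard_bumps (matern_kernel \<nu> l :: 'd kernel) \<Psi> \<sigma> w (c * w powr (- \<eta>))"
      using fam \<epsilon> info four_hundred_power_ge[OF d Npos(2)] unfolding hard_bumps_def d_def by blast
  qed
qed

lemma matern_lower_bound:
  assumes l: "0 < l" and \<nu>: "0 < \<nu>" and \<Psi>: "0 < \<Psi>" and \<sigma>: "0 < \<sigma>"
  defines "\<eta> \<equiv> \<nu> / (2 * \<nu> + real CARD('d::finite))"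
  shows "\<exists>c>0. \<exists>T0. \<forall>T\<ge>T0. \<forall>B. 2 \<le> B \<and> B \<le> T \<longrightarrow>
    (\<forall>A :: (real ^ 'd) batched_alg. batched_algorithm unit_cube T B A \<longrightarrow>
      (\<forall>\<delta>. 0 < \<delta> \<and> \<delta> < 1 / (11 * real B) \<longrightarrow>
        (\<exists>f xstar. in_rkhs_ball unit_cube (matern_kernel \<nu> l) \<Psi> f \<and>
          is_arg_max f (\<lambda>x. x \<in> unit_cube) xstar \<and>
          \<P>((u, z) in interaction_law A \<sigma> T. regret A B T f xstar u z
            \<ge> c * (real B powr (- (2 * \<eta> + 1)) * real T powr ((1 - \<eta>) / (1 - \<eta> ^ B)))) \<ge> \<delta>)))"
proof -
  have \<eta>: "0 < \<eta>" "\<eta> < 1"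
    unfolding \<eta>_def using \<nu> by (simp_all add: divide_less_eq add_pos_pos)
  obtain c where c: "0 < c" and stage: "\<forall>w\<ge>1.
    hard_bumps (matern_kernel \<nu> l :: 'd kernel) \<Psi> \<sigma> w (c * w powr (- \<eta>))"
    using matern_stage[OF l \<nu> \<Psi> \<sigma>, where 'd='d] unfolding \<eta>_def by blast
  have c2: "0 < c / 2" using c by simp
  show ?thesis
  proof (rule exI[of _ "c / 2"], rule conjI[OF c2], rule exI[of _ 0], intro allI impI, elim conjE)
    fix T B :: nat and \<delta> and A :: "(real ^ 'd) batched_alg"
    assume B: "2 \<le> B" "B \<le> T" and A: "batched_algorithm unit_cube T B A" and \<delta>: "\<delta> < 1 / (11 * real B)"
    \<comment> \<open>Solves \<tau> (j + 1) = K \<tau> j powr \<eta> with \<tau> 0 = 1 and \<tau> B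
      = T: the exponents are normalised partial geometric sums, and K is the target rate in
      T.\<close>
    define \<tau> where "\<tau> j = real T powr ((1 - \<eta> ^ j) / (1 - \<eta> ^ B))" for j
    have \<eta>B: "0 < 1 - \<eta> ^ B" using \<eta> B by (simp add: power_Suc_less_one power_less_one_iff)
    have \<tau>1: "1 \<le> \<tau> j" for j
      unfolding \<tau>_def using \<eta> \<eta>B B by (intro ge_one_powr_ge_zero divide_nonneg_pos) (auto simp: power_le_one)
    have \<tau>_Suc: "\<tau> (Suc j) = real T powr ((1 - \<eta>) / (1 - \<eta> ^ B)) * \<tau> j powr \<eta>" for j
      unfolding \<tau>_def powr_powr powr_add[symmetric] using \<eta>B
      by (simp add: field_simps)
    show "\<exists>f xstar. in_rkhs_ball unit_cube (matern_kernel \<nu> l) \<Psi> f \<and>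
        is_arg_max f (\<lambda>x. x \<in> unit_cube) xstar \<and>
        \<P>((u, z) in interaction_law A \<sigma> T. regret A B T f xstar u z
          \<ge> c / 2 * (real B powr (- (2 * \<eta> + 1)) * real T powr ((1 - \<eta>) / (1 - \<eta> ^ B)))) \<ge> \<delta>"
    proof (rule hard_instance[OF \<sigma> A _ \<delta>, where \<tau> = \<tau>])
      show "0 < B" using B by simp
      show "0 \<le> \<tau> j" for j using \<tau>1[of j] by simp
      show "\<tau> B \<le> real T" unfolding \<tau>_def using \<eta>B B by simp
      fix j
      have "1 * 1 \<le> real B * \<tau> j" using B \<tau>1[of j] by (intro mult_mono) auto
      then show "hard_bumps (matern_kernel \<nu> l :: 'd kernel) \<Psi> \<sigma> (real B * \<tau> j)
          (c * (real B * \<tau> j) powr (- \<eta>))"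
        using stage by simp
      \<comment> \<open>The construction loses only B powr (-\<eta>), through w = B \<tau> j; the
        stated power of B is smaller.\<close>
      have "c / 2 * (real B powr (- (2 * \<eta> + 1)) * real T powr ((1 - \<eta>) / (1 - \<eta> ^ B)))
          \<le> c / 2 * (real B powr (- \<eta>) * real T powr ((1 - \<eta>) / (1 - \<eta> ^ B)))"
        using c B \<eta> by (intro mult_left_mono mult_right_mono powr_mono) auto
      also have "\<dots> = c * (real B * \<tau> j) powr (- \<eta>) * \<tau> (Suc j) / 2"
      proof -
        have "\<tau> j powr (- \<eta>) * \<tau> j powr \<eta> = 1"
          unfolding powr_add[symmetric] using \<tau>1[of j] by simp
        then show ?thesis unfolding \<tau>_Suc using \<tau>1[of j] by (simp add: powr_mult)
      qed
      finally show "c / 2 * (real B powr (- (2 * \<eta> + 1)) * real T powr ((1 - \<eta>) / (1 - \<eta> ^ B)))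
        \<le> c * (real B * \<tau> j) powr (- \<eta>) * \<tau> (Suc j) / 2" .
    qed
  qed
qed

text \<open>Nothing is observed before the first batch. With \<tau> 0 = 0, hence w = 0, the
  information condition is vacuous, and a fixed grid with bumps of constant height will do.\<close>

lemma se_first_stage:
  assumes l: "0 < l" and \<Psi>: "0 < \<Psi>"
  shows "\<exists>h>0. hard_bumps (se_kernel l :: 'd::finite kernel) \<Psi> \<sigma> 0 h"
proof -
  define N :: nat where "N = 400"
  define U where "U = (pi / (2 * l\<^sup>2)) ^ CARD('d) * exp (real CARD('d) * l\<^sup>2 * (real N)\<^sup>2)"
  have U: "0 < U" unfolding U_def using l by simp
  define \<epsilon> where "\<epsilon> = \<Psi> / sqrt U"
  have \<epsilon>: "0 < \<epsilon>" unfolding \<epsilon>_def using \<Psi> U by simp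
  have "\<epsilon>\<^sup>2 * U \<le> \<Psi>\<^sup>2" unfolding \<epsilon>_def using U by (simp add: power_divide)
  then have "\<exists>F xs. bump_family (se_kernel l :: 'd kernel) \<Psi> N \<epsilon> F xs"
    using \<epsilon> \<Psi> l unfolding U_def by (intro se_bump_family) (auto simp: N_def)
  moreover have "16 * 24 ^ CARD('d) \<le> real N ^ CARD('d)"
    unfolding N_def by (rule four_hundred_power_ge) auto
  ultimately show ?thesis using \<epsilon> unfolding hard_bumps_def by (intro exI[of _ \<epsilon>]) auto
qed

text \<open>With N of order sqrt L, the information condition allows \<epsilon>^2 of order L powr
  (d/2) / w, at most L powr (d/2) exp (-L/2), while the norm multiplies it by at most exp (L/4) up
  to a constant. The product tends to 0, so it falls below \<Psi>^2 for large L; L will be ln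
  T.\<close>

lemma se_stage:
  assumes l: "0 < l" and \<Psi>: "0 < \<Psi>" and \<sigma>: "0 < \<sigma>"
  shows "\<exists>c>0. \<exists>L0. \<forall>L\<ge>L0. \<forall>w\<ge>exp (L / 2).
    hard_bumps (se_kernel l :: 'd::finite kernel) \<Psi> \<sigma> w (c * sqrt (sqrt L ^ CARD('d) / w))"
proof -
  define d where "d = CARD('d)"
  have d: "0 < d" unfolding d_def by simp
  \<comment> \<open>Chosen so that d l^2 r^2 = 1/4: grids with N <= r sqrt L cost at most exp (L/4),
    half of the exponent available.\<close>
  define r where "r = 1 / (2 * sqrt (real d) * l)"
  have r: "0 < r" unfolding r_def using d l by simp
  have r2: "real d * l\<^sup>2 * r\<^sup>2 = 1/4"
    unfolding r_def using d l by (simp add: power_divide power_mult_distrib)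
  define U where "U = (pi / (2 * l\<^sup>2)) ^ d"
  have U: "0 < U" unfolding U_def using l by simp
  \<comment> \<open>With \<epsilon>^2 = \<kappa> N^d / w the information condition holds with
    equality.\<close>
  define \<kappa> where "\<kappa> = \<sigma>\<^sup>2 / (8 * 24 ^ d)"
  have \<kappa>: "0 < \<kappa>" unfolding \<kappa>_def using \<sigma> by simp
  define c where "c = sqrt (\<kappa> * (r / 2) ^ d)"
  have c: "0 < c" unfolding c_def using \<kappa> r by simp
  have "((\<lambda>L. L powr (real d / 2) * exp (- L / 4)) \<longlongrightarrow> 0) at_top"
    by real_asymp
  then have "((\<lambda>L. \<kappa> * U * r ^ d * (L powr (real d / 2) * exp (- L / 4))) \<longlongrightarrow> 0) at_top"
    by (rule tendsto_mult_right_zero)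
  then have "\<forall>\<^sub>F L in at_top. \<kappa> * U * r ^ d * (L powr (real d / 2) * exp (- L / 4)) < \<Psi>\<^sup>2"
    by (rule order_tendstoD(2)) (use \<Psi> in simp)
  moreover have "\<forall>\<^sub>F L in at_top. 401 / r \<le> sqrt L"
    by (rule filterlim_at_top[THEN iffD1, rule_format, OF sqrt_at_top])
  ultimately have "\<forall>\<^sub>F L in at_top. 401 / r \<le> sqrt L
      \<and> \<kappa> * U * r ^ d * (L powr (real d / 2) * exp (- L / 4)) < \<Psi>\<^sup>2"
    by eventually_elim simp
  then obtain L0 where L0: "\<And>L. L \<ge> L0 \<Longrightarrow> 401 / r \<le> sqrt L"
    "\<And>L. L \<ge> L0 \<Longrightarrow> \<kappa> * U * r ^ d * (L powr (real d / 2) * exp (- L / 4)) < \<Psi>\<^sup>2"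
    unfolding eventually_at_top_linorder by blast
  show ?thesis
  proof (rule exI[of _ c], rule conjI[OF c], rule exI[of _ L0], intro allI impI)
    fix L w :: real assume L: "L0 \<le> L" and w: "exp (L / 2) \<le> w"
    have w0: "0 < w" using w exp_gt_zero[of "L / 2"] by linarith
    define N where "N = nat \<lfloor>r * sqrt L\<rfloor>"
    \<comment> \<open>The floor N is then at least 400 and at least half of r sqrt L.\<close>
    have rL: "401 \<le> r * sqrt L" using L0(1)[OF L] r by (simp add: divide_le_eq mult.commute)
    have Lpos: "0 < L"
    proof (rule ccontr)
      assume "\<not> 0 < L"
      then have "r * sqrt L \<le> 0" using r by (simp add: mult_nonneg_nonpos)
      then show False using rL by simp
    qed
    have N: "r * sqrt L / 2 \<le> real N" "real N \<le> r * sqrt L" "400 \<le> real N"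
      using rL unfolding N_def by linarith+
    define \<epsilon> where "\<epsilon> = sqrt (\<kappa> * real N ^ d / w)"
    have \<epsilon>: "0 < \<epsilon>" unfolding \<epsilon>_def using \<kappa> w0 N by simp
    have \<epsilon>2: "\<epsilon>\<^sup>2 = \<kappa> * real N ^ d / w"
      unfolding \<epsilon>_def using \<kappa> w0 by simp
    have "(real N)\<^sup>2 \<le> (r * sqrt L)\<^sup>2" using N by (intro power_mono) auto
    then have "real d * l\<^sup>2 * (real N)\<^sup>2 \<le> real d * l\<^sup>2 * (r\<^sup>2 * L)"
      using Lpos by (intro mult_left_mono) (auto simp: power_mult_distrib)
    also have "\<dots> = L / 4" using r2 by (simp add: mult.assoc[symmetric])
    finally have expN: "exp (real d * l\<^sup>2 * (real N)\<^sup>2) \<le> exp (L / 4)" by simp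
    have sqrtL: "sqrt L ^ d = L powr (real d / 2)"
      using Lpos by (simp add: powr_half_sqrt[symmetric] powr_realpow[symmetric] powr_powr)
    have "\<epsilon>\<^sup>2 * (U * exp (real d * l\<^sup>2 * (real N)\<^sup>2)) \<le> (\<kappa> * (r * sqrt L) ^ d / exp (L / 2)) * (U * exp (L / 4))"
      unfolding \<epsilon>2 using \<kappa> U w w0 N expN
      by (intro mult_mono frac_le mult_left_mono power_mono) auto
    also have "\<dots> = \<kappa> * U * r ^ d * (L powr (real d / 2) * (exp (L / 4) / exp (L / 2)))"
      unfolding power_mult_distrib sqrtL by simp
    also have "exp (L / 4) / exp (L / 2) = exp (- L / 4)"
      unfolding exp_diff[symmetric] by simp
    also have "\<kappa> * U * r ^ d * (L powr (real d / 2) * exp (- L / 4)) \<le> \<Psi>\<^sup>2"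
      using L0(2)[OF L] by simp
    finally obtain F xs where fam: "bump_family (se_kernel l :: 'd kernel) \<Psi> N \<epsilon> F xs"
      using se_bump_family[OF l, of N \<Psi> \<epsilon>] N \<epsilon> \<Psi> unfolding U_def d_def by auto
    have info: "8 * w * 24 ^ d * \<epsilon>\<^sup>2 \<le> \<sigma>\<^sup>2 * real N ^ d"
      unfolding \<epsilon>2 \<kappa>_def using w0 by simp
    have "c * sqrt (sqrt L ^ d / w) = sqrt (\<kappa> * (r * sqrt L / 2) ^ d / w)"
      unfolding c_def real_sqrt_mult[symmetric] by (simp add: power_mult_distrib power_divide)
    also have "\<dots> \<le> \<epsilon>"
      unfolding \<epsilon>_def using N \<kappa> w0 rL
      by (intro real_sqrt_le_mono divide_right_mono mult_left_mono power_mono) auto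
    finally have "c * sqrt (sqrt L ^ d / w) \<le> \<epsilon>" .
    then show "hard_bumps (se_kernel l :: 'd kernel) \<Psi> \<sigma> w
        (c * sqrt (sqrt L ^ CARD('d) / w))"
      using fam \<epsilon> info four_hundred_power_ge[OF d N(3)] unfolding hard_bumps_def d_def by blast
  qed
qed

text \<open>The height at a stage j >= 1 is of order sqrt (exp \<mu> / (B \<tau> j)) with exp \<mu>
  = (ln T) powr (d/2). Equal products with \<tau> (j + 1) give an affine recursion of ratio 1/2 for
  ln (\<tau> j), with fixed point 2 r - \<mu>; this is the closed form used for \<tau>.\<close>

lemma se_lower_bound:
  assumes l: "0 < l" and \<Psi>: "0 < \<Psi>" and \<sigma>: "0 < \<sigma>"
  defines "\<eta> \<equiv> 1 / 2 :: real" and "d \<equiv> real CARD('d::finite)"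
  shows "\<exists>c>0. \<exists>T0. \<forall>T\<ge>T0. \<forall>B. 2 \<le> B \<and> B \<le> T \<longrightarrow>
    (\<forall>A :: (real ^ 'd) batched_alg. batched_algorithm unit_cube T B A \<longrightarrow>
      (\<forall>\<delta>. 0 < \<delta> \<and> \<delta> < 1 / (11 * real B) \<longrightarrow>
        (\<exists>f xstar. in_rkhs_ball unit_cube (se_kernel l) \<Psi> f \<and>
          is_arg_max f (\<lambda>x. x \<in> unit_cube) xstar \<and>
          \<P>((u, z) in interaction_law A \<sigma> T. regret A B T f xstar u z
            \<ge> c * (real B powr (- 2) * real T powr ((1 - \<eta>) / (1 - \<eta> ^ B))
              * ln (real T) powr (d * \<eta> * (\<eta> - \<eta> ^ B) / (1 - \<eta> ^ B)))) \<ge> \<delta>)))"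
proof -
  obtain h\<^sub>0 where h\<^sub>0: "0 < h\<^sub>0" "hard_bumps (se_kernel l :: 'd kernel) \<Psi> \<sigma> 0 h\<^sub>0"
    using se_first_stage[OF l \<Psi>, where 'd='d] by blast
  obtain c L0 where c: "0 < c" and stage: "\<And>L w. L0 \<le> L \<Longrightarrow> exp (L / 2) \<le> w \<Longrightarrow>
    hard_bumps (se_kernel l :: 'd kernel) \<Psi> \<sigma> w (c * sqrt (sqrt L ^ CARD('d) / w))"
    using se_stage[OF l \<Psi> \<sigma>, where 'd='d] by blast
  have "\<forall>\<^sub>F T in sequentially. L0 \<le> ln (real T)" "\<forall>\<^sub>F T in sequentially. 1 \<le> ln (real T)"
    "\<forall>\<^sub>F T in sequentially. d / 2 * ln (ln (real T)) \<le> ln (real T) / 2"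
    by real_asymp+
  then have "\<forall>\<^sub>F T in sequentially. L0 \<le> ln (real T) \<and> 1 \<le> ln (real T)
      \<and> d / 2 * ln (ln (real T)) \<le> ln (real T) / 2"
    by eventually_elim simp
  then obtain T0 where T0: "\<And>T. T0 \<le> T \<Longrightarrow> L0 \<le> ln (real T)" "\<And>T. T0 \<le> T \<Longrightarrow> 1 \<le> ln (real T)"
    "\<And>T. T0 \<le> T \<Longrightarrow> d / 2 * ln (ln (real T)) \<le> ln (real T) / 2"
    unfolding eventually_sequentially by blast
  define c' where "c' = min h\<^sub>0 c / 2"
  have c': "0 < c'" unfolding c'_def using c h\<^sub>0(1) by simp
  show ?thesis
  proof (rule exI[of _ c'], rule conjI[OF c'], rule exI[of _ T0], intro allI impI, elim conjE)
    fix T B :: nat and \<delta> and A :: "(real ^ 'd) batched_alg"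
    assume T: "T0 \<le> T" and B: "2 \<le> B" and A: "batched_algorithm unit_cube T B A"
      and \<delta>: "\<delta> < 1 / (11 * real B)"
    define L where "L = ln (real T)"
    define \<mu> where "\<mu> = d / 2 * ln L"
    define r where "r = (1/2 * L + \<mu> * (1/2 - (1/2) ^ B)) / (1 - (1/2) ^ B)"
    have L: "L0 \<le> L" "1 \<le> L" "\<mu> \<le> L / 2"
      using T0[OF T] unfolding L_def \<mu>_def by auto
    have Tpos: "0 < real T" using L(2) unfolding L_def by (cases "T = 0") auto
    have \<mu>0: "0 \<le> \<mu>" unfolding \<mu>_def d_def using L by simp
    have half: "(1/2 :: real) ^ B \<le> 1/2"
      using B power_decreasing[of 1 B "1/2 :: real"] by simp
    then have \<eta>B: "0 < 1 - (1/2 :: real) ^ B" by linarith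
    have r_eq: "r * (1 - (1/2) ^ B) = 1/2 * L + \<mu> * (1/2 - (1/2) ^ B)"
      unfolding r_def using \<eta>B by simp
    have r_ge: "L / 2 \<le> r"
    proof -
      have "L / 2 * (1 - (1/2) ^ B) \<le> L / 2 * 1" using L by (intro mult_left_mono) auto
      also have "\<dots> \<le> r * (1 - (1/2) ^ B)" unfolding r_eq using \<mu>0 half by simp
      finally show ?thesis using \<eta>B by (simp only: mult_le_cancel_right_pos)
    qed
    have exp_r: "exp r = real T powr ((1 - \<eta>) / (1 - \<eta> ^ B))
        * ln (real T) powr (d * \<eta> * (\<eta> - \<eta> ^ B) / (1 - \<eta> ^ B))"
    proof -
      have "real T powr ((1 - \<eta>) / (1 - \<eta> ^ B)) * ln (real T) powr (d * \<eta> * (\<eta> - \<eta> ^ B) / (1 - \<eta> ^ B))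
        = exp ((1 - \<eta>) / (1 - \<eta> ^ B) * L + d * \<eta> * (\<eta> - \<eta> ^ B) / (1 - \<eta> ^ B) * ln L)"
        using Tpos L(2) unfolding exp_add powr_def L_def[symmetric] by simp
      also have "(1 - \<eta>) / (1 - \<eta> ^ B) * L + d * \<eta> * (\<eta> - \<eta> ^ B) / (1 - \<eta> ^ B) * ln L = r"
        unfolding r_def \<mu>_def \<eta>_def using \<eta>B by (simp add: add_divide_distrib)
      finally show ?thesis by simp
    qed
    \<comment> \<open>\<open>\<tau> 1 = exp r\<close>, \<open>\<tau> (j + 1) = exp r * sqrt (\<tau> j / exp \<mu>)\<close>, and \<open>r\<close> is chosen to give \<open>\<tau> B = T\<close>\<close>
    define \<tau> where "\<tau> j = (if j = 0 then 0
      else exp (2 * r * (1 - (1/2) ^ j) - \<mu> * (1 - 2 * (1/2) ^ j)))" for j :: nat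
    let ?\<rho> = "c' * (real B powr (- 2) * real T powr ((1 - \<eta>) / (1 - \<eta> ^ B))
            * ln (real T) powr (d * \<eta> * (\<eta> - \<eta> ^ B) / (1 - \<eta> ^ B)))"
    \<comment> \<open>The construction loses only the square root of B, through the height; the
      stated power B powr (-2) is smaller.\<close>
    have \<rho>_le: "?\<rho> \<le> c' * (real B powr (- 1/2) * exp r)"
      unfolding exp_r using c' B by (simp add: mult.assoc mult_right_mono powr_mono)
    show "\<exists>f xstar. in_rkhs_ball unit_cube (se_kernel l) \<Psi> f \<and>
        is_arg_max f (\<lambda>x. x \<in> unit_cube) xstar \<and>
        \<P>((u, z) in interaction_law A \<sigma> T. regret A B T f xstar u z \<ge> ?\<rho>) \<ge> \<delta>"
    proof (rule hard_instance[OF \<sigma> A _ \<delta>, where \<tau> = \<tau>])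
      show "0 < B" using B by simp
      show "0 \<le> \<tau> j" for j by (simp add: \<tau>_def)
      have "2 * r * (1 - (1/2) ^ B) - \<mu> * (1 - 2 * (1/2) ^ B) = L"
        using r_eq by (simp add: algebra_simps)
      then show "\<tau> B \<le> real T" unfolding \<tau>_def using B Tpos by (simp add: L_def)
      fix j
      define h where "h j = (if j = 0 then h\<^sub>0
        else c * sqrt (sqrt L ^ CARD('d) / (real B * \<tau> j)))" for j
      have "hard_bumps (se_kernel l :: 'd kernel) \<Psi> \<sigma> (real B * \<tau> j) (h j)
        \<and> ?\<rho> \<le> h j * \<tau> (Suc j) / 2"
      proof (cases "j = 0")
        case True
        have "?\<rho> \<le> c' * (1 * exp r)"
          using \<rho>_le c' B powr_mono[of "- 1/2" 0 "real B"]
          by (elim order_trans) (intro mult_left_mono mult_right_mono, auto)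
        also have "\<dots> \<le> h\<^sub>0 / 2 * exp r"
          unfolding c'_def by (simp add: mult_right_mono)
        also have "\<dots> = h j * \<tau> (Suc j) / 2" unfolding \<tau>_def h_def True by simp
        finally have "?\<rho> \<le> h j * \<tau> (Suc j) / 2" .
        moreover have "real B * \<tau> j = 0" "h j = h\<^sub>0" unfolding \<tau>_def h_def True by simp_all
        ultimately show ?thesis using h\<^sub>0(2) by (simp only:)
      next
        case False
        define q where "q = (1/2 :: real) ^ j"
        have q: "0 < q" "q \<le> 1/2"
          unfolding q_def using False power_decreasing[of 1 j "1/2 :: real"] by auto
        define g where "g = 2 * r * (1 - q) - \<mu> * (1 - 2 * q)"
        have \<tau>j: "\<tau> j = exp g" unfolding \<tau>_def g_def q_def using False by simp
        have \<tau>j': "\<tau> (Suc j) = exp (r + g / 2 - \<mu> / 2)"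
          unfolding \<tau>_def g_def by (simp add: q_def field_simps)
        \<comment> \<open>g = r + (r - \<mu>) (1 - 2 q), and r >= L/2 >= \<mu>; hence g >= L/2, so
          every stage after the first meets the requirement w >= exp (L/2) of
          \<open>se_stage\<close>.\<close>
        have "0 \<le> (r - \<mu>) * (1 - 2 * q)"
          using r_ge L(3) q by (intro mult_nonneg_nonneg) auto
        then have "L / 2 \<le> g" using r_ge unfolding g_def by (simp add: algebra_simps)
        then have "1 * exp (L / 2) \<le> real B * \<tau> j"
          unfolding \<tau>j using B by (intro mult_mono) auto
        then have bumps: "hard_bumps (se_kernel l :: 'd kernel) \<Psi> \<sigma> (real B * \<tau> j) (h j)"
          using stage[OF L(1)] False by (simp add: h_def)
        have "sqrt L ^ CARD('d) = exp \<mu>"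
          unfolding \<mu>_def d_def using L(2)
          by (simp add: powr_half_sqrt[symmetric] powr_realpow[symmetric] powr_powr powr_def)
        then have "sqrt L ^ CARD('d) / (real B * \<tau> j) = exp (\<mu> - g - ln (real B))"
          using B unfolding \<tau>j by (simp add: exp_diff)
        then have h_eq: "h j = c * exp ((\<mu> - g - ln (real B)) / 2)"
          using False by (simp add: h_def powr_half_sqrt[symmetric] powr_def)
        have "?\<rho> \<le> c' * (real B powr (- 1/2) * exp r)" by (rule \<rho>_le)
        also have "\<dots> \<le> c / 2 * (real B powr (- 1/2) * exp r)"
          unfolding c'_def by (intro mult_right_mono) auto
        also have "real B powr (- 1/2) * exp r = exp ((\<mu> - g - ln (real B)) / 2) * exp (r + g / 2 - \<mu> / 2)"
        proof -
          have "real B powr (- 1/2) = exp (- 1/2 * ln (real B))" using B by (simp add: powr_def)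
          moreover have "- 1/2 * ln (real B) + r = (\<mu> - g - ln (real B)) / 2 + (r + g / 2 - \<mu> / 2)"
            by (simp add: field_simps)
          ultimately show ?thesis by (simp only: exp_add[symmetric])
        qed
        finally have "?\<rho> \<le> h j * \<tau> (Suc j) / 2" unfolding h_eq \<tau>j' by simp
        then show ?thesis using bumps by blast
      qed
      then show "hard_bumps (se_kernel l :: 'd kernel) \<Psi> \<sigma> (real B * \<tau> j) (h j)"
        "?\<rho> \<le> h j * \<tau> (Suc j) / 2" by blast+
    qed
  qed
qed

theorem corollary1:
  fixes l \<nu> \<Psi> \<sigma> :: real
  assumes "0 < l" and "0 < \<nu>" and "0 < \<Psi>" and "0 < \<sigma>"
  shows
    "(let \<eta> = 1 / 2; d = real CARD('d::finite)
      in \<exists>c>0. \<exists>T0. \<forall>T\<ge>T0. \<forall>B. 2 \<le> B \<and> B \<le> T \<longrightarrow>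
        (\<forall>A :: (real ^ 'd) batched_alg. batched_algorithm unit_cube T B A \<longrightarrow>
          (\<forall>\<delta>. 0 < \<delta> \<and> \<delta> < 1 / (11 * real B) \<longrightarrow>
            (\<exists>f xstar.
               in_rkhs_ball unit_cube (se_kernel l) \<Psi> f \<and>
               is_arg_max f (\<lambda>x. x \<in> unit_cube) xstar \<and>
               \<P>((u, z) in interaction_law A \<sigma> T.
                   regret A B T f xstar u z
                     \<ge> c * (real B powr (- 2)
                             * real T powr ((1 - \<eta>) / (1 - \<eta> ^ B))
                             * ln (real T) powr (d * \<eta> * (\<eta> - \<eta> ^ B) / (1 - \<eta> ^ B))))
                 \<ge> \<delta>))))
     \<and>
     (let d = real CARD('d); \<eta> = \<nu> / (2 * \<nu> + d)
      in \<exists>c>0. \<exists>T0. \<forall>T\<ge>T0. \<forall>B. 2 \<le> B \<and> B \<le> T \<longrightarrow>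
        (\<forall>A :: (real ^ 'd) batched_alg. batched_algorithm unit_cube T B A \<longrightarrow>
          (\<forall>\<delta>. 0 < \<delta> \<and> \<delta> < 1 / (11 * real B) \<longrightarrow>
            (\<exists>f xstar.
               in_rkhs_ball unit_cube (matern_kernel \<nu> l) \<Psi> f \<and>
               is_arg_max f (\<lambda>x. x \<in> unit_cube) xstar \<and>
               \<P>((u, z) in interaction_law A \<sigma> T.
                   regret A B T f xstar u z
                     \<ge> c * (real B powr (- (2 * \<eta> + 1))
                             * real T powr ((1 - \<eta>) / (1 - \<eta> ^ B))))
                 \<ge> \<delta>))))"
  unfolding Let_def
  using se_lower_bound[OF assms(1,3,4), where 'd='d] matern_lower_bound[OF assms, where 'd='d]
  by (rule conjI)

end
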